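(* Let $\Omega\subset\mathbb R^n$ ($n\ge 1$) be a bounded domain with $C^2$ boundary, and let $M\in C^2([0,+\infty))$ be real-valued. Let $m\in\mathbb N^+$ and $\{t_j\}_{j=1}^m\subset(0,+\infty)$. For $y_0\in L^2(\Omega)$ let $y(\cdot;y_0)$ be the solution of the heat equation with memory kernel $M$ and initial datum $y_0$. Then the following two statements are equivalent: (i) There are nonempty open subsets $\omega_1,\dots,\omega_m$ of $\overline\Omega$ (in the relative topology) and a constant $C>0$ such that for every $y_0\in L^2(\Omega)$, $$C^{-1}\|y_0\|_{\mathcal H^{-4}}\le \sum_{j=1}^m\|y(t_j;y_0)\|_{L^2(\omega_j)}\le C\|y_0\|_{\mathcal H^{-4}}.$$ (ii) The equation has the backward uniqueness at $\{t_j\}_{j=1}^m$ (i.e., whenever $y_0\in L^2(\Omega)$ satisfies $y(t_j;y_0)=0$ in $L^2(\Omega)$ for each $j=1,\dots,m$, then $y_0=0$), and $$\sum_{j=1}^m|M(t_j)|>0.$$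
   Context: $\mathbb N^+=\{1,2,3,\dots\}$. The heat equation with memory kernel $M$ is $$\partial_t y-\Delta y+\int_0^t M(t-s)y(s,x)\,ds=0 \text{ in } (0,+\infty)\times\Omega,\qquad y=0 \text{ on } (0,+\infty)\times\partial\Omega,\qquad y(0,\cdot)=y_0 \text{ in }\Omega.$$ For $y_0\in L^2(\Omega)$ it has a unique (mild) solution $y(\cdot;y_0)\in C([0,+\infty);L^2(\Omega))$. Let $A$ be the Dirichlet Laplacian on $L^2(\Omega)$: $Af=\Delta f$ for $f\in H^2(\Omega)\cap H^1_0(\Omega)$. Let $(\lambda_k)_{k\ge1}$ be the eigenvalues of $-A$ (counted with multiplicity) and $(e_k)_{k\ge1}$ corresponding eigenfunctions forming an orthonormal basis of $L^2(\Omega)$. For $s\in\mathbb R$, $\mathcal H^s$ is the Hilbert space of all (formal) series $\sum_{k\ge1}a_ke_k$ with $a_k\in\mathbb R$ and $\sum_{k\ge1}a_k^2\lambda_k^s<+\infty$, with norm $\|\sum_k a_ke_k\|_{\mathcal H^s}=(\sum_k a_k^2\lambda_k^s)^{1/2}$. *)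

theory Defs
  imports "HOL-Analysis.Analysis"
begin

section \<open>Classical smoothness and domains with \<open>C\<^sup>2\<close> boundary\<close>

definition partial :: "'n::finite \<Rightarrow> (real^'n \<Rightarrow> real) \<Rightarrow> real^'n \<Rightarrow> real" where
  "partial i f x = frechet_derivative f (at x) (axis i 1)"

text \<open>Used for open \<open>U\<close> only.\<close>

primrec Ck_on :: "nat \<Rightarrow> (real^'n::finite) set \<Rightarrow> (real^'n \<Rightarrow> real) \<Rightarrow> bool" where
  "Ck_on 0 U f \<longleftrightarrow> continuous_on U f"
| "Ck_on (Suc k) U f \<longleftrightarrow> f differentiable_on U \<and> (\<forall>i. Ck_on k U (partial i f))"

text \<open>
  Near each boundary point, after relabelling and reorienting the coordinate axes, \<open>\<Omega>\<close> is the
  region above the graph of a \<open>C\<^sup>2\<close> function of the remaining \<open>n - 1\<close> coordinates. Such a function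
  is encoded as a function on \<open>\<real>\<^sup>n\<close> that does not depend on the \<open>i\<close>-th coordinate; for
  \<open>n = 1\<close> it is a constant.
\<close>

definition C2_boundary :: "(real^'n::finite) set \<Rightarrow> bool" where
  "C2_boundary \<Omega> \<longleftrightarrow>
     (\<forall>p\<in>frontier \<Omega>. \<exists>r>0. \<exists>(i::'n) \<sigma> \<gamma>.
        \<sigma> \<in> {1, -1} \<and> Ck_on 2 UNIV \<gamma> \<and>
        (\<forall>x z. (\<forall>j. j \<noteq> i \<longrightarrow> x $ j = z $ j) \<longrightarrow> \<gamma> x = \<gamma> z) \<and>
        \<Omega> \<inter> ball p r = {x \<in> ball p r. \<sigma> * x $ i > \<gamma> x})"

definition bounded_C2_domain :: "(real^'n::finite) set \<Rightarrow> bool" where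
  "bounded_C2_domain \<Omega> \<longleftrightarrow>
     open \<Omega> \<and> connected \<Omega> \<and> \<Omega> \<noteq> {} \<and> bounded \<Omega> \<and> C2_boundary \<Omega>"

definition C2_halfline :: "(real \<Rightarrow> real) \<Rightarrow> bool" where
  "C2_halfline M \<longleftrightarrow>
     (\<exists>M' M''. (\<forall>t\<ge>0. (M has_real_derivative M' t) (at t within {0..})) \<and>
               (\<forall>t\<ge>0. (M' has_real_derivative M'' t) (at t within {0..})) \<and>
               continuous_on {0..} M'')"


section \<open>The space \<open>L\<^sup>2(\<Omega>)\<close>\<close>

text \<open>
  Elements of \<open>L\<^sup>2(\<Omega>)\<close> are represented by functions on \<open>\<real>\<^sup>n\<close>. Values outside \<open>\<Omega>\<close> and on null sets
  are irrelevant, and equality in \<open>L\<^sup>2(\<Omega>)\<close> is equality almost everywhere in \<open>\<Omega>\<close>.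
\<close>

definition L2 :: "(real^'n::finite) set \<Rightarrow> (real^'n \<Rightarrow> real) set" where
  "L2 \<Omega> = {f. f \<in> borel_measurable (lebesgue_on \<Omega>) \<and> integrable (lebesgue_on \<Omega>) (\<lambda>x. (f x)\<^sup>2)}"

definition L2_inner :: "(real^'n::finite) set \<Rightarrow> (real^'n \<Rightarrow> real) \<Rightarrow> (real^'n \<Rightarrow> real) \<Rightarrow> real" where
  "L2_inner \<Omega> f g = (LINT x|lebesgue_on \<Omega>. f x * g x)"

definition L2_norm :: "(real^'n::finite) set \<Rightarrow> (real^'n \<Rightarrow> real) \<Rightarrow> real" where
  "L2_norm \<Omega> f = sqrt (LINT x|lebesgue_on \<Omega>. (f x)\<^sup>2)"

definition L2_eq :: "(real^'n::finite) set \<Rightarrow> (real^'n \<Rightarrow> real) \<Rightarrow> (real^'n \<Rightarrow> real) \<Rightarrow> bool" where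
  "L2_eq \<Omega> f g \<longleftrightarrow> (AE x in lebesgue_on \<Omega>. f x = g x)"

text \<open>
  The integral of an \<open>L\<^sup>2(\<Omega>)\<close>-valued function over \<open>[a,b]\<close>: the library's gauge-integral definition
  (\<open>has_integral\<close> on an interval), with convergence of the Riemann sums in the norm of \<open>L\<^sup>2(\<Omega>)\<close>.
  For functions continuous into \<open>L\<^sup>2(\<Omega>)\<close>, the only ones integrated below, it is the Riemann and
  the Bochner integral. It is spelled out because \<open>L\<^sup>2(\<Omega>)\<close> is not a type here.
\<close>

definition has_L2_integral ::
  "(real^'n::finite) set \<Rightarrow> (real \<Rightarrow> real^'n \<Rightarrow> real) \<Rightarrow> (real^'n \<Rightarrow> real) \<Rightarrow> real \<Rightarrow> real \<Rightarrow> bool" where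
  "has_L2_integral \<Omega> F g a b \<longleftrightarrow>
     (\<forall>s\<in>{a..b}. F s \<in> L2 \<Omega>) \<and> g \<in> L2 \<Omega> \<and>
     (\<forall>\<epsilon>>0. \<exists>\<delta>. gauge \<delta> \<and>
        (\<forall>D. D tagged_division_of {a..b} \<and> \<delta> fine D \<longrightarrow>
             L2_norm \<Omega> (\<lambda>x. (\<Sum>(s,K)\<in>D. measure lborel K * F s x) - g x) < \<epsilon>))"


section \<open>Sobolev spaces and the Dirichlet Laplacian\<close>

definition test_functions :: "(real^'n::finite) set \<Rightarrow> (real^'n \<Rightarrow> real) set" where
  "test_functions \<Omega> =
     {\<phi>. (\<forall>k. Ck_on k UNIV \<phi>) \<and> compact (closure {x. \<phi> x \<noteq> 0}) \<and> closure {x. \<phi> x \<noteq> 0} \<subseteq> \<Omega>}"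

definition weak_partial ::
  "(real^'n::finite) set \<Rightarrow> 'n \<Rightarrow> (real^'n \<Rightarrow> real) \<Rightarrow> (real^'n \<Rightarrow> real) \<Rightarrow> bool" where
  "weak_partial \<Omega> i f g \<longleftrightarrow>
     (\<forall>\<phi>\<in>test_functions \<Omega>. L2_inner \<Omega> f (partial i \<phi>) = - L2_inner \<Omega> g \<phi>)"

definition H1 :: "(real^'n::finite) set \<Rightarrow> (real^'n \<Rightarrow> real) set" where
  "H1 \<Omega> = {f \<in> L2 \<Omega>. \<forall>i. \<exists>g\<in>L2 \<Omega>. weak_partial \<Omega> i f g}"

definition H2 :: "(real^'n::finite) set \<Rightarrow> (real^'n \<Rightarrow> real) set" where
  "H2 \<Omega> = {f \<in> L2 \<Omega>. \<forall>i. \<exists>g\<in>H1 \<Omega>. weak_partial \<Omega> i f g}"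

text \<open>The closure of the test functions in \<open>H\<^sup>1(\<Omega>)\<close>; \<open>g\<close> is the weak gradient of \<open>f\<close>.\<close>

definition H10 :: "(real^'n::finite) set \<Rightarrow> (real^'n \<Rightarrow> real) set" where
  "H10 \<Omega> = {f \<in> H1 \<Omega>. \<exists>g \<phi>.
     (\<forall>i. g i \<in> L2 \<Omega> \<and> weak_partial \<Omega> i f (g i)) \<and>
     (\<forall>m::nat. \<phi> m \<in> test_functions \<Omega>) \<and>
     (\<lambda>m. L2_norm \<Omega> (\<lambda>x. \<phi> m x - f x)) \<longlonglongrightarrow> 0 \<and>
     (\<forall>i. (\<lambda>m. L2_norm \<Omega> (\<lambda>x. partial i (\<phi> m) x - g i x)) \<longlonglongrightarrow> 0)}"

definition weak_laplacian ::
  "(real^'n::finite) set \<Rightarrow> (real^'n \<Rightarrow> real) \<Rightarrow> (real^'n \<Rightarrow> real) \<Rightarrow> bool" where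
  "weak_laplacian \<Omega> f h \<longleftrightarrow>
     (\<exists>g g'. (\<forall>i. g i \<in> L2 \<Omega> \<and> weak_partial \<Omega> i f (g i) \<and>
                  g' i \<in> L2 \<Omega> \<and> weak_partial \<Omega> i (g i) (g' i)) \<and>
             L2_eq \<Omega> h (\<lambda>x. \<Sum>i\<in>UNIV. g' i x))"

text \<open>The graph of \<open>A\<close>: \<open>f\<close> belongs to \<open>D(A) = H\<^sup>2(\<Omega>) \<inter> H\<^sup>1\<^sub>0(\<Omega>)\<close> and \<open>Af = h\<close>.\<close>

definition dirichlet_laplacian ::
  "(real^'n::finite) set \<Rightarrow> (real^'n \<Rightarrow> real) \<Rightarrow> (real^'n \<Rightarrow> real) \<Rightarrow> bool" where
  "dirichlet_laplacian \<Omega> f h \<longleftrightarrow> f \<in> H2 \<Omega> \<inter> H10 \<Omega> \<and> h \<in> L2 \<Omega> \<and> weak_laplacian \<Omega> f h"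

text \<open>
  Eigenvalues of \<open>-A\<close>, repeated according to multiplicity, with an orthonormal basis of
  eigenfunctions. The index \<open>k\<close> starts at \<open>0\<close> instead of \<open>1\<close>, and no ordering is imposed.
\<close>

definition dirichlet_eigenbasis ::
  "(real^'n::finite) set \<Rightarrow> (nat \<Rightarrow> real) \<Rightarrow> (nat \<Rightarrow> real^'n \<Rightarrow> real) \<Rightarrow> bool" where
  "dirichlet_eigenbasis \<Omega> lam e \<longleftrightarrow>
     (\<forall>k. e k \<in> L2 \<Omega> \<and> dirichlet_laplacian \<Omega> (e k) (\<lambda>x. - (lam k * e k x))) \<and>
     (\<forall>j k. L2_inner \<Omega> (e j) (e k) = (if j = k then 1 else 0)) \<and>
     (\<forall>f\<in>L2 \<Omega>. (\<lambda>N. L2_norm \<Omega> (\<lambda>x. f x - (\<Sum>k<N. L2_inner \<Omega> f (e k) * e k x))) \<longlonglongrightarrow> 0)"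

text \<open>
  The norm of the formal series with coefficients \<open>a\<close> in the space of order \<open>s\<close>; a function
  \<open>f\<close> in \<open>L\<^sup>2(\<Omega>)\<close> is the series with coefficients \<open>\<langle>f, e\<^sub>k\<rangle>\<close>. For \<open>s \<le> 0\<close> the sum converges for
  every such \<open>f\<close>, as the eigenvalues are bounded below by a positive number.
\<close>

definition Hs_norm :: "(nat \<Rightarrow> real) \<Rightarrow> real \<Rightarrow> (nat \<Rightarrow> real) \<Rightarrow> real" where
  "Hs_norm lam s a = sqrt (\<Sum>k. (a k)\<^sup>2 * lam k powr s)"


section \<open>The heat equation with memory\<close>

text \<open>\<open>S\<close> is the strongly continuous semigroup on \<open>L\<^sup>2(\<Omega>)\<close> whose generator is \<open>A\<close>.\<close>

definition dirichlet_heat_semigroup ::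
  "(real^'n::finite) set \<Rightarrow> (real \<Rightarrow> (real^'n \<Rightarrow> real) \<Rightarrow> real^'n \<Rightarrow> real) \<Rightarrow> bool" where
  "dirichlet_heat_semigroup \<Omega> S \<longleftrightarrow>
     (\<forall>t\<ge>0. \<forall>f\<in>L2 \<Omega>. S t f \<in> L2 \<Omega>) \<and>
     (\<forall>t\<ge>0. \<forall>f\<in>L2 \<Omega>. \<forall>g\<in>L2 \<Omega>. \<forall>c.
        L2_eq \<Omega> (S t (\<lambda>x. f x + c * g x)) (\<lambda>x. S t f x + c * S t g x)) \<and>
     (\<forall>t\<ge>0. \<exists>K. \<forall>f\<in>L2 \<Omega>. L2_norm \<Omega> (S t f) \<le> K * L2_norm \<Omega> f) \<and>
     (\<forall>f\<in>L2 \<Omega>. L2_eq \<Omega> (S 0 f) f) \<and>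
     (\<forall>s\<ge>0. \<forall>t\<ge>0. \<forall>f\<in>L2 \<Omega>. L2_eq \<Omega> (S (s + t) f) (S s (S t f))) \<and>
     (\<forall>f\<in>L2 \<Omega>. ((\<lambda>t. L2_norm \<Omega> (\<lambda>x. S t f x - f x)) \<longlongrightarrow> 0) (at_right 0)) \<and>
     (\<forall>f\<in>L2 \<Omega>. \<forall>h\<in>L2 \<Omega>. dirichlet_laplacian \<Omega> f h \<longleftrightarrow>
        ((\<lambda>t. L2_norm \<Omega> (\<lambda>x. (S t f x - f x) / t - h x)) \<longlongrightarrow> 0) (at_right 0))"

text \<open>
  The mild solution: \<open>y\<close> in \<open>C([0,\<infinity>); L\<^sup>2(\<Omega>))\<close> with
  \<open>y(t) = S(t) y\<^sub>0 - \<integral>\<^sub>0\<^sup>t S(t - s) w(s) ds\<close> and \<open>w(s) = \<integral>\<^sub>0\<^sup>s M(s - \<tau>) y(\<tau>) d\<tau>\<close>.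
\<close>

definition mild_solution ::
  "(real^'n::finite) set \<Rightarrow> (real \<Rightarrow> real) \<Rightarrow> (real^'n \<Rightarrow> real) \<Rightarrow> (real \<Rightarrow> real^'n \<Rightarrow> real) \<Rightarrow> bool" where
  "mild_solution \<Omega> M y0 y \<longleftrightarrow>
     (\<forall>t\<ge>0. y t \<in> L2 \<Omega>) \<and>
     (\<forall>t\<ge>0. ((\<lambda>s. L2_norm \<Omega> (\<lambda>x. y s x - y t x)) \<longlongrightarrow> 0) (at t within {0..})) \<and>
     (\<exists>S w. dirichlet_heat_semigroup \<Omega> S \<and>
        (\<forall>s\<ge>0. has_L2_integral \<Omega> (\<lambda>\<tau> x. M (s - \<tau>) * y \<tau> x) (w s) 0 s) \<and>
        (\<forall>t\<ge>0. \<exists>z. has_L2_integral \<Omega> (\<lambda>s. S (t - s) (w s)) z 0 t \<and>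
                     L2_eq \<Omega> (y t) (\<lambda>x. S t y0 x - z x)))"

text \<open>\<open>Y y0\<close> stands for the solution with initial datum \<open>y0\<close>.\<close>

definition backward_uniqueness ::
  "(real^'n::finite) set \<Rightarrow> ((real^'n \<Rightarrow> real) \<Rightarrow> real \<Rightarrow> real^'n \<Rightarrow> real) \<Rightarrow> real set \<Rightarrow> bool" where
  "backward_uniqueness \<Omega> Y T \<longleftrightarrow>
     (\<forall>y0\<in>L2 \<Omega>. (\<forall>t\<in>T. L2_eq \<Omega> (Y y0 t) (\<lambda>x. 0)) \<longrightarrow> L2_eq \<Omega> y0 (\<lambda>x. 0))"

end

theory Submission
  imports Defs "HOL-Real_Asymp.Real_Asymp"
begin

text \<open>
  In the eigenbasis the equation decouples: the \<open>k\<close>-th coefficient of \<open>y(t)\<close> is that of \<open>y\<^sub>0\<close> times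
  a multiplier \<open>u\<^sub>k(t)\<close>, where \<open>u\<^sub>k' + \<lambda>\<^sub>k u\<^sub>k + M * u\<^sub>k = 0\<close> and \<open>u\<^sub>k(0) = 1\<close>, with \<open>*\<close> for
  convolution. For large \<open>\<lambda>\<^sub>k\<close> the function \<open>u\<^sub>k\<close> has an initial layer of mass about \<open>1/\<lambda>\<^sub>k\<close>, so that \<open>M * u\<^sub>k\<close> is close to
  \<open>M/\<lambda>\<^sub>k\<close> and \<open>\<lambda>\<^sub>k\<^sup>2 u\<^sub>k(t) \<rightarrow> -M(t)\<close> for every \<open>t > 0\<close>. If some \<open>M(t\<^sub>j)\<close> is nonzero, the numbers
  \<open>\<Sum>\<^sub>j u\<^sub>k(t\<^sub>j)\<^sup>2\<close> are comparable to \<open>\<lambda>\<^sub>k\<^sup>-\<^sup>4\<close> for all but finitely many \<open>k\<close>, and backward uniqueness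
  makes the remaining ones positive; one may then take every \<open>\<omega>\<^sub>j\<close> to be the closure of \<open>\<Omega>\<close>.
  Conversely, the lower estimate gives backward uniqueness at once, and applied to \<open>e\<^sub>k\<close> with
  \<open>k \<rightarrow> \<infinity>\<close> it excludes that all \<open>M(t\<^sub>j)\<close> vanish. That \<open>\<lambda>\<^sub>k > 0\<close> and \<open>\<lambda>\<^sub>k \<rightarrow> \<infinity>\<close> follows from
  estimates for translations of test functions.
\<close>

section \<open>A scalar Volterra equation\<close>

text \<open>Two factors \<open>1 / l\<close> make up the rate. The initial layer has mass about
  \<open>1 / l\<close>, so \<open>w T\<close> is about \<open>M T / l\<close>; the Duhamel kernel
  \<open>exp (-(l * (T - s)))\<close> again has mass about \<open>1 / l\<close> and sits at
  \<open>s = T\<close>, where it picks out \<open>w T\<close>. Squared in Parseval's series this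
  gives the weight of order -4. All errors are explicit in \<open>l\<close>, since one threshold has
  to serve every mode at once. Three features of the definitions shape the rest.
  \<open>mild_solution\<close> provides integral identities only, so a mode is a pair of integral
  equations and is never differentiated. The family \<open>Y\<close> is some choice of mild
  solutions, so the multiplier form of its coefficients comes from uniqueness for the scalar
  equation. The semigroup \<open>S\<close> is a witness hidden in \<open>mild_solution\<close> and
  known through its axioms alone, so its action on \<open>e k\<close> has to be derived from the
  generator. The eigenvalues carry no order. Their divergence is therefore stated as finiteness of
  \<open>{k. lam k \<le> L}\<close>, and asymptotic bounds become global ones through a finite
  exceptional set.\<close>

lemma has_integral_exp_back:
  fixes l t :: real
  assumes "l > 0" "t \<ge> 0"
  shows "((\<lambda>s. exp (-(l * (t - s)))) has_integral (1 - exp (-(l * t))) / l) {0..t}"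
proof -
  have "((\<lambda>s. exp (-(l * (t - s)))) has_integral
      exp (-(l * (t - t))) / l - exp (-(l * (t - 0))) / l) {0..t}"
    using assms
    by (intro fundamental_theorem_of_calculus)
      (auto simp: has_real_derivative_iff_has_vector_derivative[symmetric]
        intro!: derivative_eq_intros)
  then show ?thesis by (simp add: diff_divide_distrib)
qed

lemma has_integral_exp:
  fixes l t :: real
  assumes "l > 0" "t \<ge> 0"
  shows "((\<lambda>s. exp (-(l * s))) has_integral (1 - exp (-(l * t))) / l) {0..t}"
proof -
  have "((\<lambda>s. exp (-(l * s))) has_integral
      - exp (-(l * t)) / l - (- exp (-(l * 0)) / l)) {0..t}"
    using assms
    by (intro fundamental_theorem_of_calculus)
      (auto simp: has_real_derivative_iff_has_vector_derivative[symmetric]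
        intro!: derivative_eq_intros)
  then show ?thesis by (simp add: diff_divide_distrib)
qed

text \<open>The layers \<open>exp (-(l * s))\<close> and \<open>exp (-(l * (t - s)))\<close> have
  mass of order \<open>1 / l\<close>; their first moments gain another \<open>1 / l\<close>. This is
  why replacing a Lipschitz factor by its value at the layer costs only a lower order.\<close>

lemma
  fixes l t :: real
  assumes "l > 0" "t \<ge> 0"
  shows integrable_mult_exp: "(\<lambda>s. s * exp (-(l * s))) integrable_on {0..t}"
    and integral_mult_exp_le: "integral {0..t} (\<lambda>s. s * exp (-(l * s))) \<le> 1 / l\<^sup>2"
    and integrable_mult_exp_back: "(\<lambda>s. (t - s) * exp (-(l * (t - s)))) integrable_on {0..t}"
    and integral_mult_exp_back_le:
      "integral {0..t} (\<lambda>s. (t - s) * exp (-(l * (t - s)))) \<le> 1 / l\<^sup>2"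
proof -
  define F where "F u = - exp (-(l * u)) * (u / l + 1 / l\<^sup>2)" for u
  have "((\<lambda>s. s * exp (-(l * s))) has_integral F t - F 0) {0..t}"
    using assms unfolding F_def
    by (intro fundamental_theorem_of_calculus)
      (auto simp: has_real_derivative_iff_has_vector_derivative[symmetric] field_simps
        power2_eq_square intro!: derivative_eq_intros)
  moreover have "F t - F 0 \<le> 1 / l\<^sup>2"
    using assms by (simp add: F_def)
  ultimately show "(\<lambda>s. s * exp (-(l * s))) integrable_on {0..t}"
    "integral {0..t} (\<lambda>s. s * exp (-(l * s))) \<le> 1 / l\<^sup>2"
    by (auto simp: integral_unique)
  define G where "G s = exp (-(l * (t - s))) * ((t - s) / l + 1 / l\<^sup>2)" for s
  have "((\<lambda>s. (t - s) * exp (-(l * (t - s)))) has_integral G t - G 0) {0..t}"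
    using assms unfolding G_def
    by (intro fundamental_theorem_of_calculus)
      (auto simp: has_real_derivative_iff_has_vector_derivative[symmetric] field_simps
        power2_eq_square intro!: derivative_eq_intros)
  moreover have "G t - G 0 \<le> 1 / l\<^sup>2"
    using assms by (simp add: G_def)
  ultimately show "(\<lambda>s. (t - s) * exp (-(l * (t - s)))) integrable_on {0..t}"
    "integral {0..t} (\<lambda>s. (t - s) * exp (-(l * (t - s)))) \<le> 1 / l\<^sup>2"
    by (auto simp: integral_unique)
qed

text \<open>The mild formulation paired with one eigenfunction of eigenvalue \<open>l\<close>:
  \<open>c\<close> is the coefficient of the solution, \<open>a\<close> that of the initial datum,
  \<open>w\<close> that of the memory term, and \<open>c_integral\<close> is Duhamel's formula
  solved for its integral. Stating both identities with \<open>has_integral\<close> carries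
  integrability along.\<close>

locale memory_mode =
  fixes M :: "real \<Rightarrow> real" and l a T m :: real and c w :: "real \<Rightarrow> real"
  assumes l_pos: "l > 0" and T_pos: "T > 0"
    and M_bound: "\<And>s. s \<in> {0..T} \<Longrightarrow> \<bar>M s\<bar> \<le> m"
    and c_cont: "continuous_on {0..T} c"
    and w_integral: "\<And>s. s \<in> {0..T} \<Longrightarrow> ((\<lambda>\<tau>. M (s - \<tau>) * c \<tau>) has_integral w s) {0..s}"
    and c_integral: "\<And>t. t \<in> {0..T} \<Longrightarrow>
      ((\<lambda>s. exp (-(l * (t - s))) * w s) has_integral exp (-(l * t)) * a - c t) {0..t}"
begin

definition J where "J t = integral {0..t} (\<lambda>s. \<bar>c s\<bar>)"

lemma m_nonneg: "0 \<le> m"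
  using M_bound[of 0] T_pos by auto

lemma abs_c_integrable: "0 \<le> s \<Longrightarrow> t \<le> T \<Longrightarrow> (\<lambda>s. \<bar>c s\<bar>) integrable_on {s..t}"
  by (intro integrable_continuous_interval continuous_on_rabs continuous_on_subset[OF c_cont]) auto

lemma J_nonneg: "0 \<le> t \<Longrightarrow> t \<le> T \<Longrightarrow> 0 \<le> J t"
  unfolding J_def by (intro Henstock_Kurzweil_Integration.integral_nonneg abs_c_integrable) auto

lemma J_mono: "0 \<le> s \<Longrightarrow> s \<le> t \<Longrightarrow> t \<le> T \<Longrightarrow> J s \<le> J t"
  unfolding J_def by (intro integral_subset_le abs_c_integrable) auto

lemma abs_w_le:
  assumes "s \<in> {0..T}"
  shows "\<bar>w s\<bar> \<le> m * J s"
proof -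
  have "norm (integral {0..s} (\<lambda>\<tau>. M (s - \<tau>) * c \<tau>)) \<le> integral {0..s} (\<lambda>\<tau>. m * \<bar>c \<tau>\<bar>)"
    using assms w_integral[OF assms]
    by (intro integral_norm_bound_integral integrable_on_mult_right abs_c_integrable)
      (auto simp: abs_mult intro!: mult_right_mono M_bound)
  then show ?thesis
    using integral_unique[OF w_integral[OF assms]] by (simp add: J_def)
qed

text \<open>On \<open>{0..t}\<close> the memory term is at most \<open>m * J t\<close> because
  \<open>J\<close> is monotone, and the Duhamel kernel has mass at most
  \<open>1 / l\<close>.\<close>

lemma abs_c_diff_le:
  assumes "t \<in> {0..T}"
  shows "\<bar>c t - exp (-(l * t)) * a\<bar> \<le> m / l * J t"
proof -
  have exp: "((\<lambda>s. m * J t * exp (-(l * (t - s)))) has_integral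
      m * J t * ((1 - exp (-(l * t))) / l)) {0..t}"
    using assms l_pos by (intro has_integral_mult_right has_integral_exp_back) auto
  have "norm (integral {0..t} (\<lambda>s. exp (-(l * (t - s))) * w s))
      \<le> integral {0..t} (\<lambda>s. m * J t * exp (-(l * (t - s))))"
  proof (intro integral_norm_bound_integral)
    fix s assume s: "s \<in> {0..t}"
    have "\<bar>w s\<bar> \<le> m * J t"
      using abs_w_le[of s] mult_left_mono[OF J_mono[of s t] m_nonneg] s assms by auto
    then show "norm (exp (-(l * (t - s))) * w s) \<le> m * J t * exp (-(l * (t - s)))"
      by (simp add: abs_mult mult.commute mult_left_mono)
  qed (use exp c_integral[OF assms] in auto)
  also have "\<dots> = m * J t * ((1 - exp (-(l * t))) / l)"
    using exp by (rule integral_unique)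
  also have "\<dots> \<le> m * J t * (1 / l)"
    using m_nonneg J_nonneg[of t] assms l_pos
    by (intro mult_left_mono mult_nonneg_nonneg divide_right_mono) auto
  finally show ?thesis
    using integral_unique[OF c_integral[OF assms]] by (simp add: abs_minus_commute)
qed

text \<open>Gronwall: with \<open>a = 0\<close> the previous bound reads
  \<open>\<bar>c s\<bar> \<le> K * J s\<close>, and \<open>J\<close> has derivative
  \<open>\<bar>c s\<bar>\<close>, so \<open>exp (-(K * s)) * J s\<close> cannot increase from its
  initial value 0.\<close>

lemma unique_zero:
  assumes "a = 0" "t \<in> {0..T}"
  shows "c t = 0"
proof -
  define K where "K = m / l"
  have le: "\<bar>c s\<bar> \<le> K * J s" if "s \<in> {0..T}" for s
    using abs_c_diff_le[OF that] assms by (simp add: K_def)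
  have deriv: "(J has_real_derivative \<bar>c s\<bar>) (at s within {0..T})" if "s \<in> {0..T}" for s
    unfolding J_def using that
    by (intro integral_has_real_derivative continuous_on_rabs c_cont)
  have "exp (-(K * t)) * J t \<le> exp (-(K * 0)) * J 0"
  proof (cases "t = 0")
    case False
    show ?thesis
    proof (rule DERIV_nonpos_imp_decreasing_open[where f = "\<lambda>s. exp (-(K * s)) * J s"])
      show "0 \<le> t" using assms by simp
    next
      fix s assume st: "0 < s" "s < t"
      show "\<exists>y. ((\<lambda>s. exp (-(K * s)) * J s) has_real_derivative y) (at s) \<and> y \<le> 0"
      proof (intro exI conjI)
        have s: "s \<in> {0..T}" "0 < s" "s < T" using st assms by auto
        have "(J has_real_derivative \<bar>c s\<bar>) (at s)"
          using deriv[OF s(1)] at_within_Icc_at[OF s(2,3)] by simp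
        then show "((\<lambda>s. exp (-(K * s)) * J s) has_real_derivative
            exp (-(K * s)) * (\<bar>c s\<bar> - K * J s)) (at s)"
          by (auto intro!: derivative_eq_intros simp: algebra_simps)
        show "exp (-(K * s)) * (\<bar>c s\<bar> - K * J s) \<le> 0"
          using le[OF s(1)] by (simp add: mult_le_0_iff)
      qed
    next
      have "continuous_on {0..T} J"
        using deriv by (rule DERIV_continuous_on)
      then show "continuous_on {0..t} (\<lambda>s. exp (-(K * s)) * J s)"
        using assms by (intro continuous_intros) (auto elim: continuous_on_subset)
    qed
  qed simp
  moreover have "J 0 = 0" by (simp add: J_def)
  ultimately have "J t \<le> 0" by (simp add: mult_le_0_iff)
  then have "J t = 0" using J_nonneg[of t] assms by auto
  then show ?thesis using le[of t] assms by simp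
qed

end

section \<open>Asymptotics of a normalised mode for large \<open>l\<close>\<close>

locale large_memory_mode = memory_mode M l 1 T m c w
  for M :: "real \<Rightarrow> real" and l T m :: real and c w :: "real \<Rightarrow> real" +
  fixes L :: real
  assumes Lipschitz: "\<And>s s'. s \<in> {0..T} \<Longrightarrow> s' \<in> {0..T} \<Longrightarrow> \<bar>M s - M s'\<bar> \<le> L * \<bar>s - s'\<bar>"
    and l_large: "2 * m * T \<le> l"
begin

lemma L_nonneg: "0 \<le> L"
proof -
  have "0 \<le> \<bar>M 0 - M T\<bar>" by simp
  also have "\<dots> \<le> L * T" using Lipschitz[of 0 T] T_pos by simp
  finally show ?thesis using T_pos by (simp add: zero_le_mult_iff)
qed

text \<open>Integrating \<open>\<bar>c s\<bar> \<le> exp (-(l * s)) + m / l * J T\<close> over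
  \<open>{0..T}\<close> gives \<open>J T \<le> 1 / l + (m * T / l) * J T\<close>. The locale's
  condition \<open>2 * m * T \<le> l\<close> makes the last factor at most 1/2, so that term is
  absorbed on the left.\<close>

lemma J_le: "t \<in> {0..T} \<Longrightarrow> J t \<le> 2 / l"
proof -
  assume t: "t \<in> {0..T}"
  have exp: "((\<lambda>s. exp (-(l * s)) + m / l * J T) has_integral
      ((1 - exp (-(l * T))) / l + T * (m / l * J T))) {0..T}"
    using T_pos l_pos has_integral_const_real[of "m / l * J T" 0 T]
    by (intro has_integral_add has_integral_exp) auto
  have "J T \<le> integral {0..T} (\<lambda>s. exp (-(l * s)) + m / l * J T)"
    unfolding J_def
  proof (intro integral_le)
    fix s assume s: "s \<in> {0..T}"
    have "m / l * J s \<le> m / l * J T"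
      using s m_nonneg l_pos by (intro mult_left_mono J_mono) auto
    then show "\<bar>c s\<bar> \<le> exp (-(l * s)) + m / l * integral {0..T} (\<lambda>s. \<bar>c s\<bar>)"
      using abs_c_diff_le[OF s] unfolding J_def[symmetric] by (simp add: abs_le_iff)
        (use exp_gt_zero[of "- (l * s)"] in linarith)
  qed (use exp in \<open>auto simp: J_def[symmetric] intro: abs_c_integrable\<close>)
  also have "\<dots> = (1 - exp (-(l * T))) / l + T * (m / l * J T)"
    using exp by (rule integral_unique)
  also have "\<dots> \<le> 1 / l + (2 * m * T) / (2 * l) * J T"
    using l_pos by (simp add: field_simps)
  also have "\<dots> \<le> 1 / l + l / (2 * l) * J T"
    using l_pos l_large J_nonneg[of T] T_pos
    by (intro add_left_mono mult_right_mono divide_right_mono) auto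
  finally have "J T \<le> 2 / l" using l_pos by (simp add: field_simps)
  then show ?thesis using J_mono[of t T] t by auto
qed

lemma abs_c_diff_exp_le:
  assumes "t \<in> {0..T}"
  shows "\<bar>c t - exp (-(l * t))\<bar> \<le> 2 * m / l\<^sup>2"
proof -
  have "\<bar>c t - exp (-(l * t))\<bar> \<le> m / l * J t"
    using abs_c_diff_le[OF assms] by simp
  also have "\<dots> \<le> m / l * (2 / l)"
    using assms m_nonneg l_pos by (intro mult_left_mono J_le) auto
  finally show ?thesis by (simp add: power2_eq_square mult.commute)
qed

text \<open>Cutting the convolution at \<open>s\<close>: on \<open>{0..s}\<close> the kernel is
  shifted by \<open>T - s\<close>, a Lipschitz error against the mass \<open>2 / l\<close> of
  \<open>c\<close>; on \<open>{s..T}\<close> the integrand is bounded pointwise. The layer term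
  \<open>exp (-(l * s))\<close> is kept because it is not small near \<open>s = 0\<close>.\<close>

lemma abs_w_diff_le:
  assumes "0 \<le> s" "s \<le> T"
  shows "\<bar>w T - w s\<bar> \<le> (T - s) * (m * exp (-(l * s)) + (2 * m\<^sup>2 / l\<^sup>2 + 2 * L / l))"
proof -
  define f where "f \<tau> = M (T - \<tau>) * c \<tau>" for \<tau>
  have f_int: "(f has_integral w T) {0..T}"
    unfolding f_def using w_integral[of T] T_pos by simp
  have int: "f integrable_on {0..s}" "f integrable_on {s..T}"
    using f_int assms by (auto intro: integrable_subinterval_real dest: has_integral_integrable)
  have ws: "((\<lambda>\<tau>. M (s - \<tau>) * c \<tau>) has_integral w s) {0..s}"
    using w_integral assms by simp
  have "w T - w s = (integral {0..s} f - w s) + integral {s..T} f"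
    using Henstock_Kurzweil_Integration.integral_combine[of 0 s T f] f_int assms
    by (auto simp: integral_unique dest: has_integral_integrable)
  moreover have "\<bar>integral {0..s} f - w s\<bar> \<le> (T - s) * (2 * L / l)"
  proof -
    have diff: "((\<lambda>\<tau>. f \<tau> - M (s - \<tau>) * c \<tau>) has_integral integral {0..s} f - w s) {0..s}"
      using int(1) ws by (intro has_integral_diff integrable_integral)
    have "norm (integral {0..s} (\<lambda>\<tau>. f \<tau> - M (s - \<tau>) * c \<tau>))
        \<le> integral {0..s} (\<lambda>\<tau>. L * (T - s) * \<bar>c \<tau>\<bar>)"
    proof (intro integral_norm_bound_integral integrable_on_mult_right abs_c_integrable)
      fix \<tau> assume "\<tau> \<in> {0..s}"
      then have "\<bar>M (T - \<tau>) - M (s - \<tau>)\<bar> \<le> L * (T - s)"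
        using Lipschitz[of "T - \<tau>" "s - \<tau>"] assms by auto
      then show "norm (f \<tau> - M (s - \<tau>) * c \<tau>) \<le> L * (T - s) * \<bar>c \<tau>\<bar>"
        by (simp add: f_def left_diff_distrib[symmetric] abs_mult mult_right_mono)
    qed (use diff assms in auto)
    also have "\<dots> = L * (T - s) * J s"
      by (simp add: J_def)
    also have "\<dots> \<le> L * (T - s) * (2 / l)"
      using assms L_nonneg by (intro mult_left_mono J_le) auto
    finally show ?thesis using integral_unique[OF diff] by (simp add: mult_ac)
  qed
  moreover have "\<bar>integral {s..T} f\<bar> \<le> (T - s) * (m * (exp (-(l * s)) + 2 * m / l\<^sup>2))"
  proof -
    have "norm (integral {s..T} f)
        \<le> integral {s..T} (\<lambda>\<tau>. m * (exp (-(l * s)) + 2 * m / l\<^sup>2))"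
    proof (intro integral_norm_bound_integral int)
      fix \<tau> assume \<tau>: "\<tau> \<in> {s..T}"
      have "exp (-(l * \<tau>)) \<le> exp (-(l * s))"
        using \<tau> l_pos by simp
      then have "\<bar>c \<tau>\<bar> \<le> exp (-(l * s)) + 2 * m / l\<^sup>2"
        using abs_c_diff_exp_le[of \<tau>] \<tau> assms exp_gt_zero[of "-(l * \<tau>)"]
        unfolding atLeastAtMost_iff by linarith
      then show "norm (f \<tau>) \<le> m * (exp (-(l * s)) + 2 * m / l\<^sup>2)"
        unfolding f_def using \<tau> assms m_nonneg
        by (auto simp: abs_mult intro!: mult_mono M_bound)
    qed (rule integrable_const_ivl)
    then show ?thesis using assms by (simp add: mult.left_commute[of m])
  qed
  ultimately have "\<bar>w T - w s\<bar> \<le> (T - s) * (2 * L / l)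
      + (T - s) * (m * (exp (-(l * s)) + 2 * m / l\<^sup>2))" by linarith
  then show ?thesis by (simp add: algebra_simps power2_eq_square)
qed

text \<open>Freezing \<open>w\<close> at \<open>T\<close> in Duhamel's formula, whose kernel
  concentrates there. The factor \<open>T - s\<close> from \<open>abs_w_diff_le\<close> turns the
  mass of the kernel into its first moment, which is of order \<open>1 / l\<^sup>2\<close>.\<close>

lemma duhamel_error:
  "\<bar>exp (-(l * T)) - c T - w T * ((1 - exp (-(l * T))) / l)\<bar>
    \<le> m * exp (-(l * T)) * T\<^sup>2 + (2 * m\<^sup>2 / l\<^sup>2 + 2 * L / l) / l\<^sup>2"
proof -
  define D where "D = 2 * m\<^sup>2 / l\<^sup>2 + 2 * L / l"
  have D: "0 \<le> D" using L_nonneg l_pos by (simp add: D_def)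
  have T: "T \<in> {0..T}" using T_pos by simp
  define h where "h s = exp (-(l * (T - s))) * w s - w T * exp (-(l * (T - s)))" for s
  have h_int: "(h has_integral exp (-(l * T)) - c T - w T * ((1 - exp (-(l * T))) / l)) {0..T}"
    unfolding h_def using c_integral[OF T] T_pos l_pos
    by (intro has_integral_diff has_integral_mult_right has_integral_exp_back) auto
  define g where "g s = m * exp (-(l * T)) * T + D * ((T - s) * exp (-(l * (T - s))))" for s
  have g_int: "(g has_integral T * (m * exp (-(l * T)) * T)
      + D * integral {0..T} (\<lambda>s. (T - s) * exp (-(l * (T - s))))) {0..T}"
    unfolding g_def using T_pos l_pos has_integral_const_real[of "m * exp (-(l * T)) * T" 0 T]
    by (intro has_integral_add has_integral_mult_right integrable_integral
        integrable_mult_exp_back) auto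
  have "norm (integral {0..T} h) \<le> integral {0..T} g"
  proof (rule integral_norm_bound_integral)
    fix s assume s: "s \<in> {0..T}"
    have "norm (h s) = exp (-(l * (T - s))) * \<bar>w T - w s\<bar>"
      by (simp add: h_def abs_mult mult.commute[of "w T"] right_diff_distrib[symmetric]
          abs_minus_commute)
    also have "\<dots> \<le> exp (-(l * (T - s))) * ((T - s) * (m * exp (-(l * s)) + D))"
      using abs_w_diff_le[of s] s unfolding D_def by (intro mult_left_mono) auto
    also have "\<dots> = (T - s) * (m * (exp (-(l * (T - s))) * exp (-(l * s))))
        + D * ((T - s) * exp (-(l * (T - s))))"
      by (simp add: algebra_simps)
    \<comment> \<open>Near \<open>s = 0\<close>, where the layer term is large, the Duhamel kernel
      is exponentially small; the product does not depend on \<open>s\<close>.\<close>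
    also have "exp (-(l * (T - s))) * exp (-(l * s)) = exp (-(l * T))"
      by (simp add: exp_add[symmetric] algebra_simps)
    also have "(T - s) * (m * exp (-(l * T))) \<le> T * (m * exp (-(l * T)))"
      using s m_nonneg by (intro mult_right_mono) auto
    finally show "norm (h s) \<le> g s"
      by (simp add: g_def mult_ac)
  qed (use h_int g_int in auto)
  also have "\<dots> \<le> T * (m * exp (-(l * T)) * T) + D * (1 / l\<^sup>2)"
    unfolding integral_unique[OF g_int]
    using D integral_mult_exp_back_le[of l T] l_pos T_pos
    by (intro add_left_mono mult_left_mono) auto
  finally show ?thesis
    unfolding integral_unique[OF h_int] D_def[symmetric]
    by (simp add: power2_eq_square mult_ac)
qed

text \<open>Freezing the kernel at \<open>M T\<close>: the mode lives near \<open>s = 0\<close>, so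
  the Lipschitz error \<open>L * s * \<bar>c s\<bar>\<close> is controlled by the first moment of
  the layer plus the remainder \<open>2 * m / l\<^sup>2\<close> from
  \<open>abs_c_diff_exp_le\<close>.\<close>

lemma w_error:
  "\<bar>w T - M T * integral {0..T} c\<bar> \<le> L * (1 + 2 * m * T\<^sup>2) / l\<^sup>2"
proof -
  have T: "T \<in> {0..T}" using T_pos by simp
  have c_int: "c integrable_on {0..T}"
    by (intro integrable_continuous_interval c_cont)
  have diff: "((\<lambda>s. M (T - s) * c s - M T * c s) has_integral
      w T - M T * integral {0..T} c) {0..T}"
    using w_integral[OF T] c_int
    by (intro has_integral_diff has_integral_mult_right integrable_integral)
  have bound: "((\<lambda>s. L * (s * exp (-(l * s)) + T * (2 * m / l\<^sup>2))) has_integral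
      L * (integral {0..T} (\<lambda>s. s * exp (-(l * s))) + T * (T * (2 * m / l\<^sup>2)))) {0..T}"
    using T_pos l_pos has_integral_const_real[of "T * (2 * m / l\<^sup>2)" 0 T]
    by (intro has_integral_add has_integral_mult_right[where c = L] integrable_integral
        integrable_mult_exp) auto
  have "norm (integral {0..T} (\<lambda>s. M (T - s) * c s - M T * c s))
      \<le> integral {0..T} (\<lambda>s. L * (s * exp (-(l * s)) + T * (2 * m / l\<^sup>2)))"
  proof (rule integral_norm_bound_integral)
    fix s assume s: "s \<in> {0..T}"
    have "\<bar>c s\<bar> \<le> exp (-(l * s)) + 2 * m / l\<^sup>2"
      using abs_c_diff_exp_le[OF s] exp_gt_zero[of "-(l * s)"] by linarith
    then have "s * \<bar>c s\<bar> \<le> s * (exp (-(l * s)) + 2 * m / l\<^sup>2)"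
      using s by (intro mult_left_mono) auto
    also have "\<dots> \<le> s * exp (-(l * s)) + T * (2 * m / l\<^sup>2)"
      using s m_nonneg by (simp add: distrib_left divide_right_mono mult_right_mono)
    finally have sc: "s * \<bar>c s\<bar> \<le> s * exp (-(l * s)) + T * (2 * m / l\<^sup>2)" .
    have "norm (M (T - s) * c s - M T * c s) = \<bar>M (T - s) - M T\<bar> * \<bar>c s\<bar>"
      by (simp add: left_diff_distrib[symmetric] abs_mult)
    also have "\<dots> \<le> L * s * \<bar>c s\<bar>"
      using Lipschitz[of "T - s" T] s by (intro mult_right_mono) auto
    also have "\<dots> \<le> L * (s * exp (-(l * s)) + T * (2 * m / l\<^sup>2))"
      using mult_left_mono[OF sc L_nonneg] by (simp add: mult.assoc)
    finally show "norm (M (T - s) * c s - M T * c s)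
        \<le> L * (s * exp (-(l * s)) + T * (2 * m / l\<^sup>2))" .
  qed (use diff bound in auto)
  also have "\<dots> \<le> L * (1 / l\<^sup>2 + T * (T * (2 * m / l\<^sup>2)))"
    unfolding integral_unique[OF bound]
    using L_nonneg integral_mult_exp_le[of l T] l_pos T_pos
    by (intro add_right_mono mult_left_mono) auto
  finally show ?thesis
    unfolding integral_unique[OF diff]
    using l_pos by (simp add: power2_eq_square field_simps)
qed

lemma integral_c_error:
  "\<bar>integral {0..T} c - (1 - exp (-(l * T))) / l\<bar> \<le> 2 * m * T / l\<^sup>2"
proof -
  have c_int: "c integrable_on {0..T}"
    by (intro integrable_continuous_interval c_cont)
  have diff: "((\<lambda>s. c s - exp (-(l * s))) has_integral
      integral {0..T} c - (1 - exp (-(l * T))) / l) {0..T}"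
    using c_int T_pos l_pos
    by (intro has_integral_diff integrable_integral has_integral_exp) auto
  have "norm (integral {0..T} (\<lambda>s. c s - exp (-(l * s)))) \<le> integral {0..T} (\<lambda>s. 2 * m / l\<^sup>2)"
    using diff abs_c_diff_exp_le by (intro integral_norm_bound_integral) auto
  then show ?thesis
    unfolding integral_unique[OF diff] using T_pos by (simp add: mult_ac)
qed

text \<open>The bound depends on \<open>l\<close>, \<open>T\<close> and the constants of the kernel
  but not on \<open>c\<close> and \<open>w\<close>, so it is uniform over all modes.\<close>

lemma asymptotics:
  defines "E \<equiv> exp (-(l * T))"
  shows "\<bar>l\<^sup>2 * c T + M T\<bar> \<le> l\<^sup>2 * E + (l\<^sup>2 * (m * E * T\<^sup>2) + (2 * m\<^sup>2 / l\<^sup>2 + 2 * L / l))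
    + m * E + (m * (E + 2 * m * T / l) + L * (1 + 2 * m * T\<^sup>2) / l)"
proof -
  define I where "I = integral {0..T} c"
  \<comment> \<open>\<open>r1\<close> and \<open>r2\<close> are the errors of
    \<open>duhamel_error\<close> and \<open>w_error\<close>; \<open>r3\<close> is, up to
    \<open>E\<close>, that of \<open>integral_c_error\<close> times \<open>l\<close>. They enter the
    final identity multiplied by \<open>l\<^sup>2\<close>, \<open>l\<close> and
    \<open>M T\<close>.\<close>
  define r1 where "r1 = E - c T - w T * ((1 - E) / l)"
  define r2 where "r2 = w T - M T * I"
  define r3 where "r3 = l * I - 1"
  have E: "0 < E" "E \<le> 1" using l_pos T_pos by (auto simp: E_def)
  have MT: "\<bar>M T\<bar> \<le> m" using M_bound T_pos by simp
  have "\<bar>l\<^sup>2 * r1\<bar> \<le> l\<^sup>2 * (m * E * T\<^sup>2 + (2 * m\<^sup>2 / l\<^sup>2 + 2 * L / l) / l\<^sup>2)"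
    unfolding r1_def E_def abs_mult using duhamel_error by (simp add: mult_left_mono)
  also have "\<dots> = l\<^sup>2 * (m * E * T\<^sup>2) + (2 * m\<^sup>2 / l\<^sup>2 + 2 * L / l)"
    using l_pos by (simp only: distrib_left) simp
  finally have r1: "\<bar>l\<^sup>2 * r1\<bar> \<le> l\<^sup>2 * (m * E * T\<^sup>2) + (2 * m\<^sup>2 / l\<^sup>2 + 2 * L / l)" .
  have "\<bar>l * r2\<bar> \<le> l * (L * (1 + 2 * m * T\<^sup>2) / l\<^sup>2)"
    unfolding abs_mult r2_def I_def using mult_left_mono[OF w_error, of l] l_pos by simp
  then have r2: "\<bar>l * r2\<bar> \<le> L * (1 + 2 * m * T\<^sup>2) / l"
    using l_pos by (simp add: power2_eq_square)
  have "\<bar>l * (I - (1 - E) / l)\<bar> \<le> l * (2 * m * T / l\<^sup>2)"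
    unfolding abs_mult I_def E_def using mult_left_mono[OF integral_c_error, of l] l_pos by simp
  moreover have "l * (I - (1 - E) / l) = r3 + E"
    using l_pos by (simp add: r3_def field_simps)
  ultimately have r3: "\<bar>r3\<bar> \<le> E + 2 * m * T / l"
    using E l_pos by (simp add: power2_eq_square abs_le_iff) linarith
  have "\<bar>M T * r3\<bar> \<le> m * (E + 2 * m * T / l)"
    unfolding abs_mult using MT r3 by (intro mult_mono) auto
  then have "\<bar>M T * r3 + l * r2\<bar> \<le> m * (E + 2 * m * T / l) + L * (1 + 2 * m * T\<^sup>2) / l"
    using r2 by linarith
  then have r23: "\<bar>(M T * r3 + l * r2) * (1 - E)\<bar>
      \<le> m * (E + 2 * m * T / l) + L * (1 + 2 * m * T\<^sup>2) / l"
    unfolding abs_mult using E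
    by (smt (verit, best) mult_left_le abs_ge_zero)
  have ME: "\<bar>M T * E\<bar> \<le> m * E"
    unfolding abs_mult using MT E by (intro mult_mono) auto
  have "l\<^sup>2 * r1 = l\<^sup>2 * E - l\<^sup>2 * c T - l * w T * (1 - E)"
    using l_pos by (simp add: r1_def power2_eq_square right_diff_distrib field_simps)
  moreover have "l * w T = M T * (1 + r3) + l * r2"
    by (simp add: r2_def r3_def algebra_simps)
  ultimately have "l\<^sup>2 * c T + M T = l\<^sup>2 * E - l\<^sup>2 * r1 + M T * E - (M T * r3 + l * r2) * (1 - E)"
    by (simp add: algebra_simps)
  moreover have "0 \<le> l\<^sup>2 * E" using E by simp
  ultimately show ?thesis
    using r1 r23 ME by linarith
qed

end

text \<open>\<Lambda> is fixed before \<open>c\<close> and \<open>w\<close>: one threshold for all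
  modes that share the bounds \<open>m\<close> and \<open>L\<close>.\<close>

lemma mode_asymptotics:
  assumes "T > 0" "\<epsilon> > 0"
  obtains \<Lambda> where "\<And>l c w. \<Lambda> \<le> l \<Longrightarrow> large_memory_mode M l T m c w L \<Longrightarrow> \<bar>l\<^sup>2 * c T + M T\<bar> < \<epsilon>"
proof -
  define B where "B l = l\<^sup>2 * exp (-(l * T)) + (l\<^sup>2 * (m * exp (-(l * T)) * T\<^sup>2)
      + (2 * m\<^sup>2 / l\<^sup>2 + 2 * L / l)) + m * exp (-(l * T))
      + (m * (exp (-(l * T)) + 2 * m * T / l) + L * (1 + 2 * m * T\<^sup>2) / l)" for l
  have "(B \<longlongrightarrow> 0) at_top"
    unfolding B_def using \<open>T > 0\<close> by real_asymp
  then have "\<forall>\<^sub>F l in at_top. B l < \<epsilon>"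
    using \<open>\<epsilon> > 0\<close> by (auto dest: order_tendstoD)
  then obtain \<Lambda> where "\<And>l. \<Lambda> \<le> l \<Longrightarrow> B l < \<epsilon>"
    by (auto simp: eventually_at_top_linorder)
  then show ?thesis
    using large_memory_mode.asymptotics that unfolding B_def by (meson order_le_less_trans)
qed

section \<open>The space \<open>L\<^sup>2(\<Omega>)\<close>\<close>

lemma L2_measurable: "f \<in> L2 \<Omega> \<Longrightarrow> f \<in> borel_measurable (lebesgue_on \<Omega>)"
  and L2_integrable_square: "f \<in> L2 \<Omega> \<Longrightarrow> integrable (lebesgue_on \<Omega>) (\<lambda>x. (f x)\<^sup>2)"
  by (auto simp: L2_def)

lemma L2_integrable_mult:
  assumes "f \<in> L2 \<Omega>" "g \<in> L2 \<Omega>"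
  shows "integrable (lebesgue_on \<Omega>) (\<lambda>x. f x * g x)"
proof (rule Bochner_Integration.integrable_bound)
  show "integrable (lebesgue_on \<Omega>) (\<lambda>x. (f x)\<^sup>2 + (g x)\<^sup>2)"
    using assms by (intro Bochner_Integration.integrable_add L2_integrable_square)
  show "(\<lambda>x. f x * g x) \<in> borel_measurable (lebesgue_on \<Omega>)"
    using assms[THEN L2_measurable] by simp
  have "\<bar>a * b\<bar> \<le> a\<^sup>2 + b\<^sup>2" for a b :: real
  proof -
    have "2 * (\<bar>a\<bar> * \<bar>b\<bar>) \<le> a\<^sup>2 + b\<^sup>2"
      using sum_squares_bound[of "\<bar>a\<bar>" "\<bar>b\<bar>"] by simp
    moreover have "0 \<le> \<bar>a\<bar> * \<bar>b\<bar>" by simp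
    ultimately show ?thesis unfolding abs_mult by linarith
  qed
  then show "AE x in lebesgue_on \<Omega>. norm (f x * g x) \<le> norm ((f x)\<^sup>2 + (g x)\<^sup>2)"
    by (intro AE_I2) (auto simp: abs_mult)
qed

lemma L2_scale: "f \<in> L2 \<Omega> \<Longrightarrow> (\<lambda>x. c * f x) \<in> L2 \<Omega>"
  by (auto simp: L2_def power_mult_distrib)

lemma L2_add:
  assumes "f \<in> L2 \<Omega>" "g \<in> L2 \<Omega>"
  shows "(\<lambda>x. f x + g x) \<in> L2 \<Omega>"
proof -
  have "integrable (lebesgue_on \<Omega>) (\<lambda>x. (f x)\<^sup>2 + (g x)\<^sup>2 + 2 * (f x * g x))"
    using assms
    by (intro Bochner_Integration.integrable_add L2_integrable_square integrable_mult_right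
        L2_integrable_mult)
  then show ?thesis
    using assms by (auto simp: L2_def power2_sum mult.assoc)
qed

lemma L2_zero: "(\<lambda>x. 0) \<in> L2 \<Omega>"
  by (simp add: L2_def)

lemma L2_minus: "f \<in> L2 \<Omega> \<Longrightarrow> (\<lambda>x. - f x) \<in> L2 \<Omega>"
  using L2_scale[of f \<Omega> "-1"] by simp

lemma L2_diff: "f \<in> L2 \<Omega> \<Longrightarrow> g \<in> L2 \<Omega> \<Longrightarrow> (\<lambda>x. f x - g x) \<in> L2 \<Omega>"
  using L2_add[of f \<Omega> "\<lambda>x. - g x"] L2_minus[of g \<Omega>] by simp

lemma L2_divide: "f \<in> L2 \<Omega> \<Longrightarrow> (\<lambda>x. f x / c) \<in> L2 \<Omega>"
  using L2_scale[of f \<Omega> "inverse c"] by (simp add: divide_inverse mult.commute)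

lemma L2_sum: "(\<And>i. i \<in> I \<Longrightarrow> f i \<in> L2 \<Omega>) \<Longrightarrow> (\<lambda>x. \<Sum>i\<in>I. f i x) \<in> L2 \<Omega>"
  by (induction I rule: infinite_finite_induct) (auto intro: L2_zero L2_add)

lemmas L2_intros = L2_scale L2_add L2_zero L2_minus L2_diff L2_divide L2_sum

lemma L2_inner_commute: "L2_inner \<Omega> f g = L2_inner \<Omega> g f"
  by (simp add: L2_inner_def mult.commute)

lemma L2_inner_scale_left: "L2_inner \<Omega> (\<lambda>x. c * f x) g = c * L2_inner \<Omega> f g"
  by (simp add: L2_inner_def mult.assoc)

lemma L2_inner_minus_left: "L2_inner \<Omega> (\<lambda>x. - f x) g = - L2_inner \<Omega> f g"
  by (simp add: L2_inner_def)

lemma L2_inner_zero_left [simp]: "L2_inner \<Omega> (\<lambda>x. 0) g = 0"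
  by (simp add: L2_inner_def)

lemma L2_inner_divide_left: "L2_inner \<Omega> (\<lambda>x. f x / c) g = L2_inner \<Omega> f g / c"
  using L2_inner_scale_left[of \<Omega> "inverse c" f g] by (simp add: divide_inverse mult.commute)

lemma L2_inner_add_left:
  "f \<in> L2 \<Omega> \<Longrightarrow> f' \<in> L2 \<Omega> \<Longrightarrow> g \<in> L2 \<Omega> \<Longrightarrow>
    L2_inner \<Omega> (\<lambda>x. f x + f' x) g = L2_inner \<Omega> f g + L2_inner \<Omega> f' g"
  by (simp add: L2_inner_def distrib_right L2_integrable_mult)

lemma L2_inner_diff_left:
  "f \<in> L2 \<Omega> \<Longrightarrow> f' \<in> L2 \<Omega> \<Longrightarrow> g \<in> L2 \<Omega> \<Longrightarrow>
    L2_inner \<Omega> (\<lambda>x. f x - f' x) g = L2_inner \<Omega> f g - L2_inner \<Omega> f' g"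
  by (simp add: L2_inner_def left_diff_distrib L2_integrable_mult)

lemma L2_inner_sum_left:
  "(\<And>i. i \<in> I \<Longrightarrow> f i \<in> L2 \<Omega>) \<Longrightarrow> g \<in> L2 \<Omega> \<Longrightarrow>
    L2_inner \<Omega> (\<lambda>x. \<Sum>i\<in>I. f i x) g = (\<Sum>i\<in>I. L2_inner \<Omega> (f i) g)"
  by (induction I rule: infinite_finite_induct) (auto simp: L2_inner_add_left L2_sum)

lemma L2_inner_add_right:
  "f \<in> L2 \<Omega> \<Longrightarrow> f' \<in> L2 \<Omega> \<Longrightarrow> g \<in> L2 \<Omega> \<Longrightarrow>
    L2_inner \<Omega> g (\<lambda>x. f x + f' x) = L2_inner \<Omega> g f + L2_inner \<Omega> g f'"
  using L2_inner_add_left[of f \<Omega> f' g] by (simp add: L2_inner_commute)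

lemma L2_inner_diff_right:
  "f \<in> L2 \<Omega> \<Longrightarrow> f' \<in> L2 \<Omega> \<Longrightarrow> g \<in> L2 \<Omega> \<Longrightarrow>
    L2_inner \<Omega> g (\<lambda>x. f x - f' x) = L2_inner \<Omega> g f - L2_inner \<Omega> g f'"
  using L2_inner_diff_left[of f \<Omega> f' g] by (simp add: L2_inner_commute)

lemma L2_inner_minus_right: "L2_inner \<Omega> f (\<lambda>x. - g x) = - L2_inner \<Omega> f g"
  by (simp add: L2_inner_def)

lemma L2_inner_scale_right: "L2_inner \<Omega> f (\<lambda>x. c * g x) = c * L2_inner \<Omega> f g"
  using L2_inner_scale_left[of \<Omega> c g f] by (simp add: L2_inner_commute)

lemma L2_norm_nonneg [simp]: "0 \<le> L2_norm \<Omega> f"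
  by (simp add: L2_norm_def)

lemma L2_norm_square: "(L2_norm \<Omega> f)\<^sup>2 = L2_inner \<Omega> f f"
  by (simp add: L2_norm_def L2_inner_def power2_eq_square)

lemma L2_norm_diff_commute: "L2_norm \<Omega> (\<lambda>x. f x - g x) = L2_norm \<Omega> (\<lambda>x. g x - f x)"
  by (simp add: L2_norm_def power2_commute)

lemma L2_inner_le_norms:
  assumes "f \<in> L2 \<Omega>" "g \<in> L2 \<Omega>"
  shows "\<bar>L2_inner \<Omega> f g\<bar> \<le> L2_norm \<Omega> f * L2_norm \<Omega> g"
proof -
  define a b c where "a = L2_inner \<Omega> f f" and "b = L2_inner \<Omega> f g" and "c = L2_inner \<Omega> g g"
  have a0: "a \<ge> 0" and c0: "c \<ge> 0"
    unfolding a_def c_def L2_norm_square[symmetric] by simp_all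
  have key: "0 \<le> a - 2 * t * b + t\<^sup>2 * c" for t
  proof -
    have "0 \<le> L2_inner \<Omega> (\<lambda>x. f x - t * g x) (\<lambda>x. f x - t * g x)"
      unfolding L2_norm_square[symmetric] by simp
    also have "\<dots> = a - 2 * t * b + t\<^sup>2 * c"
      using assms
      by (simp add: L2_inner_diff_left L2_inner_diff_right L2_intros L2_inner_scale_left
          L2_inner_scale_right a_def b_def c_def L2_inner_commute[of \<Omega> g f] power2_eq_square
          algebra_simps)
    finally show ?thesis .
  qed
  have "b\<^sup>2 \<le> a * c"
  proof (cases "c = 0")
    case True
    have "b = 0"
    proof (rule ccontr)
      assume "b \<noteq> 0"
      \<comment> \<open>With \<open>c = 0\<close> the form \<open>a - 2 * t * b\<close> is affine in
        \<open>t\<close>; this \<open>t\<close> gives it the value -1.\<close>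
      then show False using key[of "(a + 1) / (2 * b)"] True a0 by simp
    qed
    then show ?thesis using True by simp
  next
    case False
    with c0 have c: "c > 0" by simp
    \<comment> \<open>\<open>b / c\<close> minimises the quadratic in \<open>t\<close>.\<close>
    have "0 \<le> c * (a - 2 * (b / c) * b + (b / c)\<^sup>2 * c)"
      using key[of "b / c"] c by simp
    also have "\<dots> = a * c - b\<^sup>2"
      using c by (simp add: field_simps power2_eq_square)
    finally show ?thesis by simp
  qed
  then have "b\<^sup>2 \<le> (L2_norm \<Omega> f * L2_norm \<Omega> g)\<^sup>2"
    by (simp add: power_mult_distrib L2_norm_square a_def c_def)
  then show ?thesis
    unfolding b_def[symmetric] using abs_le_square_iff[of b "L2_norm \<Omega> f * L2_norm \<Omega> g"] by simp
qed

lemma L2_norm_triangle: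
  assumes "f \<in> L2 \<Omega>" "g \<in> L2 \<Omega>"
  shows "L2_norm \<Omega> (\<lambda>x. f x + g x) \<le> L2_norm \<Omega> f + L2_norm \<Omega> g"
proof (rule power2_le_imp_le)
  have "(L2_norm \<Omega> (\<lambda>x. f x + g x))\<^sup>2
      = L2_inner \<Omega> f f + 2 * L2_inner \<Omega> f g + L2_inner \<Omega> g g"
    using assms
    by (simp add: L2_norm_square L2_inner_add_left L2_inner_add_right L2_add
        L2_inner_commute[of \<Omega> g f])
  then show "(L2_norm \<Omega> (\<lambda>x. f x + g x))\<^sup>2 \<le> (L2_norm \<Omega> f + L2_norm \<Omega> g)\<^sup>2"
    using L2_inner_le_norms[OF assms] by (simp add: power2_sum L2_norm_square)
qed simp

lemma abs_L2_norm_diff_le: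
  assumes "f \<in> L2 \<Omega>" "g \<in> L2 \<Omega>"
  shows "\<bar>L2_norm \<Omega> f - L2_norm \<Omega> g\<bar> \<le> L2_norm \<Omega> (\<lambda>x. f x - g x)"
  using L2_norm_triangle[of "\<lambda>x. f x - g x" \<Omega> g]
    L2_norm_triangle[of "\<lambda>x. g x - f x" \<Omega> f] assms
    L2_norm_diff_commute[of \<Omega> f g]
  by (auto simp: L2_diff)

lemma L2_norm_eq_0_iff:
  assumes "f \<in> L2 \<Omega>"
  shows "L2_norm \<Omega> f = 0 \<longleftrightarrow> L2_eq \<Omega> f (\<lambda>x. 0)"
  unfolding L2_norm_def L2_eq_def
  using integral_nonneg_eq_0_iff_AE[OF L2_integrable_square[OF assms]] by simp

lemma L2_eq_iff_norm_diff:
  assumes "f \<in> L2 \<Omega>" "g \<in> L2 \<Omega>"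
  shows "L2_eq \<Omega> f g \<longleftrightarrow> L2_norm \<Omega> (\<lambda>x. f x - g x) = 0"
  using L2_norm_eq_0_iff[OF L2_diff[OF assms]] by (simp add: L2_eq_def)

lemma L2_inner_cong:
  assumes "L2_eq \<Omega> f f'" "f \<in> L2 \<Omega>" "f' \<in> L2 \<Omega>" "g \<in> L2 \<Omega>"
  shows "L2_inner \<Omega> f g = L2_inner \<Omega> f' g"
  unfolding L2_inner_def
  using assms by (intro integral_cong_AE borel_measurable_times L2_measurable)
    (auto simp: L2_eq_def elim: eventually_mono)

lemma L2_norm_cong:
  assumes "L2_eq \<Omega> f f'" "f \<in> L2 \<Omega>" "f' \<in> L2 \<Omega>"
  shows "L2_norm \<Omega> f = L2_norm \<Omega> f'"
  using abs_L2_norm_diff_le[OF assms(2,3)] assms by (simp add: L2_eq_iff_norm_diff)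

lemma L2_inner_tendsto:
  assumes "\<forall>\<^sub>F x in F. f x \<in> L2 \<Omega>" "l \<in> L2 \<Omega>" "g \<in> L2 \<Omega>"
    and "((\<lambda>x. L2_norm \<Omega> (\<lambda>z. f x z - l z)) \<longlongrightarrow> 0) F"
  shows "((\<lambda>x. L2_inner \<Omega> (f x) g) \<longlongrightarrow> L2_inner \<Omega> l g) F"
proof (rule Lim_null[THEN iffD2, OF Lim_null_comparison])
  show "\<forall>\<^sub>F x in F. norm (L2_inner \<Omega> (f x) g - L2_inner \<Omega> l g)
          \<le> L2_norm \<Omega> (\<lambda>z. f x z - l z) * L2_norm \<Omega> g"
    using assms(1)
  proof eventually_elim
    case (elim x)
    then show ?case
      using L2_inner_le_norms[of "\<lambda>z. f x z - l z" \<Omega> g] assms(2,3)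
      by (simp add: L2_inner_diff_left L2_intros)
  qed
  show "((\<lambda>x. L2_norm \<Omega> (\<lambda>z. f x z - l z) * L2_norm \<Omega> g) \<longlongrightarrow> 0) F"
    using tendsto_mult_left_zero[OF assms(4)] .
qed

lemma L2_norm_tendsto:
  assumes "\<forall>\<^sub>F x in F. f x \<in> L2 \<Omega>" "l \<in> L2 \<Omega>"
    and "((\<lambda>x. L2_norm \<Omega> (\<lambda>z. f x z - l z)) \<longlongrightarrow> 0) F"
  shows "((\<lambda>x. L2_norm \<Omega> (f x)) \<longlongrightarrow> L2_norm \<Omega> l) F"
proof (rule Lim_null[THEN iffD2, OF Lim_null_comparison])
  show "\<forall>\<^sub>F x in F. norm (L2_norm \<Omega> (f x) - L2_norm \<Omega> l) \<le> L2_norm \<Omega> (\<lambda>z. f x z - l z)"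
    using assms(1) by eventually_elim (use abs_L2_norm_diff_le assms(2) in auto)
qed (use assms in auto)

text \<open>Pairing with \<open>e\<close> sends Riemann sums of \<open>F\<close> to those of the
  scalar function, and Cauchy-Schwarz controls the error. This is the passage from the mild
  formulation to scalar equations.\<close>

lemma has_L2_integral_inner:
  assumes "has_L2_integral \<Omega> F g a b" "e \<in> L2 \<Omega>"
  shows "((\<lambda>s. L2_inner \<Omega> (F s) e) has_integral L2_inner \<Omega> g e) {a..b}"
  unfolding has_integral_real
proof (intro allI impI)
  fix \<epsilon> :: real assume "\<epsilon> > 0"
  \<comment> \<open>The \<open>+ 1\<close> covers \<open>L2_norm \<Omega> e = 0\<close> and yields
    the strict inequality below.\<close>
  define \<eta> where "\<eta> = \<epsilon> / (L2_norm \<Omega> e + 1)"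
  have "\<eta> > 0" using \<open>\<epsilon> > 0\<close> by (simp add: \<eta>_def add_nonneg_pos)
  have F: "F s \<in> L2 \<Omega>" if "s \<in> {a..b}" for s
    using assms(1) that by (auto simp: has_L2_integral_def)
  have g: "g \<in> L2 \<Omega>"
    using assms(1) by (auto simp: has_L2_integral_def)
  from assms(1)[unfolded has_L2_integral_def, THEN conjunct2, THEN conjunct2, rule_format,
      OF \<open>\<eta> > 0\<close>]
  obtain \<delta> where "gauge \<delta>" and \<delta>: "\<forall>D. D tagged_division_of {a..b} \<and> \<delta> fine D \<longrightarrow>
      L2_norm \<Omega> (\<lambda>x. (\<Sum>(s,K)\<in>D. measure lborel K * F s x) - g x) < \<eta>"
    by (elim exE conjE)
  have "norm ((\<Sum>(s,K)\<in>D. measure lborel K *\<^sub>R L2_inner \<Omega> (F s) e) - L2_inner \<Omega> g e) < \<epsilon>"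
    if D: "D tagged_division_of {a..b}" "\<delta> fine D" for D
  proof -
    have tag: "F s \<in> L2 \<Omega>" if "(s, K) \<in> D" for s K
      using tag_in_interval[OF D(1) that] F by (auto)
    have in_L2: "(\<lambda>x. \<Sum>(s,K)\<in>D. measure lborel K * F s x) \<in> L2 \<Omega>"
      using L2_sum[of D "\<lambda>p x. measure lborel (snd p) * F (fst p) x" \<Omega>] tag
      by (auto simp: L2_scale case_prod_unfold)
    have "L2_inner \<Omega> (\<lambda>x. \<Sum>(s,K)\<in>D. measure lborel K * F s x) e
        = (\<Sum>(s,K)\<in>D. measure lborel K * L2_inner \<Omega> (F s) e)"
      using L2_inner_sum_left[of D "\<lambda>p x. measure lborel (snd p) * F (fst p) x" \<Omega> e] tag assms(2)
      by (auto simp: L2_scale case_prod_unfold L2_inner_scale_left)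
    then have "norm ((\<Sum>(s,K)\<in>D. measure lborel K *\<^sub>R L2_inner \<Omega> (F s) e) - L2_inner \<Omega> g e)
        = \<bar>L2_inner \<Omega> (\<lambda>x. (\<Sum>(s,K)\<in>D. measure lborel K * F s x) - g x) e\<bar>"
      using in_L2 g assms(2) by (simp add: L2_inner_diff_left)
    also have "\<dots> \<le> L2_norm \<Omega> (\<lambda>x. (\<Sum>(s,K)\<in>D. measure lborel K * F s x) - g x) * L2_norm \<Omega> e"
      using in_L2 g assms(2) by (intro L2_inner_le_norms L2_diff)
    also have "\<dots> \<le> \<eta> * L2_norm \<Omega> e"
      using \<delta>[rule_format, OF conjI[OF D]] by (intro mult_right_mono) auto
    also have "\<dots> < \<eta> * (L2_norm \<Omega> e + 1)"
      using \<open>\<eta> > 0\<close> by simp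
    also have "\<dots> = \<epsilon>"
      using L2_norm_nonneg[of \<Omega> e] by (simp add: \<eta>_def add_nonneg_eq_0_iff)
    finally show ?thesis .
  qed
  then show "\<exists>\<delta>. gauge \<delta> \<and> (\<forall>D. D tagged_division_of {a..b} \<and> \<delta> fine D \<longrightarrow>
      norm ((\<Sum>(s,K)\<in>D. measure lborel K *\<^sub>R L2_inner \<Omega> (F s) e) - L2_inner \<Omega> g e) < \<epsilon>)"
    using \<open>gauge \<delta>\<close> by blast
qed

section \<open>Translations of test functions\<close>

lemma test_function_Ck: "\<phi> \<in> test_functions \<Omega> \<Longrightarrow> Ck_on k UNIV \<phi>"
  and test_function_compact: "\<phi> \<in> test_functions \<Omega> \<Longrightarrow> compact (closure {x. \<phi> x \<noteq> 0})"
  and test_function_support: "\<phi> \<in> test_functions \<Omega> \<Longrightarrow> closure {x. \<phi> x \<noteq> 0} \<subseteq> \<Omega>"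
  by (auto simp: test_functions_def)

lemma test_function_outside: "\<phi> \<in> test_functions \<Omega> \<Longrightarrow> x \<notin> \<Omega> \<Longrightarrow> \<phi> x = 0"
  using test_function_support[of \<phi> \<Omega>] closure_subset[of "{x. \<phi> x \<noteq> 0}"] by auto

lemma test_function_continuous: "\<phi> \<in> test_functions \<Omega> \<Longrightarrow> continuous_on UNIV \<phi>"
  using test_function_Ck[of \<phi> \<Omega> 0] by simp

lemma test_function_borel [measurable (raw)]:
  "\<phi> \<in> test_functions \<Omega> \<Longrightarrow> \<phi> \<in> borel_measurable borel"
  by (intro borel_measurable_continuous_onI test_function_continuous)

lemma test_function_has_derivative:
  assumes "\<phi> \<in> test_functions \<Omega>"
  shows "(\<phi> has_derivative frechet_derivative \<phi> (at x)) (at x)"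
  using test_function_Ck[OF assms, of 1]
  by (auto simp: differentiable_on_def frechet_derivative_works)

text \<open>Outside the closed support \<phi> vanishes on an open set, hence so does its derivative.
  Closure under \<open>partial\<close> lets \<open>dirichlet_form\<close> test with derivatives of
  test functions.\<close>

lemma test_function_partial:
  assumes "\<phi> \<in> test_functions \<Omega>"
  shows "partial i \<phi> \<in> test_functions \<Omega>"
proof -
  let ?S = "{x. \<phi> x \<noteq> 0}"
  have zero: "partial i \<phi> x = 0" if "x \<notin> closure ?S" for x
  proof -
    have "(\<phi> has_derivative (\<lambda>_. 0)) (at x)"
    proof (rule has_derivative_transform_within_open)
      show "((\<lambda>_. 0) has_derivative (\<lambda>_. 0)) (at x)" by simp
      show "open (- closure ?S)" "x \<in> - closure ?S" using that by auto
      show "0 = \<phi> y" if "y \<in> - closure ?S" for y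
        using that closure_subset[of ?S] by auto
    qed
    then show ?thesis
      by (simp add: partial_def frechet_derivative_at[symmetric])
  qed
  have "closure {x. partial i \<phi> x \<noteq> 0} \<subseteq> closure ?S"
    using zero by (intro closure_minimal) auto
  moreover have "Ck_on k UNIV (partial i \<phi>)" for k
    using test_function_Ck[OF assms, of "Suc k"] by simp
  ultimately show ?thesis
    using test_function_compact[OF assms] test_function_support[OF assms]
    by (auto simp: test_functions_def compact_eq_bounded_closed intro: bounded_subset)
qed

lemma test_function_integrable:
  assumes "\<phi> \<in> test_functions \<Omega>" "continuous_on UNIV \<psi>"
  shows "integrable lborel (\<lambda>x. \<phi> x * \<psi> x)"
proof -
  let ?S = "closure {x. \<phi> x \<noteq> 0}"
  have "integrable lborel (\<lambda>x. indicator ?S x *\<^sub>R (\<phi> x * \<psi> x))"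
    using assms
    by (intro borel_integrable_compact test_function_compact continuous_on_mult
        continuous_on_subset[OF test_function_continuous] continuous_on_subset[OF assms(2)]) auto
  also have "(\<lambda>x. indicator ?S x *\<^sub>R (\<phi> x * \<psi> x)) = (\<lambda>x. \<phi> x * \<psi> x)"
    using closure_subset[of "{x. \<phi> x \<noteq> 0}"] by (auto simp: indicator_def fun_eq_iff)
  finally show ?thesis .
qed

text \<open>Test functions vanish outside \<Omega>, so their integrals may be taken over the whole
  space, where translation invariance and Fubini apply.\<close>

lemma integrable_lebesgue_on_iff_lborel:
  fixes f :: "real^'n::finite \<Rightarrow> real"
  assumes "open \<Omega>" "f \<in> borel_measurable borel" "\<And>x. x \<notin> \<Omega> \<Longrightarrow> f x = 0"
  shows "integrable (lebesgue_on \<Omega>) f \<longleftrightarrow> integrable lborel f"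
    and "integral\<^sup>L (lebesgue_on \<Omega>) f = integral\<^sup>L lborel f"
proof -
  have f: "(\<lambda>x. indicator \<Omega> x *\<^sub>R f x) = f"
    using assms(3) by (auto simp: indicator_def fun_eq_iff)
  have \<Omega>: "\<Omega> \<inter> space lebesgue \<in> sets lebesgue"
    using assms(1) by simp
  show "integrable (lebesgue_on \<Omega>) f \<longleftrightarrow> integrable lborel f"
    using assms(2) unfolding integrable_restrict_space[OF \<Omega>] f by (simp add: integrable_completion)
  show "integral\<^sup>L (lebesgue_on \<Omega>) f = integral\<^sup>L lborel f"
    using assms(2) unfolding integral_restrict_space[OF \<Omega>] f by (simp add: integral_completion)
qed

lemma borel_measurable_lebesgue_on_open:
  fixes f :: "real^'n::finite \<Rightarrow> real"
  assumes "f \<in> borel_measurable borel"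
  shows "f \<in> borel_measurable (lebesgue_on \<Omega>)"
  using assms by (intro measurable_restrict_space1 measurable_completion) auto

lemma test_function_L2:
  assumes "open \<Omega>" "\<phi> \<in> test_functions \<Omega>"
  shows "\<phi> \<in> L2 \<Omega>"
  using test_function_integrable[OF assms(2) test_function_continuous[OF assms(2)]]
    integrable_lebesgue_on_iff_lborel(1)[OF assms(1), of "\<lambda>x. (\<phi> x)\<^sup>2"]
    test_function_outside[OF assms(2)] test_function_borel[OF assms(2)]
  by (simp add: L2_def borel_measurable_lebesgue_on_open power2_eq_square)

lemma L2_inner_test_function:
  assumes "open \<Omega>" "\<phi> \<in> test_functions \<Omega>" "f \<in> borel_measurable borel"
  shows "L2_inner \<Omega> f \<phi> = (LINT x|lborel. f x * \<phi> x)"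
  unfolding L2_inner_def using assms test_function_outside[OF assms(2)] test_function_borel[OF assms(2)]
  by (intro integrable_lebesgue_on_iff_lborel) auto

lemma nn_integral_test_function_square:
  assumes "open \<Omega>" "\<phi> \<in> test_functions \<Omega>"
  shows "(\<integral>\<^sup>+x. ennreal ((\<phi> x)\<^sup>2) \<partial>lborel) = ennreal ((L2_norm \<Omega> \<phi>)\<^sup>2)"
proof -
  have "integrable lborel (\<lambda>x. (\<phi> x)\<^sup>2)"
    using test_function_integrable[OF assms(2) test_function_continuous[OF assms(2)]]
    by (simp add: power2_eq_square)
  then have "(\<integral>\<^sup>+x. ennreal ((\<phi> x)\<^sup>2) \<partial>lborel) = ennreal (LINT x|lborel. (\<phi> x)\<^sup>2)"
    by (intro nn_integral_eq_integral) auto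
  also have "(LINT x|lborel. (\<phi> x)\<^sup>2) = L2_inner \<Omega> \<phi> \<phi>"
    using assms by (simp add: L2_inner_test_function test_function_borel power2_eq_square)
  finally show ?thesis by (simp add: L2_norm_square)
qed

lemma nn_integral_lborel_shift:
  fixes f :: "'a::euclidean_space \<Rightarrow> ennreal"
  assumes [measurable]: "f \<in> borel_measurable borel"
  shows "(\<integral>\<^sup>+x. f (x + v) \<partial>lborel) = (\<integral>\<^sup>+x. f x \<partial>lborel)"
proof -
  have "(\<integral>\<^sup>+x. f x \<partial>lborel) = (\<integral>\<^sup>+x. f x \<partial>distr lborel borel ((+) v))"
    by (simp add: lborel_distr_plus)
  also have "\<dots> = (\<integral>\<^sup>+x. f (v + x) \<partial>lborel)"
    by (intro nn_integral_distr) auto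
  finally show ?thesis by (simp add: add.commute)
qed

text \<open>Jensen on an interval of length 1, from integrating
  \<open>(g s - c)\<^sup>2 \<ge> 0\<close> with the mean \<open>c\<close>.\<close>

lemma integral_square_le:
  fixes g :: "real \<Rightarrow> real"
  assumes "continuous_on {0..1} g"
  shows "(integral {0..1} g)\<^sup>2 \<le> integral {0..1} (\<lambda>s. (g s)\<^sup>2)"
proof -
  define c where "c = integral {0..1} g"
  have int: "(g has_integral c) {0..1}" "((\<lambda>s. (g s)\<^sup>2) has_integral integral {0..1} (\<lambda>s. (g s)\<^sup>2)) {0..1}"
    unfolding c_def using assms
    by (auto intro!: integrable_integral integrable_continuous_interval continuous_intros)
  have "((\<lambda>s. (g s)\<^sup>2 - 2 * c * g s + c\<^sup>2) has_integral
      (integral {0..1} (\<lambda>s. (g s)\<^sup>2) - 2 * c * c + c\<^sup>2)) {0..1}"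
    using has_integral_const_real[of "c\<^sup>2" 0 1]
    by (intro has_integral_add has_integral_diff has_integral_mult_right int) simp_all
  moreover have "(g s)\<^sup>2 - 2 * c * g s + c\<^sup>2 \<ge> 0" for s
    using zero_le_power2[of "g s - c"] by (simp add: power2_diff mult_ac)
  ultimately have "0 \<le> integral {0..1} (\<lambda>s. (g s)\<^sup>2) - 2 * c * c + c\<^sup>2"
    by (rule has_integral_nonneg)
  then show ?thesis by (simp add: c_def[symmetric] power2_eq_square)
qed

lemma test_function_line_derivative:
  assumes "\<phi> \<in> test_functions \<Omega>"
  shows "((\<lambda>s. \<phi> (x + s *\<^sub>R v)) has_real_derivative (\<Sum>i\<in>UNIV. v $ i * partial i \<phi> (x + s *\<^sub>R v))) (at s)"
proof -
  let ?D = "frechet_derivative \<phi> (at (x + s *\<^sub>R v))"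
  have lin: "linear ?D"
    using test_function_has_derivative[OF assms] by (rule has_derivative_linear)
  have "((\<lambda>s. \<phi> (x + s *\<^sub>R v)) has_derivative (\<lambda>h. ?D (h *\<^sub>R v))) (at s)"
    by (rule has_derivative_compose[OF _ test_function_has_derivative[OF assms]])
      (auto intro!: derivative_eq_intros)
  moreover have "?D v = (\<Sum>i\<in>UNIV. v $ i * partial i \<phi> (x + s *\<^sub>R v))"
  proof -
    have "?D v = ?D (\<Sum>i\<in>UNIV. v $ i *s axis i 1)"
      by (simp add: basis_expansion)
    also have "\<dots> = (\<Sum>i\<in>UNIV. v $ i * ?D (axis i 1))"
      by (simp add: linear_sum[OF lin] scalar_mult_eq_scaleR linear_scale[OF lin])
    finally show ?thesis by (simp add: partial_def)
  qed
  ultimately show ?thesis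
    by (simp add: has_field_derivative_def linear_scale[OF lin] mult_commute_abs)
qed

text \<open>The fundamental theorem along the segment from \<open>x\<close> to \<open>x + v\<close>
  and Jensen bound the square by an average over the segment; Fubini and translation invariance
  remove the segment parameter, and Cauchy-Schwarz splits off \<open>norm v\<close>. With
  nonnegative integrals Fubini asks for measurability only.\<close>

lemma translation_estimate:
  assumes "open \<Omega>" "\<phi> \<in> test_functions \<Omega>"
  shows "(\<integral>\<^sup>+x. ennreal ((\<phi> (x + v) - \<phi> x)\<^sup>2) \<partial>lborel)
    \<le> ennreal ((norm v)\<^sup>2 * (\<Sum>i\<in>UNIV. (L2_norm \<Omega> (partial i \<phi>))\<^sup>2))"
proof -
  define D where "D x = (\<Sum>i\<in>UNIV. v $ i * partial i \<phi> x)" for x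
  have D_cont: "continuous_on UNIV D"
    unfolding D_def
    by (intro continuous_intros test_function_continuous[OF test_function_partial[OF assms(2)]])
  then have [measurable]: "D \<in> borel_measurable borel"
    by (rule borel_measurable_continuous_onI)
  have line: "continuous_on {0..1} (\<lambda>s. D (x + s *\<^sub>R v))" for x
    by (rule continuous_on_compose2[OF D_cont]) (auto intro!: continuous_intros)
  have pointwise: "ennreal ((\<phi> (x + v) - \<phi> x)\<^sup>2)
      \<le> (\<integral>\<^sup>+s. ennreal ((D (x + s *\<^sub>R v))\<^sup>2) * indicator {0..1} s \<partial>lborel)" for x
  proof -
    have "((\<lambda>s. D (x + s *\<^sub>R v)) has_integral \<phi> (x + 1 *\<^sub>R v) - \<phi> (x + 0 *\<^sub>R v)) {0..1}"
      unfolding D_def using test_function_line_derivative[OF assms(2)]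
      by (intro fundamental_theorem_of_calculus)
        (auto simp: has_real_derivative_iff_has_vector_derivative[symmetric]
          intro: has_field_derivative_at_within)
    then have "\<phi> (x + v) - \<phi> x = integral {0..1} (\<lambda>s. D (x + s *\<^sub>R v))"
      by (simp add: integral_unique)
    then have "(\<phi> (x + v) - \<phi> x)\<^sup>2 \<le> integral {0..1} (\<lambda>s. (D (x + s *\<^sub>R v))\<^sup>2)"
      using integral_square_le[OF line] by simp
    moreover have "(\<integral>\<^sup>+s. ennreal ((D (x + s *\<^sub>R v))\<^sup>2) * indicator {0..1} s \<partial>lborel)
        = ennreal (integral {0..1} (\<lambda>s. (D (x + s *\<^sub>R v))\<^sup>2))"
      by (intro nn_integral_has_integral_lebesgue' integrable_integral
          integrable_continuous_interval continuous_intros line) auto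
    ultimately show ?thesis by (simp add: ennreal_leI)
  qed
  have "(\<integral>\<^sup>+x. ennreal ((\<phi> (x + v) - \<phi> x)\<^sup>2) \<partial>lborel)
      \<le> (\<integral>\<^sup>+x. (\<integral>\<^sup>+s. ennreal ((D (x + s *\<^sub>R v))\<^sup>2) * indicator {0..1} s \<partial>lborel) \<partial>lborel)"
    by (intro nn_integral_mono pointwise)
  also have "\<dots> = (\<integral>\<^sup>+s. (\<integral>\<^sup>+x. ennreal ((D (x + s *\<^sub>R v))\<^sup>2) * indicator {0..1::real} s \<partial>lborel) \<partial>lborel)"
    by (rule lborel_pair.Fubini'[symmetric]) measurable
  also have "\<dots> = (\<integral>\<^sup>+s. (\<integral>\<^sup>+x. ennreal ((D x)\<^sup>2) \<partial>lborel) * indicator {0..1::real} s \<partial>lborel)"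
    by (simp add: nn_integral_multc nn_integral_lborel_shift[where f = "\<lambda>x. ennreal ((D x)\<^sup>2)"])
  also have "\<dots> = (\<integral>\<^sup>+x. ennreal ((D x)\<^sup>2) \<partial>lborel)"
    by (simp add: nn_integral_cmult)
  also have "\<dots> \<le> (\<integral>\<^sup>+x. (\<Sum>i\<in>UNIV. ennreal ((norm v)\<^sup>2) * ennreal ((partial i \<phi> x)\<^sup>2)) \<partial>lborel)"
  proof (intro nn_integral_mono)
    fix x
    have "(D x)\<^sup>2 \<le> (\<Sum>i\<in>UNIV. (v $ i)\<^sup>2) * (\<Sum>i\<in>UNIV. (partial i \<phi> x)\<^sup>2)"
      unfolding D_def by (rule Cauchy_Schwarz_ineq_sum)
    also have "(\<Sum>i\<in>UNIV. (v $ i)\<^sup>2) = (norm v)\<^sup>2"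
      by (simp add: norm_vec_def L2_set_def sum_nonneg)
    finally show "ennreal ((D x)\<^sup>2)
        \<le> (\<Sum>i\<in>UNIV. ennreal ((norm v)\<^sup>2) * ennreal ((partial i \<phi> x)\<^sup>2))"
      by (simp add: ennreal_mult[symmetric] sum_ennreal sum_distrib_left ennreal_leI)
  qed
  also have "\<dots> = (\<Sum>i\<in>UNIV. ennreal ((norm v)\<^sup>2) * ennreal ((L2_norm \<Omega> (partial i \<phi>))\<^sup>2))"
    using test_function_borel[OF test_function_partial[OF assms(2)]]
    by (simp add: nn_integral_sum nn_integral_cmult
        nn_integral_test_function_square[OF assms(1) test_function_partial[OF assms(2)]])
  also have "\<dots> = ennreal ((norm v)\<^sup>2 * (\<Sum>i\<in>UNIV. (L2_norm \<Omega> (partial i \<phi>))\<^sup>2))"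
    by (simp add: ennreal_mult[symmetric] sum_ennreal sum_distrib_left)
  finally show ?thesis .
qed

text \<open>A shift longer than the diameter of \<Omega> makes \<open>\<phi> (x + v)\<close> and
  \<open>\<phi> x\<close> disjointly supported, so the left side of the translation estimate is
  twice the squared norm.\<close>

lemma Poincare_test_function:
  fixes \<Omega> :: "(real^'n::finite) set"
  assumes "open \<Omega>" "bounded \<Omega>"
  obtains P where "P > 0"
    "\<And>\<phi>. \<phi> \<in> test_functions \<Omega> \<Longrightarrow> (L2_norm \<Omega> \<phi>)\<^sup>2 \<le> P * (\<Sum>i\<in>UNIV. (L2_norm \<Omega> (partial i \<phi>))\<^sup>2)"
proof -
  obtain R where R: "R > 0" "\<And>x. x \<in> \<Omega> \<Longrightarrow> norm x \<le> R"
    using assms(2) by (auto simp: bounded_pos)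
  \<comment> \<open>Names some coordinate direction; any one will do.\<close>
  obtain i :: 'n where True by simp
  \<comment> \<open>Two points of \<Omega> are at most \<open>2 * R\<close> apart, hence the length
    \<open>3 * R\<close>.\<close>
  define v :: "real^'n" where "v = (3 * R) *\<^sub>R axis i 1"
  have v: "norm v = 3 * R" using R by (simp add: v_def)
  have "2 * (L2_norm \<Omega> \<phi>)\<^sup>2 \<le> (norm v)\<^sup>2 * (\<Sum>i\<in>UNIV. (L2_norm \<Omega> (partial i \<phi>))\<^sup>2)"
    if \<phi>: "\<phi> \<in> test_functions \<Omega>" for \<phi>
  proof -
    note [measurable] = test_function_borel[OF \<phi>]
    have split: "(\<phi> (x + v) - \<phi> x)\<^sup>2 = (\<phi> (x + v))\<^sup>2 + (\<phi> x)\<^sup>2" for x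
    proof -
      have "x \<notin> \<Omega> \<or> x + v \<notin> \<Omega>"
        using R(2)[of x] R(2)[of "x + v"] norm_triangle_ineq4[of "x + v" x] v R(1) by auto
      then have "\<phi> (x + v) * \<phi> x = 0"
        using test_function_outside[OF \<phi>] by auto
      then show ?thesis by (simp add: power2_diff)
    qed
    have "ennreal (2 * (L2_norm \<Omega> \<phi>)\<^sup>2)
        = (\<integral>\<^sup>+x. ennreal ((\<phi> (x + v))\<^sup>2) \<partial>lborel) + (\<integral>\<^sup>+x. ennreal ((\<phi> x)\<^sup>2) \<partial>lborel)"
      by (simp add: nn_integral_lborel_shift[where f = "\<lambda>x. ennreal ((\<phi> x)\<^sup>2)"]
          nn_integral_test_function_square[OF assms(1) \<phi>] ennreal_plus[symmetric] del: ennreal_plus)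
    also have "\<dots> = (\<integral>\<^sup>+x. ennreal ((\<phi> (x + v) - \<phi> x)\<^sup>2) \<partial>lborel)"
      by (subst nn_integral_add[symmetric]) (auto simp: split)
    also have "\<dots> \<le> ennreal ((norm v)\<^sup>2 * (\<Sum>i\<in>UNIV. (L2_norm \<Omega> (partial i \<phi>))\<^sup>2))"
      by (rule translation_estimate[OF assms(1) \<phi>])
    finally show ?thesis
      by (subst (asm) ennreal_le_iff) (auto intro!: mult_nonneg_nonneg sum_nonneg)
  qed
  then show ?thesis
    using R(1) v by (intro that[of "(norm v)\<^sup>2 / 2"]) (auto simp: field_simps)
qed

section \<open>Averages over balls\<close>

text \<open>The kernel of averaging over the ball of radius \<epsilon> about \<open>x\<close>; the
  volume is taken at the origin so that the normalising constant visibly does not depend on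
  \<open>x\<close>.\<close>

definition ball_mean_weight :: "real \<Rightarrow> real^'n::finite \<Rightarrow> real^'n \<Rightarrow> real" where
  "ball_mean_weight \<epsilon> x y = indicator (cball x \<epsilon>) y / measure lborel (cball (0::real^'n) \<epsilon>)"

lemma ball_mean_weight_borel [measurable]: "ball_mean_weight \<epsilon> x \<in> borel_measurable borel"
  unfolding ball_mean_weight_def[abs_def]
  by (intro borel_measurable_divide borel_measurable_indicator borel_measurable_const) auto

lemma measure_cball_pos: "\<epsilon> > 0 \<Longrightarrow> measure lborel (cball (0::real^'n::finite) \<epsilon>) > 0"
  by (rule content_cball_pos)

lemma measure_cball_translate:
  "measure lborel (cball (x::real^'n::finite) \<epsilon>) = measure lborel (cball (0::real^'n) \<epsilon>)"
proof -
  have "emeasure lborel (cball x \<epsilon>) = (\<integral>\<^sup>+y. indicator (cball x \<epsilon>) y \<partial>lborel)"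
    by simp
  also have "\<dots> = (\<integral>\<^sup>+y. indicator (cball x \<epsilon>) (y + x) \<partial>lborel)"
    by (intro nn_integral_lborel_shift[symmetric] borel_measurable_indicator) auto
  also have "\<dots> = (\<integral>\<^sup>+y. indicator (cball (0::real^'n) \<epsilon>) y \<partial>lborel)"
    by (intro nn_integral_cong) (auto simp: indicator_def dist_norm)
  finally show ?thesis by (simp add: measure_def)
qed

lemma ball_mean_weight_integral:
  fixes x :: "real^'n::finite"
  assumes "\<epsilon> > 0"
  shows "integrable lborel (ball_mean_weight \<epsilon> x)" "(LINT y|lborel. ball_mean_weight \<epsilon> x y) = 1"
proof -
  let ?V = "measure lborel (cball (0::real^'n) \<epsilon>)"
  have "emeasure lborel (cball x \<epsilon>) < \<infinity>"
    by (rule emeasure_lborel_cball_finite)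
  then have int: "integrable lborel (indicator (cball x \<epsilon>) :: _ \<Rightarrow> real)"
    by (intro integrable_real_indicator) auto
  then show "integrable lborel (ball_mean_weight \<epsilon> x)"
    unfolding ball_mean_weight_def[abs_def] by simp
  show "(LINT y|lborel. ball_mean_weight \<epsilon> x y) = 1"
    unfolding ball_mean_weight_def
    using measure_cball_pos[OF assms, where ?'n = 'n] by (simp add: measure_cball_translate[of x])
qed

text \<open>The weight takes only the values 0 and \<open>1 / V\<close>, so its square is the weight
  divided by \<open>V\<close>. There is only an inequality because the ball may leave
  \<Omega>.\<close>

lemma ball_mean_weight_L2:
  fixes \<Omega> :: "(real^'n::finite) set"
  assumes "open \<Omega>" "\<epsilon> > 0"
  shows "ball_mean_weight \<epsilon> x \<in> L2 \<Omega>"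
    and "L2_inner \<Omega> (ball_mean_weight \<epsilon> x) (ball_mean_weight \<epsilon> x)
      \<le> 1 / measure lborel (cball (0::real^'n) \<epsilon>)"
proof -
  let ?r = "ball_mean_weight \<epsilon> x"
  define V where "V = measure lborel (cball (0::real^'n) \<epsilon>)"
  have V: "V > 0" unfolding V_def by (rule measure_cball_pos[OF assms(2)])
  have sq: "(?r y)\<^sup>2 = ?r y / V" for y
    by (simp add: ball_mean_weight_def V_def power2_eq_square indicator_def)
  have nonneg: "0 \<le> ?r y" for y
    by (simp add: ball_mean_weight_def)
  have int: "integrable lebesgue (\<lambda>y. indicator \<Omega> y *\<^sub>R (?r y)\<^sup>2)"
    and le: "(LINT y|lebesgue. indicator \<Omega> y *\<^sub>R (?r y)\<^sup>2) \<le> 1 / V"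
  proof -
    have meas: "(\<lambda>y. indicator \<Omega> y *\<^sub>R (?r y)\<^sup>2) \<in> borel_measurable lborel"
      using assms(1)
      by (intro borel_measurable_scaleR borel_measurable_indicator borel_measurable_power) auto
    have bound: "integrable lborel (\<lambda>y. ?r y / V)"
      using ball_mean_weight_integral(1)[OF assms(2)] by (intro integrable_divide)
    have int': "integrable lborel (\<lambda>y. indicator \<Omega> y *\<^sub>R (?r y)\<^sup>2)"
      by (rule Bochner_Integration.integrable_bound[OF bound meas])
        (auto simp: sq indicator_def)
    then show "integrable lebesgue (\<lambda>y. indicator \<Omega> y *\<^sub>R (?r y)\<^sup>2)"
      using meas by (simp add: integrable_completion del: real_scaleR_def)
    have "(LINT y|lborel. indicator \<Omega> y *\<^sub>R (?r y)\<^sup>2) \<le> (LINT y|lborel. ?r y / V)"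
      using V by (intro integral_mono int' bound)
        (auto simp: sq indicator_def nonneg)
    also have "\<dots> = 1 / V"
      using ball_mean_weight_integral(2)[OF assms(2), of x] by simp
    finally show "(LINT y|lebesgue. indicator \<Omega> y *\<^sub>R (?r y)\<^sup>2) \<le> 1 / V"
      using meas by (simp add: integral_completion del: real_scaleR_def)
  qed
  have \<Omega>: "\<Omega> \<inter> space lebesgue \<in> sets lebesgue"
    using assms(1) by simp
  show "?r \<in> L2 \<Omega>"
    using int unfolding L2_def mem_Collect_eq integrable_restrict_space[OF \<Omega>]
    by (simp add: borel_measurable_lebesgue_on_open)
  show "L2_inner \<Omega> ?r ?r \<le> 1 / measure lborel (cball (0::real^'n) \<epsilon>)"
    using le unfolding L2_inner_def power2_eq_square[symmetric] integral_restrict_space[OF \<Omega>] V_def .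
qed

text \<open>Splits \<open>\<phi> x\<close> into the ball mean, left to Bessel's inequality, and the
  deviation from it, which Jensen turns into an average of squared translation differences. The
  weight is recentred at 0 so that it does not depend on \<open>x\<close> when the order of
  integration is exchanged.\<close>

lemma ball_mean_deviation:
  fixes \<Omega> :: "(real^'n::finite) set" and x :: "real^'n"
  assumes "open \<Omega>" "\<phi> \<in> test_functions \<Omega>" "\<epsilon> > 0"
  shows "ennreal ((\<phi> x)\<^sup>2)
    \<le> ennreal 2 * (\<integral>\<^sup>+z. ennreal (ball_mean_weight \<epsilon> 0 z) * ennreal ((\<phi> (x + z) - \<phi> x)\<^sup>2) \<partial>lborel)
      + ennreal (2 * (L2_inner \<Omega> (ball_mean_weight \<epsilon> x) \<phi>)\<^sup>2)"
proof -
  let ?r = "ball_mean_weight \<epsilon> x"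
  define p where "p = (LINT y|lborel. ?r y * \<phi> y)"
  define A where "A = (LINT y|lborel. ?r y * (\<phi> y)\<^sup>2)"
  define V where "V = measure lborel (cball (0::real^'n) \<epsilon>)"
  have V: "V > 0" unfolding V_def by (rule measure_cball_pos[OF assms(3)])
  note [measurable] = test_function_borel[OF assms(2)]
  have r: "0 \<le> ?r y" "?r y \<le> 1 / V" for y
    using V by (auto simp: ball_mean_weight_def V_def[symmetric] indicator_def)
  have int: "integrable lborel (\<lambda>y. ?r y * f y)"
    if "integrable lborel f" "f \<in> borel_measurable borel" for f :: "real^'n \<Rightarrow> real"
  proof (rule Bochner_Integration.integrable_bound)
    show "integrable lborel (\<lambda>y. 1 / V * f y)" using that(1) by simp
    show "(\<lambda>y. ?r y * f y) \<in> borel_measurable lborel"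
      using that(2) by measurable
    show "AE y in lborel. norm (?r y * f y) \<le> norm (1 / V * f y)"
      unfolding real_norm_def abs_mult using r V
      by (intro AE_I2 mult_right_mono) auto
  qed
  have int1: "integrable lborel (\<lambda>y. ?r y * \<phi> y)"
    using test_function_integrable[OF assms(2), of "\<lambda>_. 1"] by (intro int) auto
  have int2: "integrable lborel (\<lambda>y. ?r y * (\<phi> y)\<^sup>2)"
    using test_function_integrable[OF assms(2) test_function_continuous[OF assms(2)]]
    by (intro int) (auto simp: power2_eq_square)
  note int0 = ball_mean_weight_integral[OF assms(3), of x]
  \<comment> \<open>Used twice: \<open>c = p\<close> gives the variance, hence
    \<open>p\<^sup>2 \<le> A\<close>; with this, \<open>c = \<phi> x\<close> yields Jensen's
    inequality.\<close>
  have expand: "?r y * (\<phi> y - c)\<^sup>2 = ?r y * (\<phi> y)\<^sup>2 - 2 * c * (?r y * \<phi> y) + c\<^sup>2 * ?r y" for c y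
    by (simp add: power2_diff algebra_simps)
  have int_c: "integrable lborel (\<lambda>y. ?r y * (\<phi> y - c)\<^sup>2)"
    and val_c: "(LINT y|lborel. ?r y * (\<phi> y - c)\<^sup>2) = A - 2 * c * p + c\<^sup>2" for c
    unfolding expand using int0 int1 int2 by (simp_all add: A_def p_def)
  have "0 \<le> (LINT y|lborel. ?r y * (\<phi> y - p)\<^sup>2)"
    using r by (intro integral_nonneg_AE) auto
  then have "p\<^sup>2 \<le> A" unfolding val_c by (simp add: power2_eq_square)
  then have "(\<phi> x - p)\<^sup>2 \<le> (LINT y|lborel. ?r y * (\<phi> y - \<phi> x)\<^sup>2)"
    unfolding val_c by (simp add: power2_diff)
  moreover have "(\<phi> x)\<^sup>2 \<le> 2 * (\<phi> x - p)\<^sup>2 + 2 * p\<^sup>2"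
    using zero_le_power2[of "\<phi> x - 2 * p"] by (simp add: power2_eq_square algebra_simps)
  ultimately have "(\<phi> x)\<^sup>2 \<le> 2 * (LINT y|lborel. ?r y * (\<phi> y - \<phi> x)\<^sup>2) + 2 * p\<^sup>2"
    by linarith
  then have "ennreal ((\<phi> x)\<^sup>2) \<le> ennreal (2 * (LINT y|lborel. ?r y * (\<phi> y - \<phi> x)\<^sup>2) + 2 * p\<^sup>2)"
    by (rule ennreal_leI)
  also have "\<dots> = ennreal 2 * ennreal (LINT y|lborel. ?r y * (\<phi> y - \<phi> x)\<^sup>2) + ennreal (2 * p\<^sup>2)"
    using r by (subst ennreal_plus) (auto simp: ennreal_mult integral_nonneg_AE)
  also have "ennreal (LINT y|lborel. ?r y * (\<phi> y - \<phi> x)\<^sup>2)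
      = (\<integral>\<^sup>+y. ennreal (?r y * (\<phi> y - \<phi> x)\<^sup>2) \<partial>lborel)"
    using r int_c by (intro nn_integral_eq_integral[symmetric]) auto
  also have "\<dots> = (\<integral>\<^sup>+z. ennreal (?r (z + x) * (\<phi> (z + x) - \<phi> x)\<^sup>2) \<partial>lborel)"
    by (rule nn_integral_lborel_shift[symmetric]) measurable
  also have "\<dots> = (\<integral>\<^sup>+z. ennreal (ball_mean_weight \<epsilon> 0 z) * ennreal ((\<phi> (x + z) - \<phi> x)\<^sup>2) \<partial>lborel)"
    using V by (intro nn_integral_cong)
      (auto simp: ball_mean_weight_def V_def[symmetric] indicator_def dist_norm ennreal_mult[symmetric]
        add.commute)
  also have "p = L2_inner \<Omega> ?r \<phi>"
    unfolding p_def using assms by (simp add: L2_inner_test_function)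
  finally show ?thesis .
qed

section \<open>Bessel's inequality and quantitative compactness\<close>

lemma L2_Bessel:
  assumes "finite K" "f \<in> L2 \<Omega>" "\<And>k. k \<in> K \<Longrightarrow> e k \<in> L2 \<Omega>"
    and "\<And>j k. j \<in> K \<Longrightarrow> k \<in> K \<Longrightarrow> L2_inner \<Omega> (e j) (e k) = (if j = k then 1 else 0)"
  shows "(\<Sum>k\<in>K. (L2_inner \<Omega> f (e k))\<^sup>2) \<le> L2_inner \<Omega> f f"
proof -
  define c where "c k = L2_inner \<Omega> f (e k)" for k
  define g where "g x = (\<Sum>k\<in>K. c k * e k x)" for x
  have g: "g \<in> L2 \<Omega>" unfolding g_def using assms(3) by (intro L2_sum L2_scale)
  have g_inner: "L2_inner \<Omega> g h = (\<Sum>k\<in>K. c k * L2_inner \<Omega> (e k) h)" if "h \<in> L2 \<Omega>" for h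
    unfolding g_def using assms(3) that by (simp add: L2_inner_sum_left L2_scale L2_inner_scale_left)
  have gf: "L2_inner \<Omega> g f = (\<Sum>k\<in>K. (c k)\<^sup>2)"
    using assms(2) by (simp add: g_inner L2_inner_commute[of \<Omega> "e _" f] c_def power2_eq_square)
  have ge: "L2_inner \<Omega> g (e j) = c j" if "j \<in> K" for j
    using that assms by (simp add: g_inner if_distrib[of "\<lambda>x. _ * x"] sum.delta cong: sum.cong if_cong)
  have gg: "L2_inner \<Omega> g g = (\<Sum>k\<in>K. (c k)\<^sup>2)"
    using g by (simp add: g_inner[of g] L2_inner_commute[of \<Omega> "e _" g] ge power2_eq_square)
  have "0 \<le> L2_inner \<Omega> (\<lambda>x. f x - g x) (\<lambda>x. f x - g x)"
    unfolding L2_norm_square[symmetric] by simp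
  also have "\<dots> = L2_inner \<Omega> f f - (\<Sum>k\<in>K. (c k)\<^sup>2)"
    using assms(2) g
    by (simp add: L2_inner_diff_left L2_inner_diff_right L2_diff gg gf L2_inner_commute[of _ f g])
  finally show ?thesis by (simp add: c_def)
qed

text \<open>
  Rellich's theorem in quantitative form: averaging over balls of radius \<open>\<epsilon>\<close> is a Hilbert--Schmidt
  operator that moves functions of bounded energy by \<open>O(\<epsilon>)\<close>, so that Bessel's inequality bounds the
  number of such orthonormal functions.
\<close>

lemma finite_orthonormal_bounded_energy:
  fixes \<Omega> :: "(real^'n::finite) set" and e :: "nat \<Rightarrow> real^'n \<Rightarrow> real"
  assumes "open \<Omega>" "bounded \<Omega>" "\<Lambda> > 0"
    and e_L2: "\<And>k. k \<in> S \<Longrightarrow> e k \<in> L2 \<Omega>"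
    and orth: "\<And>j k. j \<in> S \<Longrightarrow> k \<in> S \<Longrightarrow> L2_inner \<Omega> (e j) (e k) = (if j = k then 1 else 0)"
    and approx: "\<And>k \<eta>. k \<in> S \<Longrightarrow> \<eta> > 0 \<Longrightarrow> \<exists>\<phi>\<in>test_functions \<Omega>.
      L2_norm \<Omega> (\<lambda>x. \<phi> x - e k x) < \<eta> \<and> (\<Sum>i\<in>UNIV. (L2_norm \<Omega> (partial i \<phi>))\<^sup>2) \<le> \<Lambda>"
  shows "finite S"
proof -
  \<comment> \<open>A translation by at most \<epsilon> costs
    \<open>\<epsilon>\<^sup>2 * \<Lambda> = 1 / 16\<close>; with the factor 2 of
    \<open>ball_mean_deviation\<close> each function loses at most 1/8, half of the 1/4 that its
    squared norm retains.\<close>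
  define \<epsilon> where "\<epsilon> = 1 / (4 * sqrt \<Lambda>)"
  have \<epsilon>: "\<epsilon> > 0" "\<epsilon>\<^sup>2 * \<Lambda> = 1 / 16"
    using assms(3) by (auto simp: \<epsilon>_def power_divide power_mult_distrib)
  define V where "V = measure lborel (cball (0::real^'n) \<epsilon>)"
  have V: "V > 0" unfolding V_def by (rule measure_cball_pos[OF \<epsilon>(1)])
  define \<mu> where "\<mu> = measure lborel \<Omega>"
  have \<mu>: "emeasure lborel \<Omega> = ennreal \<mu>"
    unfolding \<mu>_def using emeasure_bounded_finite[OF assms(2)]
    by (intro emeasure_eq_ennreal_measure) auto
  have "card K \<le> nat \<lceil>64 * \<mu> / V\<rceil>" if K: "K \<subseteq> S" "finite K" for K
  proof -
    \<comment> \<open>The tolerance shrinks with \<open>card K\<close>, so that the squared errors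
      of all approximations together are at most 1.\<close>
    define \<eta> where "\<eta> = 1 / (2 * (real (card K) + 1))"
    have \<eta>: "\<eta> > 0" "\<eta> \<le> 1 / 2" "real (card K) * \<eta>\<^sup>2 \<le> 1"
    proof -
      show "\<eta> > 0" "\<eta> \<le> 1 / 2" by (auto simp: \<eta>_def field_simps add_pos_nonneg)
      then have "real (card K) * \<eta>\<^sup>2 \<le> (real (card K) * \<eta>) * (1 / 2)"
        using mult_left_mono[of \<eta> "1 / 2" "real (card K) * \<eta>"]
        by (simp add: power2_eq_square mult.assoc)
      also have "\<dots> \<le> 1 * (1 / 2)"
        by (intro mult_right_mono) (auto simp: \<eta>_def field_simps)
      finally show "real (card K) * \<eta>\<^sup>2 \<le> 1" by simp
    qed
    have "\<forall>k\<in>K. \<exists>\<phi>. \<phi> \<in> test_functions \<Omega> \<and> L2_norm \<Omega> (\<lambda>x. \<phi> x - e k x) < \<eta>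
        \<and> (\<Sum>i\<in>UNIV. (L2_norm \<Omega> (partial i \<phi>))\<^sup>2) \<le> \<Lambda>"
    proof
      fix k assume "k \<in> K"
      then have "k \<in> S" using K(1) by auto
      from approx[OF this \<eta>(1)] show "\<exists>\<phi>. \<phi> \<in> test_functions \<Omega> \<and> L2_norm \<Omega> (\<lambda>x. \<phi> x - e k x) < \<eta>
        \<and> (\<Sum>i\<in>UNIV. (L2_norm \<Omega> (partial i \<phi>))\<^sup>2) \<le> \<Lambda>"
        by (elim bexE) (intro exI conjI; auto)
    qed
    from bchoice[OF this] obtain \<phi> where sel: "\<forall>k\<in>K. \<phi> k \<in> test_functions \<Omega>
        \<and> L2_norm \<Omega> (\<lambda>x. \<phi> k x - e k x) < \<eta>
        \<and> (\<Sum>i\<in>UNIV. (L2_norm \<Omega> (partial i (\<phi> k)))\<^sup>2) \<le> \<Lambda>"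
      by (elim exE)
    have \<phi>: "k \<in> K \<Longrightarrow> \<phi> k \<in> test_functions \<Omega>"
      and close: "k \<in> K \<Longrightarrow> L2_norm \<Omega> (\<lambda>x. \<phi> k x - e k x) < \<eta>"
      and energy: "k \<in> K \<Longrightarrow> (\<Sum>i\<in>UNIV. (L2_norm \<Omega> (partial i (\<phi> k)))\<^sup>2) \<le> \<Lambda>" for k
      using sel by auto
    have meas[measurable]: "k \<in> K \<Longrightarrow> \<phi> k \<in> borel_measurable borel" for k
      using \<phi> by (intro test_function_borel)
    have \<phi>_L2: "k \<in> K \<Longrightarrow> \<phi> k \<in> L2 \<Omega>" for k
      using \<phi> assms(1) by (intro test_function_L2)
    have eK: "k \<in> K \<Longrightarrow> e k \<in> L2 \<Omega>" for k
      using e_L2 K by auto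
    define p where "p k x = L2_inner \<Omega> (ball_mean_weight \<epsilon> x) (\<phi> k)" for k x
    define Q where "Q k x = (\<integral>\<^sup>+z. ennreal (ball_mean_weight \<epsilon> 0 z)
        * ennreal ((\<phi> k (x + z) - \<phi> k x)\<^sup>2) \<partial>lborel)" for k x
    \<comment> \<open>The Hilbert-Schmidt bound: at fixed \<open>x\<close>, Bessel for the
      orthonormal \<open>e k\<close> gives at most \<open>1 / V\<close>, whatever the size of
      \<open>K\<close>. Passing to \<open>\<phi> k\<close> doubles this and adds the approximation
      errors.\<close>
    have p_sum: "(\<Sum>k\<in>K. (p k x)\<^sup>2) \<le> 4 / V" for x
    proof -
      let ?r = "ball_mean_weight \<epsilon> x"
      note r = ball_mean_weight_L2[OF assms(1) \<epsilon>(1), of x, folded V_def]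
      have "(p k x)\<^sup>2 \<le> 2 * (L2_inner \<Omega> ?r (e k))\<^sup>2 + 2 * (1 / V * \<eta>\<^sup>2)" if k: "k \<in> K" for k
      proof -
        define d where "d = L2_inner \<Omega> ?r (\<lambda>x. \<phi> k x - e k x)"
        have "\<bar>d\<bar> \<le> L2_norm \<Omega> ?r * L2_norm \<Omega> (\<lambda>x. \<phi> k x - e k x)"
          unfolding d_def using r(1) \<phi>_L2[OF k] eK[OF k] by (intro L2_inner_le_norms L2_diff)
        also have "\<dots> \<le> L2_norm \<Omega> ?r * \<eta>"
          using close[OF k] by (intro mult_left_mono) auto
        finally have "\<bar>d\<bar>\<^sup>2 \<le> (L2_norm \<Omega> ?r * \<eta>)\<^sup>2"
          by (intro power_mono) auto
        also have "\<dots> \<le> 1 / V * \<eta>\<^sup>2"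
          unfolding power_mult_distrib L2_norm_square using r(2) by (intro mult_right_mono) auto
        finally have "d\<^sup>2 \<le> 1 / V * \<eta>\<^sup>2" by simp
        moreover have "p k x = L2_inner \<Omega> ?r (e k) + d"
          unfolding p_def d_def using r(1) \<phi>_L2[OF k] eK[OF k] by (simp add: L2_inner_diff_right)
        moreover have "(a + d)\<^sup>2 \<le> 2 * a\<^sup>2 + 2 * d\<^sup>2" for a
          using zero_le_power2[of "a - d"] by (simp add: power2_eq_square algebra_simps)
        ultimately show ?thesis by (smt (verit, best))
      qed
      then have "(\<Sum>k\<in>K. (p k x)\<^sup>2)
          \<le> (\<Sum>k\<in>K. 2 * (L2_inner \<Omega> ?r (e k))\<^sup>2 + 2 * (1 / V * \<eta>\<^sup>2))"
        by (rule sum_mono)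
      also have "\<dots> = 2 * (\<Sum>k\<in>K. (L2_inner \<Omega> ?r (e k))\<^sup>2) + 2 / V * (real (card K) * \<eta>\<^sup>2)"
        by (simp add: sum.distrib sum_distrib_left)
      also have "\<dots> \<le> 2 * (1 / V) + 2 / V * 1"
      proof (intro add_mono mult_left_mono \<eta>(3))
        have "(\<Sum>k\<in>K. (L2_inner \<Omega> ?r (e k))\<^sup>2) \<le> L2_inner \<Omega> ?r ?r"
          using K(1) orth by (intro L2_Bessel K(2) r(1) eK) blast+
        then show "(\<Sum>k\<in>K. (L2_inner \<Omega> ?r (e k))\<^sup>2) \<le> 1 / V"
          using r(2) by linarith
      qed (use V in auto)
      finally show ?thesis by simp
    qed
    have Q_meas[measurable]: "Q k \<in> borel_measurable borel" if [simp, measurable]: "k \<in> K" for k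
      unfolding Q_def by measurable
    \<comment> \<open>The weight has mass 1 and vanishes unless
      \<open>norm z \<le> \<epsilon>\<close>, so the translation estimate holds with the common
      bound \<open>\<epsilon>\<^sup>2 * \<Lambda>\<close>.\<close>
    have Q_int: "(\<integral>\<^sup>+x. Q k x \<partial>lborel) \<le> ennreal (1 / 16)" if k: "k \<in> K" for k
    proof -
      note [measurable] = meas[OF k]
      have "(\<integral>\<^sup>+x. Q k x \<partial>lborel) = (\<integral>\<^sup>+z. (\<integral>\<^sup>+x. ennreal (ball_mean_weight \<epsilon> 0 z)
          * ennreal ((\<phi> k (x + z) - \<phi> k x)\<^sup>2) \<partial>lborel) \<partial>lborel)"
        unfolding Q_def by (rule lborel_pair.Fubini') measurable
      also have "\<dots> = (\<integral>\<^sup>+z. ennreal (ball_mean_weight \<epsilon> 0 z)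
          * (\<integral>\<^sup>+x. ennreal ((\<phi> k (x + z) - \<phi> k x)\<^sup>2) \<partial>lborel) \<partial>lborel)"
        by (intro nn_integral_cong nn_integral_cmult) measurable
      also have "\<dots> \<le> (\<integral>\<^sup>+z. ennreal (ball_mean_weight \<epsilon> (0::real^'n) z) * ennreal (\<epsilon>\<^sup>2 * \<Lambda>) \<partial>lborel)"
      proof (intro nn_integral_mono)
        fix z :: "real^'n"
        show "ennreal (ball_mean_weight \<epsilon> 0 z)
            * (\<integral>\<^sup>+x. ennreal ((\<phi> k (x + z) - \<phi> k x)\<^sup>2) \<partial>lborel)
            \<le> ennreal (ball_mean_weight \<epsilon> 0 z) * ennreal (\<epsilon>\<^sup>2 * \<Lambda>)"
        proof (cases "z \<in> cball 0 \<epsilon>")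
          case True
          then have "(norm z)\<^sup>2 \<le> \<epsilon>\<^sup>2" by (intro power_mono) auto
          then have "(norm z)\<^sup>2 * (\<Sum>i\<in>UNIV. (L2_norm \<Omega> (partial i (\<phi> k)))\<^sup>2) \<le> \<epsilon>\<^sup>2 * \<Lambda>"
            using energy[OF k] by (intro mult_mono) (auto intro: sum_nonneg)
          then have "(\<integral>\<^sup>+x. ennreal ((\<phi> k (x + z) - \<phi> k x)\<^sup>2) \<partial>lborel) \<le> ennreal (\<epsilon>\<^sup>2 * \<Lambda>)"
            by (intro order_trans[OF translation_estimate[OF assms(1) \<phi>[OF k]]] ennreal_leI)
          then show ?thesis by (rule mult_left_mono) simp
        qed (simp add: ball_mean_weight_def)
      qed
      also have "\<dots> = (\<integral>\<^sup>+z. ennreal (ball_mean_weight \<epsilon> (0::real^'n) z) \<partial>lborel) * ennreal (\<epsilon>\<^sup>2 * \<Lambda>)"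
        by (rule nn_integral_multc) measurable
      also have "(\<integral>\<^sup>+z. ennreal (ball_mean_weight \<epsilon> (0::real^'n) z) \<partial>lborel) = ennreal 1"
      proof -
        have "0 \<le> ball_mean_weight \<epsilon> (0::real^'n) z" for z
          by (simp add: ball_mean_weight_def)
        then show ?thesis
          using ball_mean_weight_integral[OF \<epsilon>(1), where x = "0::real^'n"]
          by (subst nn_integral_eq_integral) simp_all
      qed
      finally show ?thesis by (simp add: \<epsilon>)
    qed
    \<comment> \<open>Outside \<Omega> the left side is 0; the indicator keeps the integral of the
      constant \<open>8 / V\<close> finite.\<close>
    have "(\<Sum>k\<in>K. ennreal ((\<phi> k x)\<^sup>2))
        \<le> ennreal 2 * (\<Sum>k\<in>K. Q k x) + ennreal (8 / V) * indicator \<Omega> x" for x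
    proof (cases "x \<in> \<Omega>")
      case True
      have "(\<Sum>k\<in>K. ennreal ((\<phi> k x)\<^sup>2))
          \<le> (\<Sum>k\<in>K. ennreal 2 * Q k x + ennreal (2 * (p k x)\<^sup>2))"
        unfolding Q_def p_def
        by (intro sum_mono ball_mean_deviation[OF assms(1) _ \<epsilon>(1)] \<phi>)
      also have "\<dots> = ennreal 2 * (\<Sum>k\<in>K. Q k x) + ennreal (2 * (\<Sum>k\<in>K. (p k x)\<^sup>2))"
        by (simp add: sum.distrib sum_distrib_left sum_ennreal)
      also have "\<dots> \<le> ennreal 2 * (\<Sum>k\<in>K. Q k x) + ennreal (8 / V)"
        using p_sum[of x] by (intro add_left_mono ennreal_leI) simp
      finally show ?thesis using True by simp
    next
      case False
      then have "(\<Sum>k\<in>K. ennreal ((\<phi> k x)\<^sup>2)) = 0"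
        using test_function_outside[OF \<phi> False] by (intro sum.neutral) simp
      then show ?thesis by simp
    qed
    then have "(\<integral>\<^sup>+x. (\<Sum>k\<in>K. ennreal ((\<phi> k x)\<^sup>2)) \<partial>lborel)
        \<le> (\<integral>\<^sup>+x. ennreal 2 * (\<Sum>k\<in>K. Q k x) + ennreal (8 / V) * indicator \<Omega> x \<partial>lborel)"
      by (intro nn_integral_mono)
    also have "\<dots> = ennreal 2 * (\<Sum>k\<in>K. \<integral>\<^sup>+x. Q k x \<partial>lborel) + ennreal (8 / V) * ennreal \<mu>"
    proof -
      have [measurable]: "(\<lambda>x. \<Sum>k\<in>K. Q k x) \<in> borel_measurable borel" "\<Omega> \<in> sets borel"
        using assms(1) by (auto intro!: borel_measurable_sum Q_meas)
      show ?thesis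
        using Q_meas assms(1)
        by (subst nn_integral_add) (auto simp: nn_integral_cmult nn_integral_sum \<mu>)
    qed
    also have "\<dots> \<le> ennreal 2 * (\<Sum>k\<in>K. ennreal (1 / 16)) + ennreal (8 / V) * ennreal \<mu>"
      using Q_int by (intro add_right_mono mult_left_mono sum_mono) auto
    also have "\<dots> = ennreal (real (card K) / 8 + 8 / V * \<mu>)"
    proof -
      have "ennreal 2 * (\<Sum>k\<in>K. ennreal (1 / 16)) = ennreal 2 * ennreal (\<Sum>k\<in>K. 1 / 16)"
        by (subst sum_ennreal) auto
      also have "\<dots> = ennreal (2 * (\<Sum>k\<in>K. 1 / 16))"
        by (rule ennreal_mult[symmetric]) (auto intro: sum_nonneg)
      also have "\<dots> = ennreal (real (card K) / 8)"
        by simp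
      moreover have "ennreal (8 / V) * ennreal \<mu> = ennreal (8 / V * \<mu>)"
        using V by (intro ennreal_mult[symmetric]) (auto simp: \<mu>_def)
      ultimately show ?thesis
        using V by (simp add: \<mu>_def)
    qed
    finally have "(\<integral>\<^sup>+x. (\<Sum>k\<in>K. ennreal ((\<phi> k x)\<^sup>2)) \<partial>lborel)
        \<le> ennreal (real (card K) / 8 + 8 / V * \<mu>)" .
    moreover have "(\<integral>\<^sup>+x. (\<Sum>k\<in>K. ennreal ((\<phi> k x)\<^sup>2)) \<partial>lborel)
        = ennreal (\<Sum>k\<in>K. (L2_norm \<Omega> (\<phi> k))\<^sup>2)"
      using \<phi> meas
      by (subst nn_integral_sum) (auto simp: nn_integral_test_function_square[OF assms(1)] sum_ennreal)
    ultimately have "ennreal (\<Sum>k\<in>K. (L2_norm \<Omega> (\<phi> k))\<^sup>2) \<le> ennreal (real (card K) / 8 + 8 / V * \<mu>)"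
      by simp
    then have "(\<Sum>k\<in>K. (L2_norm \<Omega> (\<phi> k))\<^sup>2) \<le> real (card K) / 8 + 8 / V * \<mu>"
      using V by (subst (asm) ennreal_le_iff) (auto simp: \<mu>_def)
    moreover have "1 / 4 \<le> (L2_norm \<Omega> (\<phi> k))\<^sup>2" if k: "k \<in> K" for k
    proof -
      have "L2_norm \<Omega> (e k) = 1"
        using orth[of k k] k K by (simp add: L2_norm_def L2_inner_def power2_eq_square subsetD)
      then have "1 / 2 \<le> L2_norm \<Omega> (\<phi> k)"
        using abs_L2_norm_diff_le[OF \<phi>_L2[OF k] eK[OF k]] close[OF k] \<eta>(2) by linarith
      then have "(1 / 2)\<^sup>2 \<le> (L2_norm \<Omega> (\<phi> k))\<^sup>2"
        by (intro power_mono) auto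
      then show ?thesis by (simp add: power2_eq_square)
    qed
    then have "real (card K) * (1 / 4) \<le> (\<Sum>k\<in>K. (L2_norm \<Omega> (\<phi> k))\<^sup>2)"
      using sum_mono[of K "\<lambda>_. 1 / 4 :: real"] by simp
    \<comment> \<open>Here \<open>card K / 4 \<le> card K / 8 + 8 * \<mu> / V\<close>, and the
      \<open>card K\<close> on the right is absorbed.\<close>
    ultimately have "real (card K) \<le> 64 * \<mu> / V"
      by (simp add: field_simps)
    then show ?thesis by linarith
  qed
  then show ?thesis
    using finite_if_finite_subsets_card_bdd by blast
qed

section \<open>The spectrum of the Dirichlet Laplacian\<close>

text \<open>The witnesses for \<open>f \<in> H10 \<Omega>\<close> in one predicate, so that the same
  gradient and approximating sequence can be used in several limits.\<close>

definition H10_gradient ::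
  "(real^'n::finite) set \<Rightarrow> (real^'n \<Rightarrow> real) \<Rightarrow> ('n \<Rightarrow> real^'n \<Rightarrow> real) \<Rightarrow> (nat \<Rightarrow> real^'n \<Rightarrow> real) \<Rightarrow> bool"
  where "H10_gradient \<Omega> f G \<phi> \<longleftrightarrow>
    f \<in> L2 \<Omega> \<and> (\<forall>i. G i \<in> L2 \<Omega> \<and> weak_partial \<Omega> i f (G i)) \<and>
    (\<forall>m. \<phi> m \<in> test_functions \<Omega>) \<and>
    (\<lambda>m. L2_norm \<Omega> (\<lambda>x. \<phi> m x - f x)) \<longlonglongrightarrow> 0 \<and>
    (\<forall>i. (\<lambda>m. L2_norm \<Omega> (\<lambda>x. partial i (\<phi> m) x - G i x)) \<longlonglongrightarrow> 0)"

lemma dirichlet_laplacian_L2: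
  assumes "dirichlet_laplacian \<Omega> f h"
  shows "f \<in> L2 \<Omega>" "h \<in> L2 \<Omega>"
  using assms by (auto simp: dirichlet_laplacian_def H2_def)

lemma dirichlet_laplacian_gradient:
  assumes "dirichlet_laplacian \<Omega> f h"
  obtains G \<phi> where "H10_gradient \<Omega> f G \<phi>"
  using assms that unfolding dirichlet_laplacian_def H10_def H10_gradient_def H2_def by blast

text \<open>
  The weak gradient from the definition of \<open>\<Delta>f\<close> and the one from \<open>f \<in> H\<^sup>1\<^sub>0(\<Omega>)\<close> need not be
  identified: both have the same inner products with the test functions \<open>\<partial>\<^sub>i\<phi>\<^sub>m\<close>.
\<close>

lemma dirichlet_form:
  assumes "open \<Omega>" "dirichlet_laplacian \<Omega> f h" "H10_gradient \<Omega> f F \<psi>" "H10_gradient \<Omega> f' G \<phi>"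
  shows "L2_inner \<Omega> h f' = - (\<Sum>i\<in>UNIV. L2_inner \<Omega> (F i) (G i))"
proof -
  obtain g g' where g: "\<And>i. g i \<in> L2 \<Omega>" "\<And>i. weak_partial \<Omega> i f (g i)"
      "\<And>i. g' i \<in> L2 \<Omega>" "\<And>i. weak_partial \<Omega> i (g i) (g' i)"
    and h: "L2_eq \<Omega> h (\<lambda>x. \<Sum>i\<in>UNIV. g' i x)"
    using assms(2) unfolding dirichlet_laplacian_def weak_laplacian_def by blast
  have F: "\<And>i. F i \<in> L2 \<Omega>" "\<And>i. weak_partial \<Omega> i f (F i)"
    using assms(3) by (auto simp: H10_gradient_def)
  have G: "\<And>i. G i \<in> L2 \<Omega>" "f' \<in> L2 \<Omega>" and \<phi>: "\<And>m. \<phi> m \<in> test_functions \<Omega>"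
    and lim: "(\<lambda>m. L2_norm \<Omega> (\<lambda>x. \<phi> m x - f' x)) \<longlonglongrightarrow> 0"
      "\<And>i. (\<lambda>m. L2_norm \<Omega> (\<lambda>x. partial i (\<phi> m) x - G i x)) \<longlonglongrightarrow> 0"
    using assms(4) by (auto simp: H10_gradient_def)
  have h_L2: "h \<in> L2 \<Omega>" by (rule dirichlet_laplacian_L2[OF assms(2)])
  have \<phi>_L2: "\<phi> m \<in> L2 \<Omega>" "partial i (\<phi> m) \<in> L2 \<Omega>" for i m
    using assms(1) \<phi> by (auto intro: test_function_L2 test_function_partial)
  have eq: "L2_inner \<Omega> (\<phi> m) h = - (\<Sum>i\<in>UNIV. L2_inner \<Omega> (partial i (\<phi> m)) (F i))" for m
  proof -
    have "L2_inner \<Omega> h (\<phi> m) = (\<Sum>i\<in>UNIV. L2_inner \<Omega> (g' i) (\<phi> m))"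
      using L2_inner_cong[OF h h_L2 _ \<phi>_L2(1)] g(3) \<phi>_L2 by (simp add: L2_sum L2_inner_sum_left)
    also have "\<dots> = (\<Sum>i\<in>UNIV. - L2_inner \<Omega> (F i) (partial i (\<phi> m)))"
    proof (intro sum.cong refl)
      fix i
      have "L2_inner \<Omega> (g' i) (\<phi> m) = - L2_inner \<Omega> (g i) (partial i (\<phi> m))"
        using g(4)[of i] \<phi>[of m] by (simp add: weak_partial_def)
      \<comment> \<open>Going through the second derivative of the test function exchanges the
        gradient \<open>g\<close> for \<open>F\<close>.\<close>
      also have "\<dots> = L2_inner \<Omega> f (partial i (partial i (\<phi> m)))"
        using g(2)[of i] test_function_partial[OF \<phi>[of m], of i] by (simp add: weak_partial_def)
      also have "\<dots> = - L2_inner \<Omega> (F i) (partial i (\<phi> m))"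
        using F(2)[of i] test_function_partial[OF \<phi>[of m], of i] by (simp add: weak_partial_def)
      finally show "L2_inner \<Omega> (g' i) (\<phi> m) = - L2_inner \<Omega> (F i) (partial i (\<phi> m))" .
    qed
    finally show ?thesis
      by (simp add: L2_inner_commute[of \<Omega> "\<phi> m"] L2_inner_commute[of \<Omega> "partial _ _"] sum_negf)
  qed
  have "(\<lambda>m. L2_inner \<Omega> (\<phi> m) h) \<longlonglongrightarrow> L2_inner \<Omega> f' h"
    using \<phi>_L2 G h_L2 lim by (intro L2_inner_tendsto) auto
  moreover have "(\<lambda>m. L2_inner \<Omega> (\<phi> m) h) \<longlonglongrightarrow> - (\<Sum>i\<in>UNIV. L2_inner \<Omega> (G i) (F i))"
    unfolding eq using \<phi>_L2 G F lim by (intro tendsto_minus tendsto_sum L2_inner_tendsto) auto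
  ultimately show ?thesis
    by (auto dest: LIMSEQ_unique simp: L2_inner_commute[of \<Omega> f'] L2_inner_commute[of \<Omega> "G _"])
qed

text \<open>Both sides are minus the Dirichlet form of \<open>f\<close> and \<open>f'\<close>, which
  is symmetric.\<close>

lemma dirichlet_laplacian_symmetric:
  assumes "open \<Omega>" "dirichlet_laplacian \<Omega> f h" "dirichlet_laplacian \<Omega> f' h'"
  shows "L2_inner \<Omega> h f' = L2_inner \<Omega> f h'"
proof -
  obtain F \<psi> G \<phi> where FG: "H10_gradient \<Omega> f F \<psi>" "H10_gradient \<Omega> f' G \<phi>"
    using assms(2,3) by (metis dirichlet_laplacian_gradient)
  show ?thesis
    using dirichlet_form[OF assms(1,2) FG] dirichlet_form[OF assms(1,3) FG(2,1)]
    by (simp add: L2_inner_commute[of _ f] L2_inner_commute[of _ "G _"])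
qed

text \<open>The limit is the Dirichlet form of \<open>f\<close> with itself. For a normalised
  eigenfunction it is the eigenvalue, so eigenvalue bounds become energy bounds for test
  functions.\<close>

lemma dirichlet_energy_tendsto:
  assumes "open \<Omega>" "dirichlet_laplacian \<Omega> f h" "H10_gradient \<Omega> f G \<phi>"
  shows "(\<lambda>m. \<Sum>i\<in>UNIV. (L2_norm \<Omega> (partial i (\<phi> m)))\<^sup>2) \<longlonglongrightarrow> - L2_inner \<Omega> h f"
proof -
  have "(\<lambda>m. \<Sum>i\<in>UNIV. (L2_norm \<Omega> (partial i (\<phi> m)))\<^sup>2) \<longlonglongrightarrow> (\<Sum>i\<in>UNIV. (L2_norm \<Omega> (G i))\<^sup>2)"
    using assms
    by (intro tendsto_sum tendsto_power L2_norm_tendsto)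
      (auto simp: H10_gradient_def intro!: always_eventually test_function_L2 test_function_partial)
  then show ?thesis
    using dirichlet_form[OF assms(1,2,3,3)] by (simp add: L2_norm_square)
qed

lemma dirichlet_Poincare:
  fixes \<Omega> :: "(real^'n::finite) set"
  assumes "open \<Omega>" "bounded \<Omega>"
  obtains P where "P > 0"
    "\<And>f h. dirichlet_laplacian \<Omega> f h \<Longrightarrow> (L2_norm \<Omega> f)\<^sup>2 \<le> P * (- L2_inner \<Omega> h f)"
proof -
  obtain P where P: "P > 0" "\<And>\<phi>. \<phi> \<in> test_functions \<Omega> \<Longrightarrow>
      (L2_norm \<Omega> \<phi>)\<^sup>2 \<le> P * (\<Sum>i\<in>UNIV. (L2_norm \<Omega> (partial i \<phi>))\<^sup>2)"
    using Poincare_test_function[OF assms] by blast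
  have "(L2_norm \<Omega> f)\<^sup>2 \<le> P * (- L2_inner \<Omega> h f)" if f: "dirichlet_laplacian \<Omega> f h" for f h
  proof -
    obtain G \<phi> where G: "H10_gradient \<Omega> f G \<phi>"
      using f by (rule dirichlet_laplacian_gradient)
    have "(\<lambda>m. (L2_norm \<Omega> (\<phi> m))\<^sup>2) \<longlonglongrightarrow> (L2_norm \<Omega> f)\<^sup>2"
      using G assms(1)
      by (intro tendsto_power L2_norm_tendsto) (auto simp: H10_gradient_def intro!: always_eventually test_function_L2)
    moreover have "(\<lambda>m. P * (\<Sum>i\<in>UNIV. (L2_norm \<Omega> (partial i (\<phi> m)))\<^sup>2)) \<longlonglongrightarrow> P * (- L2_inner \<Omega> h f)"
      by (intro tendsto_mult_left dirichlet_energy_tendsto[OF assms(1) f G])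
    ultimately show ?thesis
      using P(2) G by (intro LIMSEQ_le) (auto simp: H10_gradient_def)
  qed
  then show ?thesis using that P(1) by blast
qed

section \<open>Positivity and divergence of the eigenvalues, Parseval\<close>

locale dirichlet_spectrum =
  fixes \<Omega> :: "(real^'n::finite) set" and lam :: "nat \<Rightarrow> real" and e :: "nat \<Rightarrow> real^'n \<Rightarrow> real"
  assumes open_domain: "open \<Omega>" and bounded_domain: "bounded \<Omega>"
    and eigenbasis: "dirichlet_eigenbasis \<Omega> lam e"
begin

lemma e_L2: "e k \<in> L2 \<Omega>"
  and eigenfunction: "dirichlet_laplacian \<Omega> (e k) (\<lambda>x. - (lam k * e k x))"
  and e_inner: "L2_inner \<Omega> (e j) (e k) = (if j = k then 1 else 0)"
  and e_expansion: "f \<in> L2 \<Omega> \<Longrightarrow>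
    (\<lambda>N. L2_norm \<Omega> (\<lambda>x. f x - (\<Sum>k<N. L2_inner \<Omega> f (e k) * e k x))) \<longlonglongrightarrow> 0"
  using eigenbasis by (auto simp: dirichlet_eigenbasis_def)

lemma e_norm: "L2_norm \<Omega> (e k) = 1"
  using e_inner[of k k] by (simp add: L2_norm_def L2_inner_def power2_eq_square)

lemma energy_e: "- L2_inner \<Omega> (\<lambda>x. - (lam k * e k x)) (e k) = lam k"
  by (simp add: L2_inner_minus_left L2_inner_scale_left e_inner)

text \<open>For \<open>e k\<close>, of norm 1 and energy \<open>lam k\<close>, the Poincare
  inequality reads \<open>1 \<le> P * lam k\<close>.\<close>

lemma lam_pos: "lam k > 0"
proof -
  obtain P where "P > 0" "\<And>f h. dirichlet_laplacian \<Omega> f h \<Longrightarrow>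
      (L2_norm \<Omega> f)\<^sup>2 \<le> P * (- L2_inner \<Omega> h f)"
    using dirichlet_Poincare[OF open_domain bounded_domain] by blast
  from this(1) this(2)[OF eigenfunction[of k]] show ?thesis
    unfolding energy_e e_norm by (smt (verit) mult_nonneg_nonpos one_power2)
qed

text \<open>The \<open>e k\<close> with \<open>lam k \<le> L\<close> are orthonormal and limits of
  test functions of bounded energy, so compactness leaves only finitely many.\<close>

lemma finite_lam_le: "finite {k. lam k \<le> L}"
proof -
  \<comment> \<open>\<open>L + 1\<close> leaves room for energies converging to
    \<open>lam k \<le> L\<close>; the maximum makes \<Lambda> positive for every
    \<open>L\<close>.\<close>
  define \<Lambda> where "\<Lambda> = max 1 (L + 1)"
  show ?thesis
  proof (rule finite_orthonormal_bounded_energy[OF open_domain bounded_domain, where e = e])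
    show "\<Lambda> > 0" by (simp add: \<Lambda>_def)
    fix k and \<eta> :: real assume k: "k \<in> {k. lam k \<le> L}" and "\<eta> > 0"
    obtain G \<phi> where G: "H10_gradient \<Omega> (e k) G \<phi>"
      using eigenfunction by (rule dirichlet_laplacian_gradient)
    have "(\<lambda>m. \<Sum>i\<in>UNIV. (L2_norm \<Omega> (partial i (\<phi> m)))\<^sup>2) \<longlonglongrightarrow> lam k"
      using dirichlet_energy_tendsto[OF open_domain eigenfunction G] by (simp only: energy_e)
    moreover have "lam k < \<Lambda>" using k by (simp add: \<Lambda>_def)
    ultimately have "\<forall>\<^sub>F m in sequentially. (\<Sum>i\<in>UNIV. (L2_norm \<Omega> (partial i (\<phi> m)))\<^sup>2) < \<Lambda>"
      by (rule order_tendstoD)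
    moreover have "\<forall>\<^sub>F m in sequentially. L2_norm \<Omega> (\<lambda>x. \<phi> m x - e k x) < \<eta>"
      using G \<open>\<eta> > 0\<close> by (intro order_tendstoD(2)[where y = 0]) (auto simp: H10_gradient_def)
    ultimately have "\<exists>m. (\<Sum>i\<in>UNIV. (L2_norm \<Omega> (partial i (\<phi> m)))\<^sup>2) < \<Lambda>
        \<and> L2_norm \<Omega> (\<lambda>x. \<phi> m x - e k x) < \<eta>"
      by (intro eventually_happens'[OF sequentially_bot] eventually_conj)
    then show "\<exists>\<phi>\<in>test_functions \<Omega>. L2_norm \<Omega> (\<lambda>x. \<phi> x - e k x) < \<eta>
        \<and> (\<Sum>i\<in>UNIV. (L2_norm \<Omega> (partial i \<phi>))\<^sup>2) \<le> \<Lambda>"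
      using G unfolding H10_gradient_def by (meson less_imp_le)
  qed (auto simp: e_L2 e_inner)
qed

lemma Parseval:
  assumes "f \<in> L2 \<Omega>"
  shows "(\<lambda>k. (L2_inner \<Omega> f (e k))\<^sup>2) sums (L2_norm \<Omega> f)\<^sup>2"
proof -
  define c where "c k = L2_inner \<Omega> f (e k)" for k
  define g where "g N x = (\<Sum>k<N. c k * e k x)" for N x
  have g: "g N \<in> L2 \<Omega>" for N
    unfolding g_def by (intro L2_sum L2_scale e_L2)
  have "(L2_norm \<Omega> (g N))\<^sup>2 = (\<Sum>k<N. (c k)\<^sup>2)" for N
  proof -
    have g_inner: "L2_inner \<Omega> (g N) h = (\<Sum>k<N. c k * L2_inner \<Omega> (e k) h)" if "h \<in> L2 \<Omega>" for h
      unfolding g_def using that by (simp add: L2_inner_sum_left L2_scale L2_inner_scale_left e_L2)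
    have "L2_inner \<Omega> (e k) (g N) = c k" if "k < N" for k
      using that g_inner[OF e_L2[of k]]
      by (simp add: L2_inner_commute[of \<Omega> "e k" "g N"] e_inner if_distrib[of "\<lambda>x. _ * x"]
          sum.delta cong: if_cong)
    then show ?thesis
      unfolding L2_norm_square g_inner[OF g] by (simp add: power2_eq_square)
  qed
  moreover have "(\<lambda>N. (L2_norm \<Omega> (g N))\<^sup>2) \<longlonglongrightarrow> (L2_norm \<Omega> f)\<^sup>2"
  proof (intro tendsto_power L2_norm_tendsto always_eventually allI g assms)
    show "(\<lambda>N. L2_norm \<Omega> (\<lambda>x. g N x - f x)) \<longlonglongrightarrow> 0"
      using e_expansion[OF assms] unfolding g_def c_def by (subst L2_norm_diff_commute)
  qed
  ultimately show ?thesis by (simp add: sums_def c_def)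
qed

lemma L2_eq_0_iff_coefficients:
  assumes "f \<in> L2 \<Omega>"
  shows "L2_eq \<Omega> f (\<lambda>x. 0) \<longleftrightarrow> (\<forall>k. L2_inner \<Omega> f (e k) = 0)"
proof
  assume "\<forall>k. L2_inner \<Omega> f (e k) = 0"
  then have "(\<lambda>_. 0) sums (L2_norm \<Omega> f)\<^sup>2"
    using Parseval[OF assms] by simp
  then have "(L2_norm \<Omega> f)\<^sup>2 = 0"
    using sums_unique2 sums_zero by blast
  then show "L2_eq \<Omega> f (\<lambda>x. 0)"
    using L2_norm_eq_0_iff[OF assms] by simp
next
  assume "L2_eq \<Omega> f (\<lambda>x. 0)"
  then show "\<forall>k. L2_inner \<Omega> f (e k) = 0"
    using L2_inner_cong[OF _ assms L2_zero e_L2] by simp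
qed

end

section \<open>The heat semigroup on eigenfunctions\<close>

text \<open>The expanded product contains the diagonal terms; the others are nonnegative.\<close>

lemma sum_mult_le_mult_sum:
  fixes a b :: "'i \<Rightarrow> real"
  assumes "finite I" "\<And>i. i \<in> I \<Longrightarrow> 0 \<le> a i" "\<And>i. i \<in> I \<Longrightarrow> 0 \<le> b i"
  shows "(\<Sum>i\<in>I. a i * b i) \<le> (\<Sum>i\<in>I. a i) * (\<Sum>i\<in>I. b i)"
proof -
  have "(\<Sum>i\<in>I. a i * b i) \<le> (\<Sum>i\<in>I. (\<Sum>j\<in>I. a j) * b i)"
    using assms by (intro sum_mono mult_right_mono member_le_sum) auto
  then show ?thesis by (simp add: sum_distrib_left)
qed

text \<open>\<open>1 + q T \<le> (1 + q (T / n)) ^ n \<le> exp (n * q (T / n))\<close>, and the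
  exponent tends to 0 because \<open>q h = o(h)\<close>.\<close>

lemma submultiplicative_vanishes:
  fixes q :: "real \<Rightarrow> real"
  assumes nonneg: "\<And>s. 0 \<le> q s"
    and submult: "\<And>s t. 0 < s \<Longrightarrow> 0 < t \<Longrightarrow> 1 + q (s + t) \<le> (1 + q s) * (1 + q t)"
    and small: "((\<lambda>h. q h / h) \<longlongrightarrow> 0) (at_right 0)"
    and "T > 0"
  shows "q T = 0"
proof -
  have power: "1 + q (real (Suc n) * h) \<le> (1 + q h) ^ Suc n" if "h > 0" for n h
  proof (induction n)
    case (Suc n)
    have "1 + q (real (Suc (Suc n)) * h) = 1 + q (real (Suc n) * h + h)"
      by (simp add: algebra_simps)
    also have "\<dots> \<le> (1 + q (real (Suc n) * h)) * (1 + q h)"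
      using \<open>h > 0\<close> by (intro submult) auto
    also have "\<dots> \<le> (1 + q h) ^ Suc n * (1 + q h)"
      using Suc nonneg[of h] by (intro mult_right_mono) auto
    finally show ?case by (simp add: mult_ac)
  qed simp
  have "1 + q T \<le> exp (T * (q (T / real (Suc n)) / (T / real (Suc n))))" for n
  proof -
    define h where "h = T / real (Suc n)"
    have h: "h > 0" "real (Suc n) * h = T" using \<open>T > 0\<close> by (auto simp: h_def)
    have "1 + q T \<le> (1 + q h) ^ Suc n" using power[OF h(1), of n] unfolding h(2) .
    also have "\<dots> \<le> exp (q h) ^ Suc n"
      using nonneg[of h] by (intro power_mono) auto
    also have "\<dots> = exp (real (Suc n) * q h)"
      by (simp only: exp_of_nat_mult)
    also have "real (Suc n) * q h = T * (q h / h)"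
      using h(1) by (simp add: h(2)[symmetric] del: of_nat_Suc)
    finally show ?thesis unfolding h_def .
  qed
  moreover have "(\<lambda>n. exp (T * (q (T / real (Suc n)) / (T / real (Suc n))))) \<longlonglongrightarrow> exp (T * 0)"
  proof (intro tendsto_exp tendsto_mult_left)
    have "(\<lambda>n. T * (1 / real (Suc n))) \<longlonglongrightarrow> T * 0"
      using LIMSEQ_Suc[OF lim_1_over_n] by (intro tendsto_mult_left) simp
    then have "filterlim (\<lambda>n. T / real (Suc n)) (at_right 0) sequentially"
      using \<open>T > 0\<close> by (intro filterlim_at_withinI always_eventually) auto
    then show "(\<lambda>n. q (T / real (Suc n)) / (T / real (Suc n))) \<longlonglongrightarrow> 0"
      by (rule filterlim_compose[OF small])
  qed
  ultimately have "1 + q T \<le> exp (T * 0)"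
    by (intro LIMSEQ_le_const) auto
  then show ?thesis using nonneg[of T] by simp
qed

locale heat_semigroup = dirichlet_spectrum \<Omega> lam e
  for \<Omega> :: "(real^'n::finite) set" and lam e +
  fixes S :: "real \<Rightarrow> (real^'n \<Rightarrow> real) \<Rightarrow> real^'n \<Rightarrow> real"
  assumes semigroup: "dirichlet_heat_semigroup \<Omega> S"
begin

lemma S_L2: "t \<ge> 0 \<Longrightarrow> f \<in> L2 \<Omega> \<Longrightarrow> S t f \<in> L2 \<Omega>"
  and S_linear: "t \<ge> 0 \<Longrightarrow> f \<in> L2 \<Omega> \<Longrightarrow> g \<in> L2 \<Omega> \<Longrightarrow>
    L2_eq \<Omega> (S t (\<lambda>x. f x + c * g x)) (\<lambda>x. S t f x + c * S t g x)"
  and S_bounded: "t \<ge> 0 \<Longrightarrow> \<exists>K. \<forall>f\<in>L2 \<Omega>. L2_norm \<Omega> (S t f) \<le> K * L2_norm \<Omega> f"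
  and S_0: "f \<in> L2 \<Omega> \<Longrightarrow> L2_eq \<Omega> (S 0 f) f"
  and S_add: "s \<ge> 0 \<Longrightarrow> t \<ge> 0 \<Longrightarrow> f \<in> L2 \<Omega> \<Longrightarrow> L2_eq \<Omega> (S (s + t) f) (S s (S t f))"
  and S_generator: "f \<in> L2 \<Omega> \<Longrightarrow> h \<in> L2 \<Omega> \<Longrightarrow> dirichlet_laplacian \<Omega> f h \<longleftrightarrow>
    ((\<lambda>t. L2_norm \<Omega> (\<lambda>x. (S t f x - f x) / t - h x)) \<longlongrightarrow> 0) (at_right 0)"
  using semigroup unfolding dirichlet_heat_semigroup_def by blast+

text \<open>\<open>S t\<close> commutes with difference quotients of the semigroup: the quotient at
  \<open>S t (e j)\<close> plus \<open>lam j\<close> times that function is \<open>S t\<close>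
  applied to a family tending to 0, and \<open>S t\<close> is bounded at the fixed time
  \<open>t\<close>.\<close>

lemma S_eigenfunction:
  assumes "t \<ge> 0"
  shows "dirichlet_laplacian \<Omega> (S t (e j)) (\<lambda>x. - (lam j * S t (e j) x))"
proof -
  let ?x = "S t (e j)" and ?l = "lam j"
  have x: "?x \<in> L2 \<Omega>" using assms e_L2 by (rule S_L2)
  obtain K where K: "\<And>f. f \<in> L2 \<Omega> \<Longrightarrow> L2_norm \<Omega> (S t f) \<le> K * L2_norm \<Omega> f"
    using S_bounded[OF assms] by blast
  \<comment> \<open>\<open>u h\<close> is the difference quotient of \<open>e j\<close> plus
    \<open>lam j * e j\<close>, assembled from pieces \<open>f + c * g\<close>, the shape in which
    \<open>S_linear\<close> is stated.\<close>
  define d where "d h z = S h (e j) z + (-1) * e j z" for h z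
  define g where "g z = e j z + (?l - 1) * e j z" for z
  define u where "u h z = g z + (1 / h) * d h z" for h z
  have u_eq: "u h z = (S h (e j) z - e j z) / h - - (?l * e j z)" for h z
    by (simp add: u_def d_def g_def diff_divide_distrib algebra_simps)
  have "((\<lambda>h. L2_norm \<Omega> (u h)) \<longlongrightarrow> 0) (at_right 0)"
    using eigenfunction[of j] S_generator[OF e_L2 L2_minus[OF L2_scale[OF e_L2]], of j ?l j]
    unfolding u_eq[abs_def] by simp
  then have limK: "((\<lambda>h. K * L2_norm \<Omega> (u h)) \<longlongrightarrow> 0) (at_right 0)"
    by (rule tendsto_mult_right_zero)
  have bound: "L2_norm \<Omega> (\<lambda>z. (S h ?x z - ?x z) / h - - (?l * ?x z)) \<le> K * L2_norm \<Omega> (u h)"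
    if "h > 0" for h
  proof -
    have h: "h \<ge> 0" using that by simp
    have L2: "d h \<in> L2 \<Omega>" "g \<in> L2 \<Omega>" "S h (e j) \<in> L2 \<Omega>"
      unfolding d_def g_def using h by (intro L2_add L2_scale S_L2 e_L2; simp)+
    have u: "u h \<in> L2 \<Omega>"
      unfolding u_def using L2 by (intro L2_add L2_scale)
    have "L2_eq \<Omega> (S t (u h)) (\<lambda>z. S t g z + (1 / h) * S t (d h) z)"
      unfolding u_def using assms L2 by (intro S_linear)
    moreover have "L2_eq \<Omega> (S t g) (\<lambda>z. ?x z + (?l - 1) * ?x z)"
      unfolding g_def using assms e_L2 by (intro S_linear)
    moreover have "L2_eq \<Omega> (S t (d h)) (\<lambda>z. S t (S h (e j)) z + (-1) * ?x z)"
      unfolding d_def using assms e_L2 L2 by (intro S_linear)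
    moreover have "L2_eq \<Omega> (S (t + h) (e j)) (S t (S h (e j)))"
      using assms h e_L2 by (rule S_add)
    moreover have "L2_eq \<Omega> (S (t + h) (e j)) (S h ?x)"
      using S_add[OF h assms e_L2] by (simp add: add.commute)
    ultimately have "L2_eq \<Omega> (\<lambda>z. (S h ?x z - ?x z) / h - - (?l * ?x z)) (S t (u h))"
      unfolding L2_eq_def
    proof eventually_elim
      case (elim z)
      then show ?case
        by (simp add: algebra_simps diff_divide_distrib)
    qed
    then have "L2_norm \<Omega> (\<lambda>z. (S h ?x z - ?x z) / h - - (?l * ?x z)) = L2_norm \<Omega> (S t (u h))"
      using x h assms u by (intro L2_norm_cong L2_diff L2_divide L2_minus L2_scale S_L2 e_L2)
    then show ?thesis using K[OF u] by simp
  qed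
  have "((\<lambda>h. L2_norm \<Omega> (\<lambda>z. (S h ?x z - ?x z) / h - - (?l * ?x z))) \<longlongrightarrow> 0) (at_right 0)"
    by (rule Lim_null_comparison[OF _ limK])
      (use bound in \<open>auto simp: eventually_at_right_field intro: exI[of _ 1]\<close>)
  then show ?thesis
    using x by (subst S_generator) (auto intro: L2_minus L2_scale)
qed

text \<open>By \<open>S_eigenfunction\<close> both functions satisfy eigenvalue equations, and a
  symmetric operator has orthogonal eigenspaces.\<close>

lemma S_eigenfunction_orthogonal:
  assumes "t \<ge> 0" "lam j \<noteq> lam k"
  shows "L2_inner \<Omega> (S t (e j)) (e k) = 0"
  using dirichlet_laplacian_symmetric[OF open_domain S_eigenfunction[OF assms(1), of j] eigenfunction[of k]]
    assms(2)
  by (simp add: L2_inner_minus_left L2_inner_minus_right L2_inner_scale_left L2_inner_scale_right)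

text \<open>At fixed \<open>t\<close> the operator is linear and bounded, so it may be applied to
  the eigenfunction expansion term by term.\<close>

lemma S_inner_expansion:
  assumes "t \<ge> 0" "f \<in> L2 \<Omega>"
  shows "(\<lambda>N. \<Sum>j<N. L2_inner \<Omega> f (e j) * L2_inner \<Omega> (S t (e j)) (e k))
    \<longlonglongrightarrow> L2_inner \<Omega> (S t f) (e k)"
proof -
  define a where "a j = L2_inner \<Omega> f (e j)" for j
  define g where "g N x = (\<Sum>j<N. a j * e j x)" for N x
  define h where "h N x = (\<Sum>j<N. a j * S t (e j) x)" for N x
  have g: "g N \<in> L2 \<Omega>" for N
    unfolding g_def by (intro L2_sum L2_scale e_L2)
  have h: "h N \<in> L2 \<Omega>" for N
    unfolding h_def using assms(1) by (intro L2_sum L2_scale S_L2 e_L2)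
  obtain K where K: "\<And>f. f \<in> L2 \<Omega> \<Longrightarrow> L2_norm \<Omega> (S t f) \<le> K * L2_norm \<Omega> f"
    using S_bounded[OF assms(1)] by blast
  have gh: "L2_eq \<Omega> (S t (g N)) (h N)" for N
  proof (induction N)
    case 0
    have "L2_norm \<Omega> (S t (\<lambda>x. 0)) \<le> 0"
      using K[OF L2_zero] by (simp add: L2_norm_def)
    then have "L2_norm \<Omega> (S t (\<lambda>x. 0)) = 0"
      using L2_norm_nonneg[of \<Omega> "S t (\<lambda>x. 0)"] by linarith
    then show ?case
      using L2_norm_eq_0_iff[OF S_L2[OF assms(1) L2_zero]] by (simp add: g_def[abs_def] h_def[abs_def])
  next
    case (Suc N)
    have "L2_eq \<Omega> (S t (\<lambda>x. g N x + a N * e N x)) (\<lambda>x. S t (g N) x + a N * S t (e N) x)"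
      using assms(1) g e_L2 by (rule S_linear)
    moreover have "g (Suc N) = (\<lambda>x. g N x + a N * e N x)" "h (Suc N) = (\<lambda>x. h N x + a N * S t (e N) x)"
      by (simp_all add: g_def h_def fun_eq_iff)
    ultimately show ?case
      using Suc unfolding L2_eq_def by (auto elim: eventually_elim2)
  qed
  have bound: "L2_norm \<Omega> (\<lambda>x. h N x - S t f x) \<le> K * L2_norm \<Omega> (\<lambda>x. f x - g N x)" for N
  proof -
    have fg: "(\<lambda>x. f x + (-1) * g N x) \<in> L2 \<Omega>"
      using assms(2) g by (intro L2_add L2_scale)
    have "L2_eq \<Omega> (S t (\<lambda>x. f x + (-1) * g N x)) (\<lambda>x. S t f x + (-1) * S t (g N) x)"
      using assms g by (intro S_linear)
    then have "L2_eq \<Omega> (S t (\<lambda>x. f x + (-1) * g N x)) (\<lambda>x. S t f x - h N x)"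
      using gh[of N] unfolding L2_eq_def by eventually_elim simp
    then have "L2_norm \<Omega> (S t (\<lambda>x. f x + (-1) * g N x)) = L2_norm \<Omega> (\<lambda>x. S t f x - h N x)"
      using assms h fg by (intro L2_norm_cong S_L2 L2_diff)
    then show ?thesis
      using K[OF fg] by (simp add: L2_norm_diff_commute[of \<Omega> "h N"])
  qed
  have lim: "(\<lambda>N. K * L2_norm \<Omega> (\<lambda>x. f x - g N x)) \<longlonglongrightarrow> 0"
    unfolding g_def a_def by (intro tendsto_mult_right_zero e_expansion assms)
  have "(\<lambda>N. L2_norm \<Omega> (\<lambda>x. h N x - S t f x)) \<longlonglongrightarrow> 0"
    by (rule Lim_null_comparison[OF _ lim]) (simp add: bound)
  then have "(\<lambda>N. L2_inner \<Omega> (h N) (e k)) \<longlonglongrightarrow> L2_inner \<Omega> (S t f) (e k)"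
    using h assms by (intro L2_inner_tendsto) (auto intro: S_L2 e_L2)
  moreover have "L2_inner \<Omega> (h N) (e k) = (\<Sum>j<N. a j * L2_inner \<Omega> (S t (e j)) (e k))" for N
    unfolding h_def using assms(1)
    by (simp add: L2_inner_sum_left L2_scale S_L2 e_L2 L2_inner_scale_left)
  ultimately show ?thesis by (simp add: a_def)
qed

lemma S_inner_finite_expansion:
  assumes "t \<ge> 0" "f \<in> L2 \<Omega>" "finite E" "\<And>j. j \<notin> E \<Longrightarrow> L2_inner \<Omega> f (e j) * L2_inner \<Omega> (S t (e j)) (e k) = 0"
  shows "L2_inner \<Omega> (S t f) (e k) = (\<Sum>j\<in>E. L2_inner \<Omega> f (e j) * L2_inner \<Omega> (S t (e j)) (e k))"
proof (rule LIMSEQ_unique[OF S_inner_expansion[OF assms(1,2)]])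
  show "(\<lambda>N. \<Sum>j<N. L2_inner \<Omega> f (e j) * L2_inner \<Omega> (S t (e j)) (e k))
      \<longlonglongrightarrow> (\<Sum>j\<in>E. L2_inner \<Omega> f (e j) * L2_inner \<Omega> (S t (e j)) (e k))"
    using sums_finite[OF assms(3), of "\<lambda>j. L2_inner \<Omega> f (e j) * L2_inner \<Omega> (S t (e j)) (e k)"] assms(4)
    by (simp add: sums_def)
qed

text \<open>
  No bound on \<open>S t\<close> uniform in \<open>t\<close> is available, but the orbit of \<open>e j\<close> stays in the eigenspace of
  \<open>lam j\<close>, which is finite-dimensional. There \<open>exp (lam j * t) S t\<close> is a matrix semigroup with
  generator \<open>0\<close>.
\<close>

lemma S_eigenfunction_inner:
  assumes "t \<ge> 0"
  shows "L2_inner \<Omega> (S t (e j)) (e k) = exp (- (lam j * t)) * (if j = k then 1 else 0)"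
proof (cases "lam j = lam k \<and> t > 0")
  case False
  consider "t = 0" | "lam j \<noteq> lam k" using False assms by force
  then show ?thesis
  proof cases
    case 1
    then show ?thesis
      using L2_inner_cong[OF S_0[OF e_L2] S_L2[OF _ e_L2] e_L2 e_L2] by (simp add: e_inner)
  qed (use S_eigenfunction_orthogonal[OF assms] in auto)
next
  case True
  define l where "l = lam j"
  define E where "E = {i. lam i = l}"
  have E: "finite E" "j \<in> E" "k \<in> E"
  proof -
    have "E \<subseteq> {i. lam i \<le> l}" by (auto simp: E_def)
    then show "finite E" using finite_lam_le by (rule finite_subset)
  qed (use True in \<open>auto simp: E_def l_def\<close>)
  define \<delta> where "\<delta> i i' = (if i = i' then 1 else 0 :: real)" for i i' :: nat
  define p where "p i i' s = L2_inner \<Omega> (S s (e i)) (e i')" for i i' s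
  \<comment> \<open>\<open>R\<close> measures how far the matrix \<open>exp (l * s) * p\<close> is
    from the identity, and \<open>q\<close> is its entrywise norm. By \<open>R_add\<close>,
    \<open>1 + q\<close> is submultiplicative, so \<open>submultiplicative_vanishes\<close>
    applies.\<close>
  define R where "R i i' s = exp (l * s) * p i i' s - \<delta> i i'" for i i' s
  define q where "q s = (\<Sum>i\<in>E. \<Sum>i'\<in>E. \<bar>R i i' s\<bar>)" for s
  have q_nonneg: "0 \<le> q s" for s
    unfolding q_def by (intro sum_nonneg) auto
  \<comment> \<open>The semigroup law as a matrix product: by orthogonality the expansion of
    \<open>S r (e i)\<close> has no terms outside \<open>E\<close>.\<close>
  have p_add: "p i i' (s + r) = (\<Sum>n\<in>E. p i n r * p n i' s)"
    if "i \<in> E" "i' \<in> E" "0 < s" "0 < r" for i i' s r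
  proof -
    have "p i i' (s + r) = L2_inner \<Omega> (S s (S r (e i))) (e i')"
      unfolding p_def using that by (intro L2_inner_cong S_add S_L2 e_L2) auto
    also have "\<dots> = (\<Sum>n\<in>E. p i n r * p n i' s)"
      unfolding p_def using that
      by (intro S_inner_finite_expansion S_L2 e_L2 E)
        (auto simp: E_def intro!: S_eigenfunction_orthogonal)
    finally show ?thesis .
  qed
  have R_add: "R i i' (s + r) = (\<Sum>n\<in>E. R i n r * R n i' s) + R i i' r + R i i' s"
    if i: "i \<in> E" "i' \<in> E" "0 < s" "0 < r" for i i' s r
  proof -
    have "exp (l * (s + r)) * p i i' (s + r)
        = (\<Sum>n\<in>E. (R i n r + \<delta> i n) * (R n i' s + \<delta> n i'))"
      unfolding p_add[OF i] by (simp add: R_def distrib_left exp_add sum_distrib_left mult_ac)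
    also have "\<dots> = (\<Sum>n\<in>E. R i n r * R n i' s) + (\<Sum>n\<in>E. R i n r * \<delta> n i')
        + (\<Sum>n\<in>E. \<delta> i n * R n i' s) + (\<Sum>n\<in>E. \<delta> i n * \<delta> n i')"
      by (simp add: algebra_simps sum.distrib)
    also have "(\<Sum>n\<in>E. R i n r * \<delta> n i') = R i i' r"
      using E i by (simp add: \<delta>_def if_distrib[of "\<lambda>x. _ * x"] sum.delta cong: if_cong)
    also have "(\<Sum>n\<in>E. \<delta> i n * R n i' s) = R i i' s"
      using E i by (simp add: \<delta>_def if_distrib[of "\<lambda>x. x * _"] sum.delta cong: if_cong)
    also have "(\<Sum>n\<in>E. \<delta> i n * \<delta> n i') = \<delta> i i'"
      using E i by (simp add: \<delta>_def if_distrib[of "\<lambda>x. x * _"] sum.delta cong: if_cong)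
    finally show ?thesis by (simp add: R_def)
  qed
  have "1 + q (s + r) \<le> (1 + q s) * (1 + q r)" if "0 < s" "0 < r" for s r
  proof -
    have "q (s + r) \<le> (\<Sum>i\<in>E. \<Sum>i'\<in>E. (\<Sum>n\<in>E. \<bar>R i n r\<bar> * \<bar>R n i' s\<bar>) + \<bar>R i i' r\<bar> + \<bar>R i i' s\<bar>)"
      unfolding q_def
    proof (intro sum_mono)
      fix i i' assume i: "i \<in> E" "i' \<in> E"
      have "\<bar>\<Sum>n\<in>E. R i n r * R n i' s\<bar> \<le> (\<Sum>n\<in>E. \<bar>R i n r\<bar> * \<bar>R n i' s\<bar>)"
        by (rule order_trans[OF sum_abs]) (simp add: abs_mult)
      then show "\<bar>R i i' (s + r)\<bar> \<le> (\<Sum>n\<in>E. \<bar>R i n r\<bar> * \<bar>R n i' s\<bar>) + \<bar>R i i' r\<bar> + \<bar>R i i' s\<bar>"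
        unfolding R_add[OF i that] by linarith
    qed
    also have "\<dots> = (\<Sum>i\<in>E. \<Sum>i'\<in>E. \<Sum>n\<in>E. \<bar>R i n r\<bar> * \<bar>R n i' s\<bar>) + q r + q s"
      by (simp add: sum.distrib q_def)
    also have "(\<Sum>i\<in>E. \<Sum>i'\<in>E. \<Sum>n\<in>E. \<bar>R i n r\<bar> * \<bar>R n i' s\<bar>)
        = (\<Sum>n\<in>E. (\<Sum>i\<in>E. \<bar>R i n r\<bar>) * (\<Sum>i'\<in>E. \<bar>R n i' s\<bar>))"
    proof -
      have "(\<Sum>i\<in>E. \<Sum>i'\<in>E. \<Sum>n\<in>E. \<bar>R i n r\<bar> * \<bar>R n i' s\<bar>)
          = (\<Sum>i\<in>E. \<Sum>n\<in>E. \<Sum>i'\<in>E. \<bar>R i n r\<bar> * \<bar>R n i' s\<bar>)"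
        by (intro sum.cong refl sum.swap)
      also have "\<dots> = (\<Sum>n\<in>E. \<Sum>i\<in>E. \<Sum>i'\<in>E. \<bar>R i n r\<bar> * \<bar>R n i' s\<bar>)"
        by (rule sum.swap)
      finally show ?thesis by (simp add: sum_product)
    qed
    also have "\<dots> \<le> (\<Sum>n\<in>E. \<Sum>i\<in>E. \<bar>R i n r\<bar>) * (\<Sum>n\<in>E. \<Sum>i'\<in>E. \<bar>R n i' s\<bar>)"
      by (intro sum_mult_le_mult_sum E sum_nonneg) auto
    also have "(\<Sum>n\<in>E. \<Sum>i\<in>E. \<bar>R i n r\<bar>) = q r"
      unfolding q_def by (rule sum.swap)
    finally have "q (s + r) \<le> q r * q s + q r + q s"
      unfolding q_def[of s] by simp
    then show ?thesis by (simp add: algebra_simps)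
  qed
  moreover have "((\<lambda>h. q h / h) \<longlongrightarrow> 0) (at_right 0)"
  proof -
    have "((\<lambda>h. R i i' h / h) \<longlongrightarrow> 0) (at_right 0)" if i: "i \<in> E" for i i'
    proof -
      \<comment> \<open>\<open>D h\<close> is the defect of the generator relation, which tends to
        0; the rest of \<open>R i i' h / h\<close> comes from
        \<open>exp (l * h) * (1 - l * h)\<close>, whose derivative at 0 vanishes.\<close>
      define D where "D h = L2_inner \<Omega> (\<lambda>x. (S h (e i) x - e i x) / h) (e i') + l * \<delta> i i'" for h
      have lim: "((\<lambda>h. L2_norm \<Omega> (\<lambda>x. (S h (e i) x - e i x) / h - - (lam i * e i x))) \<longlongrightarrow> 0) (at_right 0)"
        using eigenfunction[of i] by (subst (asm) S_generator[OF e_L2 L2_minus[OF L2_scale[OF e_L2]]])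
      have "((\<lambda>h. L2_inner \<Omega> (\<lambda>x. (S h (e i) x - e i x) / h) (e i'))
          \<longlongrightarrow> L2_inner \<Omega> (\<lambda>x. - (lam i * e i x)) (e i')) (at_right 0)"
        by (rule L2_inner_tendsto[OF _ _ _ lim])
          (auto simp: eventually_at_right_field
            intro!: e_L2 L2_minus L2_scale exI[of _ 1] L2_divide L2_diff S_L2)
      then have "(D \<longlongrightarrow> L2_inner \<Omega> (\<lambda>x. - (lam i * e i x)) (e i') + l * \<delta> i i') (at_right 0)"
        unfolding D_def by (intro tendsto_add tendsto_const)
      moreover have "L2_inner \<Omega> (\<lambda>x. - (lam i * e i x)) (e i') + l * \<delta> i i' = 0"
        using i by (simp add: E_def L2_inner_minus_left L2_inner_scale_left e_inner \<delta>_def)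
      ultimately have D: "(D \<longlongrightarrow> 0) (at_right 0)" by simp
      have "((\<lambda>h. exp (l * h) * (1 - l * h)) has_real_derivative 0) (at 0)"
        by (auto intro!: derivative_eq_intros)
      then have "((\<lambda>h. (exp (l * h) * (1 - l * h) - 1) / h) \<longlongrightarrow> 0) (at 0)"
        by (simp add: DERIV_def)
      then have A: "((\<lambda>h. (exp (l * h) * (1 - l * h) - 1) / h) \<longlongrightarrow> 0) (at_right 0)"
        by (rule tendsto_within_subset) simp
      have "((\<lambda>h. exp (l * h) * D h + \<delta> i i' * ((exp (l * h) * (1 - l * h) - 1) / h))
          \<longlongrightarrow> exp (l * 0) * 0 + \<delta> i i' * 0) (at_right 0)"
        by (intro tendsto_intros D A)
      moreover have "\<forall>\<^sub>F h in at_right 0. exp (l * h) * D h + \<delta> i i' * ((exp (l * h) * (1 - l * h) - 1) / h)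
          = R i i' h / h"
      proof -
        have "exp (l * h) * D h + \<delta> i i' * ((exp (l * h) * (1 - l * h) - 1) / h) = R i i' h / h"
          if "h > 0" for h
        proof -
          have "D h = (p i i' h - \<delta> i i') / h + l * \<delta> i i'"
            unfolding D_def p_def using that
            by (simp add: L2_inner_divide_left L2_inner_diff_left S_L2 e_L2 e_inner \<delta>_def)
          then have p_eq: "p i i' h = h * D h + \<delta> i i' - h * (l * \<delta> i i')"
            using that by (simp add: field_simps)
          show ?thesis
            unfolding R_def p_eq using that by (simp add: field_simps)
        qed
        then show ?thesis by (auto simp: eventually_at_right_field intro: exI[of _ 1])
      qed
      ultimately show ?thesis by (simp add: tendsto_cong)
    qed
    then have "((\<lambda>h. \<Sum>i\<in>E. \<Sum>i'\<in>E. \<bar>R i i' h / h\<bar>) \<longlongrightarrow> (\<Sum>i\<in>E. \<Sum>i'\<in>E. \<bar>0\<bar>)) (at_right 0)"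
      by (intro tendsto_sum tendsto_rabs)
    moreover have "\<forall>\<^sub>F h in at_right 0. (\<Sum>i\<in>E. \<Sum>i'\<in>E. \<bar>R i i' h / h\<bar>) = q h / h"
      by (auto simp: eventually_at_right_field q_def sum_divide_distrib intro!: exI[of _ 1])
    ultimately show ?thesis by (simp add: tendsto_cong)
  qed
  ultimately have "q t = 0"
    using q_nonneg True by (intro submultiplicative_vanishes) auto
  then have "R j k t = 0"
    using E unfolding q_def by (simp add: sum_nonneg_eq_0_iff sum_nonneg)
  then have "exp (l * t) * p j k t = \<delta> j k" by (simp add: R_def)
  then have "p j k t = exp (- (l * t)) * \<delta> j k"
    by (simp add: exp_minus field_simps)
  then show ?thesis by (simp add: p_def l_def \<delta>_def)
qed

text \<open>By the preceding lemma only the index \<open>k\<close> contributes: every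
  \<open>S\<close> with \<open>dirichlet_heat_semigroup \<Omega> S\<close> is diagonal in this
  basis.\<close>

lemma S_coefficient:
  assumes "t \<ge> 0" "f \<in> L2 \<Omega>"
  shows "L2_inner \<Omega> (S t f) (e k) = exp (- (lam k * t)) * L2_inner \<Omega> f (e k)"
  using S_inner_finite_expansion[OF assms, of "{k}" k] S_eigenfunction_inner[OF assms(1)]
  by simp

end

section \<open>Decoupling of the heat equation with memory\<close>

lemma differentiable_halfline_bounded:
  fixes f :: "real \<Rightarrow> real"
  assumes "\<And>t. t \<ge> 0 \<Longrightarrow> (f has_real_derivative f' t) (at t within {0..})"
  shows "\<exists>B. \<forall>s\<in>{0..T}. \<bar>f s\<bar> \<le> B"
proof -
  have "continuous_on {0..} f"
    by (rule DERIV_continuous_on[of _ _ f']) (use assms in auto)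
  then have "continuous_on {0..T} f"
    by (rule continuous_on_subset) auto
  then have "bounded (f ` {0..T})"
    by (intro compact_imp_bounded compact_continuous_image) auto
  then show ?thesis by (auto simp: bounded_iff)
qed

lemma C2_halfline_bounded:
  assumes "C2_halfline M"
  shows "\<exists>m. \<forall>s\<in>{0..T}. \<bar>M s\<bar> \<le> m"
  using assms differentiable_halfline_bounded[of M] unfolding C2_halfline_def by blast

lemma C2_halfline_Lipschitz:
  assumes "C2_halfline M"
  shows "\<exists>L. \<forall>s\<in>{0..T}. \<forall>s'\<in>{0..T}. \<bar>M s - M s'\<bar> \<le> L * \<bar>s - s'\<bar>"
proof -
  obtain M' M'' where
    M': "\<And>t. t \<ge> 0 \<Longrightarrow> (M has_real_derivative M' t) (at t within {0..})" and
    M'': "\<And>t. t \<ge> 0 \<Longrightarrow> (M' has_real_derivative M'' t) (at t within {0..})"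
    using assms unfolding C2_halfline_def by blast
  obtain L where L: "\<forall>s\<in>{0..T}. \<bar>M' s\<bar> \<le> L"
    using differentiable_halfline_bounded[OF M''] by blast
  have "(M has_real_derivative M' r) (at r within {0..T})" if "r \<in> {0..T}" for r
    using that by (intro has_field_derivative_subset[OF M']) auto
  then show ?thesis
    using field_differentiable_bound[of "{0..T}" M M' L] L by (intro exI[of _ L]) auto
qed

text \<open>The asymptotics control all but finitely many indices; this turns them into constants
  valid for every \<open>k\<close>.\<close>

lemma bounded_except_finite:
  fixes f :: "nat \<Rightarrow> real"
  assumes "finite A" "\<And>k. k \<notin> A \<Longrightarrow> f k \<le> B"
  shows "\<exists>C>0. \<forall>k. f k \<le> C"
proof (intro exI conjI allI)
  show "1 + \<bar>B\<bar> + (\<Sum>k\<in>A. \<bar>f k\<bar>) > 0"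
    by (intro add_pos_nonneg sum_nonneg) auto
  fix k
  show "f k \<le> 1 + \<bar>B\<bar> + (\<Sum>k\<in>A. \<bar>f k\<bar>)"
  proof (cases "k \<in> A")
    case True
    then show ?thesis
      using member_le_sum[of k A "\<lambda>k. \<bar>f k\<bar>"] assms(1) by auto
  next
    case False
    have "0 \<le> (\<Sum>k\<in>A. \<bar>f k\<bar>)" by (intro sum_nonneg) auto
    then show ?thesis using assms(2)[OF False] by linarith
  qed
qed

text \<open>Passes from observation on \<open>\<omega> j\<close> to observation on all of \<Omega>;
  openness of \<open>U\<close> provides measurability.\<close>

lemma L2_norm_open_subset_le:
  assumes "open \<Omega>" "open U" "f \<in> L2 \<Omega>"
  shows "L2_norm (U \<inter> \<Omega>) f \<le> L2_norm \<Omega> f"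
proof -
  have sets: "\<Omega> \<inter> space lebesgue \<in> sets lebesgue" "(U \<inter> \<Omega>) \<inter> space lebesgue \<in> sets lebesgue"
    "U \<in> sets lebesgue"
    using assms(1,2) by auto
  have int: "integrable lebesgue (\<lambda>x. indicator \<Omega> x *\<^sub>R (f x)\<^sup>2)"
    using L2_integrable_square[OF assms(3)] unfolding integrable_restrict_space[OF sets(1)] .
  have eq: "indicator (U \<inter> \<Omega>) x *\<^sub>R (f x)\<^sup>2 = indicator U x *\<^sub>R (indicator \<Omega> x *\<^sub>R (f x)\<^sup>2)" for x
    by (simp add: indicator_def)
  show ?thesis
    unfolding L2_norm_def integral_restrict_space[OF sets(1)] integral_restrict_space[OF sets(2)] eq
    by (intro real_sqrt_le_mono integral_mono int integrable_mult_indicator sets)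
      (auto simp: indicator_def)
qed

text \<open>Pairing with \<open>e k\<close> commutes with both integrals of the mild formulation,
  and \<open>S_coefficient\<close> replaces the hidden semigroup by the exponential kernel.\<close>

lemma (in dirichlet_spectrum) mild_solution_mode:
  assumes "mild_solution \<Omega> M y0 y" "y0 \<in> L2 \<Omega>" "T > 0"
    and bound: "\<And>s. s \<in> {0..T} \<Longrightarrow> \<bar>M s\<bar> \<le> m"
  obtains w where
    "memory_mode M (lam k) (L2_inner \<Omega> y0 (e k)) T m (\<lambda>t. L2_inner \<Omega> (y t) (e k)) w"
proof -
  have y: "\<And>t. t \<ge> 0 \<Longrightarrow> y t \<in> L2 \<Omega>"
    "\<And>t. t \<ge> 0 \<Longrightarrow> ((\<lambda>s. L2_norm \<Omega> (\<lambda>x. y s x - y t x)) \<longlongrightarrow> 0) (at t within {0..})"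
    using assms(1) unfolding mild_solution_def by auto
  obtain S w where "dirichlet_heat_semigroup \<Omega> S"
    and w: "\<And>s. s \<ge> 0 \<Longrightarrow> has_L2_integral \<Omega> (\<lambda>\<tau> x. M (s - \<tau>) * y \<tau> x) (w s) 0 s"
    and Duhamel: "\<And>t. t \<ge> 0 \<Longrightarrow> \<exists>z. has_L2_integral \<Omega> (\<lambda>s. S (t - s) (w s)) z 0 t \<and>
      L2_eq \<Omega> (y t) (\<lambda>x. S t y0 x - z x)"
    using assms(1) unfolding mild_solution_def by blast
  then interpret heat_semigroup \<Omega> lam e S
    by unfold_locales
  have w_L2: "w s \<in> L2 \<Omega>" if "s \<ge> 0" for s
    using w[OF that] by (simp add: has_L2_integral_def)
  show ?thesis
  proof (rule that[of "\<lambda>s. L2_inner \<Omega> (w s) (e k)"], unfold_locales)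
    show "continuous_on {0..T} (\<lambda>t. L2_inner \<Omega> (y t) (e k))"
      unfolding continuous_on_def
    proof
      fix t assume t: "t \<in> {0..T}"
      have "((\<lambda>t. L2_inner \<Omega> (y t) (e k)) \<longlongrightarrow> L2_inner \<Omega> (y t) (e k)) (at t within {0..})"
        using t y by (intro L2_inner_tendsto e_L2) (auto simp: eventually_at_filter)
      then show "((\<lambda>t. L2_inner \<Omega> (y t) (e k)) \<longlongrightarrow> L2_inner \<Omega> (y t) (e k)) (at t within {0..T})"
        by (rule tendsto_within_subset) auto
    qed
    fix s assume s: "s \<in> {0..T}"
    show "((\<lambda>\<tau>. M (s - \<tau>) * L2_inner \<Omega> (y \<tau>) (e k)) has_integral L2_inner \<Omega> (w s) (e k)) {0..s}"
      using has_L2_integral_inner[OF w e_L2, of s k] s by (simp add: L2_inner_scale_left)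
  next
    fix t assume t: "t \<in> {0..T}"
    obtain z where z: "has_L2_integral \<Omega> (\<lambda>s. S (t - s) (w s)) z 0 t"
      "L2_eq \<Omega> (y t) (\<lambda>x. S t y0 x - z x)"
      using Duhamel[of t] t by auto
    have z_L2: "z \<in> L2 \<Omega>" using z(1) by (simp add: has_L2_integral_def)
    have t0: "t \<ge> 0" using t by simp
    have "L2_inner \<Omega> (y t) (e k) = L2_inner \<Omega> (\<lambda>x. S t y0 x - z x) (e k)"
      using z z_L2 t0 assms(2) y by (intro L2_inner_cong e_L2 L2_diff S_L2)
    also have "\<dots> = exp (- (lam k * t)) * L2_inner \<Omega> y0 (e k) - L2_inner \<Omega> z (e k)"
      using t0 z_L2 assms(2) by (simp add: L2_inner_diff_left S_L2 e_L2 S_coefficient)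
    finally have eq: "exp (- (lam k * t)) * L2_inner \<Omega> y0 (e k) - L2_inner \<Omega> (y t) (e k)
        = L2_inner \<Omega> z (e k)" by simp
    have "((\<lambda>s. L2_inner \<Omega> (S (t - s) (w s)) (e k)) has_integral L2_inner \<Omega> z (e k)) {0..t}"
      using z(1) e_L2 by (rule has_L2_integral_inner)
    then show "((\<lambda>s. exp (- (lam k * (t - s))) * L2_inner \<Omega> (w s) (e k)) has_integral
        exp (- (lam k * t)) * L2_inner \<Omega> y0 (e k) - L2_inner \<Omega> (y t) (e k)) {0..t}"
      unfolding eq by (rule has_integral_eq[rotated]) (simp add: S_coefficient w_L2)
  qed (use assms(3) bound lam_pos in auto)
qed

section \<open>Multipliers and two-sided estimates\<close>

locale heat_memory = dirichlet_spectrum \<Omega> lam e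
  for \<Omega> :: "(real^'n::finite) set" and lam e +
  fixes M :: "real \<Rightarrow> real" and Y :: "(real^'n \<Rightarrow> real) \<Rightarrow> real \<Rightarrow> real^'n \<Rightarrow> real"
  assumes kernel: "C2_halfline M"
    and solution: "y0 \<in> L2 \<Omega> \<Longrightarrow> mild_solution \<Omega> M y0 (Y y0)"
begin

text \<open>The scalar mode with initial value 1, read off from the given solution starting at
  \<open>e k\<close>, so that its existence needs no separate construction.\<close>

definition multiplier :: "nat \<Rightarrow> real \<Rightarrow> real" where
  "multiplier k t = L2_inner \<Omega> (Y (e k) t) (e k)"

lemma Y_L2: "y0 \<in> L2 \<Omega> \<Longrightarrow> t > 0 \<Longrightarrow> Y y0 t \<in> L2 \<Omega>"
  using solution by (auto simp: mild_solution_def)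

text \<open>The coefficient and \<open>?a\<close> times the multiplier solve the same scalar
  equation with the same initial value, so \<open>unique_zero\<close> applies to their difference.
  This stands in for linearity of \<open>Y\<close>, which is not among the assumptions.\<close>

lemma Y_coefficient:
  assumes "y0 \<in> L2 \<Omega>" "t > 0"
  shows "L2_inner \<Omega> (Y y0 t) (e k) = L2_inner \<Omega> y0 (e k) * multiplier k t"
proof -
  let ?a = "L2_inner \<Omega> y0 (e k)"
  let ?c = "\<lambda>s. L2_inner \<Omega> (Y y0 s) (e k)" and ?u = "\<lambda>s. multiplier k s"
  obtain m where m: "\<And>s. s \<in> {0..t} \<Longrightarrow> \<bar>M s\<bar> \<le> m"
    using C2_halfline_bounded[OF kernel] by blast
  obtain w where "memory_mode M (lam k) ?a t m ?c w"
    using mild_solution_mode[OF solution[OF assms(1)] assms m] by blast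
  then interpret c: memory_mode M "lam k" ?a t m ?c w .
  obtain v where "memory_mode M (lam k) 1 t m ?u v"
    using mild_solution_mode[OF solution[OF e_L2] e_L2 assms(2) m, of k k]
    by (auto simp: multiplier_def e_inner)
  then interpret u: memory_mode M "lam k" 1 t m ?u v .
  have "memory_mode M (lam k) 0 t m (\<lambda>s. ?c s - ?a * ?u s) (\<lambda>s. w s - ?a * v s)"
  proof unfold_locales
    show "continuous_on {0..t} (\<lambda>s. ?c s - ?a * ?u s)"
      by (intro continuous_intros c.c_cont u.c_cont)
    show "((\<lambda>\<tau>. M (s - \<tau>) * (?c \<tau> - ?a * ?u \<tau>)) has_integral w s - ?a * v s) {0..s}"
      if "s \<in> {0..t}" for s
      using has_integral_diff[OF c.w_integral[OF that] has_integral_mult_right[OF u.w_integral[OF that], of ?a]]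
      by (simp add: algebra_simps)
    show "((\<lambda>\<tau>. exp (- (lam k * (s - \<tau>))) * (w \<tau> - ?a * v \<tau>)) has_integral
        exp (- (lam k * s)) * 0 - (?c s - ?a * ?u s)) {0..s}" if "s \<in> {0..t}" for s
      using has_integral_diff[OF c.c_integral[OF that] has_integral_mult_right[OF u.c_integral[OF that], of ?a]]
      by (simp add: algebra_simps)
  qed (use assms m lam_pos in auto)
  from memory_mode.unique_zero[OF this, of t] assms(2) show ?thesis by simp
qed

lemma multiplier_asymptotics:
  assumes "t > 0" "\<epsilon> > 0"
  obtains \<Lambda> where "\<And>k. lam k > \<Lambda> \<Longrightarrow> \<bar>(lam k)\<^sup>2 * multiplier k t + M t\<bar> < \<epsilon>"
proof -
  obtain m where m: "\<And>s. s \<in> {0..t} \<Longrightarrow> \<bar>M s\<bar> \<le> m"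
    using C2_halfline_bounded[OF kernel] by blast
  obtain L where L: "\<And>s s'. s \<in> {0..t} \<Longrightarrow> s' \<in> {0..t} \<Longrightarrow> \<bar>M s - M s'\<bar> \<le> L * \<bar>s - s'\<bar>"
    using C2_halfline_Lipschitz[OF kernel] by blast
  obtain \<Lambda> where \<Lambda>: "\<And>l c w. \<Lambda> \<le> l \<Longrightarrow> large_memory_mode M l t m c w L \<Longrightarrow> \<bar>l\<^sup>2 * c t + M t\<bar> < \<epsilon>"
    using mode_asymptotics[OF assms] by blast
  show ?thesis
  \<comment> \<open>\<Lambda> serves the limit, \<open>2 * m * t\<close> the condition
    \<open>l_large\<close>.\<close>
  proof (rule that[of "max \<Lambda> (2 * m * t)"])
    fix k assume k: "lam k > max \<Lambda> (2 * m * t)"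
    obtain v where "memory_mode M (lam k) 1 t m (multiplier k) v"
      using mild_solution_mode[OF solution[OF e_L2] e_L2 assms(1) m, of k k]
      by (auto simp: multiplier_def[abs_def] e_inner)
    then have "large_memory_mode M (lam k) t m (multiplier k) v L"
      unfolding large_memory_mode_def large_memory_mode_axioms_def using k L by auto
    then show "\<bar>(lam k)\<^sup>2 * multiplier k t + M t\<bar> < \<epsilon>"
      using k by (intro \<Lambda>) auto
  qed
qed

lemma Y_norm_sums:
  assumes "y0 \<in> L2 \<Omega>" "t > 0"
  shows "(\<lambda>k. (L2_inner \<Omega> y0 (e k))\<^sup>2 * (multiplier k t)\<^sup>2) sums (L2_norm \<Omega> (Y y0 t))\<^sup>2"
  using Parseval[OF Y_L2[OF assms]] by (simp add: Y_coefficient[OF assms] power_mult_distrib)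

lemma lam_powr: "lam k powr (-4) = 1 / (lam k) ^ 4"
  using lam_pos[of k] by (simp add: powr_neg_numeral)

text \<open>Apart from finitely many \<open>k\<close> the weight is at most 1, so Parseval's series
  dominates. Without summability the infinite sum in \<open>Hs_norm\<close> would carry no
  information.\<close>

lemma Hs_norm_sums:
  assumes "y0 \<in> L2 \<Omega>"
  shows "(\<lambda>k. (L2_inner \<Omega> y0 (e k))\<^sup>2 * lam k powr (-4))
    sums (Hs_norm lam (-4) (\<lambda>k. L2_inner \<Omega> y0 (e k)))\<^sup>2"
proof -
  let ?f = "\<lambda>k. (L2_inner \<Omega> y0 (e k))\<^sup>2 * lam k powr (-4)"
  have le: "lam k powr (-4) \<le> 1" if "k \<notin> {k. lam k \<le> 1}" for k
    using that by (simp add: lam_powr)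
  have "\<exists>B>0. \<forall>k. lam k powr (-4) \<le> B"
    by (rule bounded_except_finite[OF finite_lam_le le])
  then obtain B where B: "B > 0" "\<And>k. lam k powr (-4) \<le> B" by blast
  have "summable ?f"
  proof (rule summable_comparison_test')
    show "summable (\<lambda>k. (L2_inner \<Omega> y0 (e k))\<^sup>2 * B)"
      using Parseval[OF assms] by (intro summable_mult2) (rule sums_summable)
    show "norm (?f k) \<le> (L2_inner \<Omega> y0 (e k))\<^sup>2 * B" for k
      using B(2)[of k] by (simp add: mult_left_mono)
  qed
  moreover have "0 \<le> (\<Sum>k. ?f k)"
    using \<open>summable ?f\<close> by (intro suminf_nonneg) auto
  ultimately show ?thesis
    by (simp add: Hs_norm_def summable_sums)
qed

lemma Hs_norm_nonneg: "y0 \<in> L2 \<Omega> \<Longrightarrow> 0 \<le> Hs_norm lam (-4) (\<lambda>k. L2_inner \<Omega> y0 (e k))"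
  unfolding Hs_norm_def
  by (intro real_sqrt_ge_zero suminf_nonneg sums_summable[OF Hs_norm_sums]) auto

text \<open>With \<open>Y_eigenfunction_norm\<close> this turns the lower estimate at
  \<open>e k\<close> into a lower bound for the multipliers.\<close>

lemma Hs_norm_eigenfunction: "Hs_norm lam (-4) (\<lambda>l. L2_inner \<Omega> (e k) (e l)) = 1 / (lam k)\<^sup>2"
proof -
  have "(\<lambda>l. (L2_inner \<Omega> (e k) (e l))\<^sup>2 * lam l powr (-4))
      = (\<lambda>l. if l = k then lam l powr (-4) else 0)"
    by (auto simp: e_inner fun_eq_iff)
  then have "(\<lambda>l. (L2_inner \<Omega> (e k) (e l))\<^sup>2 * lam l powr (-4)) sums (lam k powr (-4))"
    using sums_single[of k "\<lambda>l. lam l powr (-4)"] by simp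
  then have "(\<Sum>l. (L2_inner \<Omega> (e k) (e l))\<^sup>2 * lam l powr (-4)) = (1 / (lam k)\<^sup>2)\<^sup>2"
    by (simp add: sums_iff lam_powr power_divide)
  then show ?thesis by (simp add: Hs_norm_def)
qed

lemma Y_eigenfunction_norm:
  assumes "t > 0"
  shows "L2_norm \<Omega> (Y (e k) t) = \<bar>multiplier k t\<bar>"
proof -
  have "(\<lambda>l. (L2_inner \<Omega> (e k) (e l))\<^sup>2 * (multiplier l t)\<^sup>2)
      = (\<lambda>l. if l = k then (multiplier l t)\<^sup>2 else 0)"
    by (auto simp: e_inner fun_eq_iff)
  then have "(L2_norm \<Omega> (Y (e k) t))\<^sup>2 = (multiplier k t)\<^sup>2"
    using Y_norm_sums[OF e_L2 assms, of k] sums_single[of k "\<lambda>l. (multiplier l t)\<^sup>2"]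
    by (simp add: sums_iff)
  then show ?thesis
    by (metis L2_norm_nonneg abs_of_nonneg power2_eq_iff abs_minus_cancel)
qed

text \<open>The squared multipliers are compared with \<open>lam k powr (-4)\<close> term by term in
  Parseval's series; for boundedness the asymptotics with error 1 suffice.\<close>

lemma upper_estimate:
  assumes "t > 0"
  obtains C where "C > 0" "\<And>y0. y0 \<in> L2 \<Omega> \<Longrightarrow>
    L2_norm \<Omega> (Y y0 t) \<le> C * Hs_norm lam (-4) (\<lambda>k. L2_inner \<Omega> y0 (e k))"
proof -
  obtain \<Lambda> where \<Lambda>: "\<And>k. lam k > \<Lambda> \<Longrightarrow> \<bar>(lam k)\<^sup>2 * multiplier k t + M t\<bar> < 1"
    using multiplier_asymptotics[OF assms, of 1] by auto
  have le: "\<bar>(lam k)\<^sup>2 * multiplier k t\<bar> \<le> \<bar>M t\<bar> + 1" if "k \<notin> {k. lam k \<le> \<Lambda>}" for k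
    using \<Lambda>[of k] that by auto
  have "\<exists>B>0. \<forall>k. \<bar>(lam k)\<^sup>2 * multiplier k t\<bar> \<le> B"
    by (rule bounded_except_finite[OF finite_lam_le le])
  then obtain B where B: "B > 0" "\<And>k. \<bar>(lam k)\<^sup>2 * multiplier k t\<bar> \<le> B" by blast
  have le: "(multiplier k t)\<^sup>2 \<le> B\<^sup>2 * lam k powr (-4)" for k
  proof -
    have "\<bar>(lam k)\<^sup>2 * multiplier k t\<bar>\<^sup>2 \<le> B\<^sup>2"
      using B(2)[of k] by (intro power_mono) auto
    then have "(lam k) ^ 4 * (multiplier k t)\<^sup>2 \<le> B\<^sup>2"
      by (simp add: power_mult_distrib)
    then show ?thesis
      using lam_pos[of k] by (simp add: lam_powr field_simps)
  qed
  show ?thesis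
  proof (rule that[OF B(1)])
    fix y0 assume y0: "y0 \<in> L2 \<Omega>"
    let ?H = "Hs_norm lam (-4) (\<lambda>k. L2_inner \<Omega> y0 (e k))"
    have "(L2_norm \<Omega> (Y y0 t))\<^sup>2 \<le> B\<^sup>2 * ?H\<^sup>2"
    proof (rule sums_le[OF _ Y_norm_sums[OF y0 assms] sums_mult[OF Hs_norm_sums[OF y0]]])
      fix k show "(L2_inner \<Omega> y0 (e k))\<^sup>2 * (multiplier k t)\<^sup>2
          \<le> B\<^sup>2 * ((L2_inner \<Omega> y0 (e k))\<^sup>2 * lam k powr (-4))"
        using mult_left_mono[OF le[of k], of "(L2_inner \<Omega> y0 (e k))\<^sup>2"] by (simp add: mult_ac)
    qed
    then have "(L2_norm \<Omega> (Y y0 t))\<^sup>2 \<le> (B * ?H)\<^sup>2"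
      by (simp add: power_mult_distrib)
    then show "L2_norm \<Omega> (Y y0 t) \<le> B * ?H"
      by (rule power2_le_imp_le) (use B(1) Hs_norm_nonneg[OF y0] in simp)
  qed
qed

lemma lower_estimate:
  assumes "finite I" and t_pos: "\<And>j. j \<in> I \<Longrightarrow> t j > 0"
    and unique: "backward_uniqueness \<Omega> Y (t ` I)" and M_pos: "(\<Sum>j\<in>I. \<bar>M (t j)\<bar>) > 0"
  obtains c where "c > 0" "\<And>y0. y0 \<in> L2 \<Omega> \<Longrightarrow>
    c * Hs_norm lam (-4) (\<lambda>k. L2_inner \<Omega> y0 (e k)) \<le> (\<Sum>j\<in>I. L2_norm \<Omega> (Y y0 (t j)))"
proof -
  \<comment> \<open>The squared multipliers in units of \<open>lam k powr (-4)\<close>; the claim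
    amounts to a positive lower bound for \<open>v\<close>, uniform in \<open>k\<close>.\<close>
  define v where "v k = (\<Sum>j\<in>I. (multiplier k (t j))\<^sup>2) * (lam k) ^ 4" for k
  have v_pos: "v k > 0" for k
  proof -
    have "\<exists>j\<in>I. multiplier k (t j) \<noteq> 0"
    proof (rule ccontr)
      assume "\<not> ?thesis"
      then have "L2_eq \<Omega> (Y (e k) (t j)) (\<lambda>x. 0)" if "j \<in> I" for j
        using that t_pos[OF that] Y_eigenfunction_norm[of "t j" k]
        by (simp add: L2_norm_eq_0_iff[symmetric] Y_L2 e_L2)
      then have "L2_eq \<Omega> (e k) (\<lambda>x. 0)"
        using unique e_L2 unfolding backward_uniqueness_def by blast
      then show False
        using e_norm[of k] by (simp add: L2_norm_eq_0_iff[OF e_L2, symmetric])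
    qed
    then have "(\<Sum>j\<in>I. (multiplier k (t j))\<^sup>2) > 0"
      using assms(1) by (auto intro: sum_pos2)
    then show ?thesis using lam_pos[of k] by (simp add: v_def)
  qed
  obtain i where i: "i \<in> I" "M (t i) \<noteq> 0"
  proof -
    have "\<exists>i\<in>I. M (t i) \<noteq> 0"
      using M_pos by (rule contrapos_pp) simp
    then show ?thesis using that by blast
  qed
  \<comment> \<open>Half of the limit, so that \<open>(lam k)\<^sup>2 * multiplier k (t i)\<close>
    stays away from 0.\<close>
  define \<epsilon> where "\<epsilon> = \<bar>M (t i)\<bar> / 2"
  have \<epsilon>: "\<epsilon> > 0" using i by (simp add: \<epsilon>_def)
  obtain \<Lambda> where \<Lambda>: "\<And>k. lam k > \<Lambda> \<Longrightarrow> \<bar>(lam k)\<^sup>2 * multiplier k (t i) + M (t i)\<bar> < \<epsilon>"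
    using multiplier_asymptotics[OF t_pos[OF i(1)] \<epsilon>] by auto
  \<comment> \<open>Reciprocals, because \<open>bounded_except_finite\<close> gives upper bounds;
    positivity of \<open>v\<close> converts its conclusion into a lower bound for
    \<open>v\<close>.\<close>
  have le_large: "1 / v k \<le> 1 / \<epsilon>\<^sup>2" if "k \<notin> {k. lam k \<le> \<Lambda>}" for k
  proof -
    have "\<epsilon> \<le> \<bar>(lam k)\<^sup>2 * multiplier k (t i)\<bar>"
      using \<Lambda>[of k] that unfolding \<epsilon>_def mem_Collect_eq by linarith
    then have "\<epsilon>\<^sup>2 \<le> \<bar>(lam k)\<^sup>2 * multiplier k (t i)\<bar>\<^sup>2"
      using \<epsilon> by (intro power_mono) auto
    also have "\<dots> = (multiplier k (t i))\<^sup>2 * (lam k) ^ 4"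
      by (simp add: power_mult_distrib mult.commute)
    also have "\<dots> \<le> v k"
      unfolding v_def using assms(1) i(1) lam_pos[of k]
      by (intro mult_right_mono member_le_sum) auto
    finally show ?thesis using \<epsilon> by (intro divide_left_mono) (auto simp: v_pos)
  qed
  have "\<exists>B>0. \<forall>k. 1 / v k \<le> B"
    by (rule bounded_except_finite[OF finite_lam_le le_large])
  then obtain B where B: "B > 0" "\<And>k. 1 / v k \<le> B" by blast
  have le: "lam k powr (-4) / B \<le> (\<Sum>j\<in>I. (multiplier k (t j))\<^sup>2)" for k
    using B(2)[of k] v_pos[of k] B(1) lam_pos[of k]
    by (simp add: v_def lam_powr field_simps)
  show ?thesis
  proof (rule that[of "sqrt (1 / B)"])
    show "sqrt (1 / B) > 0" using B(1) by simp
    fix y0 assume y0: "y0 \<in> L2 \<Omega>"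
    let ?H = "Hs_norm lam (-4) (\<lambda>k. L2_inner \<Omega> y0 (e k))"
    have "?H\<^sup>2 / B \<le> (\<Sum>j\<in>I. (L2_norm \<Omega> (Y y0 (t j)))\<^sup>2)"
    proof (rule sums_le[OF _ sums_divide[OF Hs_norm_sums[OF y0]]
          sums_sum[OF Y_norm_sums[OF y0 t_pos]]])
      fix k show "(L2_inner \<Omega> y0 (e k))\<^sup>2 * lam k powr (-4) / B
          \<le> (\<Sum>j\<in>I. (L2_inner \<Omega> y0 (e k))\<^sup>2 * (multiplier k (t j))\<^sup>2)"
        using mult_left_mono[OF le[of k], of "(L2_inner \<Omega> y0 (e k))\<^sup>2"]
        by (simp add: sum_distrib_left)
    qed
    \<comment> \<open>Parseval yields squared norms while the estimate sums norms; the square of the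
      sum dominates.\<close>
    also have "\<dots> \<le> (\<Sum>j\<in>I. L2_norm \<Omega> (Y y0 (t j))) * (\<Sum>j\<in>I. L2_norm \<Omega> (Y y0 (t j)))"
      unfolding power2_eq_square using assms(1) by (intro sum_mult_le_mult_sum) auto
    finally have "(sqrt (1 / B) * ?H)\<^sup>2 \<le> (\<Sum>j\<in>I. L2_norm \<Omega> (Y y0 (t j)))\<^sup>2"
      using B(1) by (simp add: power_mult_distrib power2_eq_square[of "sum _ _"])
    then show "sqrt (1 / B) * ?H \<le> (\<Sum>j\<in>I. L2_norm \<Omega> (Y y0 (t j)))"
      by (rule power2_le_imp_le) (auto intro: sum_nonneg)
  qed
qed

end

text \<open>\<open>\<omega> j\<close> is relatively open in the closure and may contain boundary
  points, whereas elements of \<open>L2 \<Omega>\<close> are determined on \<Omega> alone; hence the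
  norms over \<open>\<omega> j \<inter> \<Omega>\<close>.\<close>

theorem theorem1p9:
  fixes \<Omega> :: "(real^'n::finite) set"
    and M :: "real \<Rightarrow> real"
    and lam :: "nat \<Rightarrow> real"
    and e :: "nat \<Rightarrow> real^'n \<Rightarrow> real"
    and Y :: "(real^'n \<Rightarrow> real) \<Rightarrow> real \<Rightarrow> real^'n \<Rightarrow> real"
    and m :: nat
    and t :: "nat \<Rightarrow> real"
  assumes "bounded_C2_domain \<Omega>"
    and "C2_halfline M"
    and "dirichlet_eigenbasis \<Omega> lam e"
    and "\<And>y0. y0 \<in> L2 \<Omega> \<Longrightarrow> mild_solution \<Omega> M y0 (Y y0)"
    and "m \<ge> 1"
    and "\<And>j. j \<in> {1..m} \<Longrightarrow> t j > 0"
  shows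
    "(\<exists>\<omega> :: nat \<Rightarrow> (real^'n) set. \<exists>C>0.
        (\<forall>j\<in>{1..m}. openin (top_of_set (closure \<Omega>)) (\<omega> j) \<and> \<omega> j \<noteq> {}) \<and>
        (\<forall>y0\<in>L2 \<Omega>.
           inverse C * Hs_norm lam (-4) (\<lambda>k. L2_inner \<Omega> y0 (e k))
             \<le> (\<Sum>j=1..m. L2_norm (\<omega> j \<inter> \<Omega>) (Y y0 (t j))) \<and>
           (\<Sum>j=1..m. L2_norm (\<omega> j \<inter> \<Omega>) (Y y0 (t j)))
             \<le> C * Hs_norm lam (-4) (\<lambda>k. L2_inner \<Omega> y0 (e k))))
     \<longleftrightarrow>
     (backward_uniqueness \<Omega> Y (t ` {1..m}) \<and> (\<Sum>j=1..m. \<bar>M (t j)\<bar>) > 0)"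
    (is "?observable \<longleftrightarrow> ?unique \<and> ?nonzero")
proof -
  interpret heat_memory \<Omega> lam e M Y
    using assms by unfold_locales (auto simp: bounded_C2_domain_def)
  note t_pos = assms(6)
  let ?H = "\<lambda>y0. Hs_norm lam (-4) (\<lambda>k. L2_inner \<Omega> y0 (e k))"
  show ?thesis
  proof
    assume ?observable
    then obtain \<omega> :: "nat \<Rightarrow> (real^'n) set" and C where C: "C > 0"
      and \<omega>: "\<And>j. j \<in> {1..m} \<Longrightarrow> openin (top_of_set (closure \<Omega>)) (\<omega> j)"
      and lower: "\<And>y0. y0 \<in> L2 \<Omega> \<Longrightarrow>
        inverse C * ?H y0 \<le> (\<Sum>j=1..m. L2_norm (\<omega> j \<inter> \<Omega>) (Y y0 (t j)))"
      by blast
    \<comment> \<open>The lower estimate survives enlarging every \<open>\<omega> j\<close> to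
      \<Omega>, where Parseval is available.\<close>
    have "L2_norm (\<omega> j \<inter> \<Omega>) (Y y0 (t j)) \<le> L2_norm \<Omega> (Y y0 (t j))"
      if y0: "y0 \<in> L2 \<Omega>" and j: "j \<in> {1..m}" for y0 j
    proof -
      obtain U where "open U" "\<omega> j = closure \<Omega> \<inter> U"
        using \<omega>[OF j] by (auto simp: openin_open)
      then have "\<omega> j \<inter> \<Omega> = U \<inter> \<Omega>" "open U"
        using closure_subset[of \<Omega>] by auto
      then show ?thesis
        using L2_norm_open_subset_le[OF open_domain _ Y_L2[OF y0 t_pos[OF j]]] by simp
    qed
    then have H_le: "inverse C * ?H y0 \<le> (\<Sum>j=1..m. L2_norm \<Omega> (Y y0 (t j)))" if "y0 \<in> L2 \<Omega>" for y0
      using that by (intro order_trans[OF lower] sum_mono)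
    have ?unique
      unfolding backward_uniqueness_def
    proof (intro ballI impI)
      fix y0 assume y0: "y0 \<in> L2 \<Omega>" and zero: "\<forall>s\<in>t ` {1..m}. L2_eq \<Omega> (Y y0 s) (\<lambda>x. 0)"
      have "L2_norm \<Omega> (Y y0 (t j)) = 0" if "j \<in> {1..m}" for j
        using zero that L2_norm_eq_0_iff[OF Y_L2[OF y0 t_pos[OF that]]] by auto
      then have "inverse C * ?H y0 \<le> 0" using H_le[OF y0] by simp
      then have "?H y0 = 0"
        using C Hs_norm_nonneg[OF y0] by (simp add: mult_le_0_iff)
      then have sums0: "(\<lambda>k. (L2_inner \<Omega> y0 (e k))\<^sup>2 * lam k powr (-4)) sums 0"
        using Hs_norm_sums[OF y0] by simp
      have "(L2_inner \<Omega> y0 (e k))\<^sup>2 * lam k powr (-4) = 0" for k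
        using suminf_eq_zero_iff[OF sums_summable[OF sums0]] sums_unique[OF sums0] by simp
      moreover have "lam k powr (-4) \<noteq> 0" for k
        using lam_pos[of k] by simp
      ultimately show "L2_eq \<Omega> y0 (\<lambda>x. 0)"
        unfolding L2_eq_0_iff_coefficients[OF y0] by simp
    qed
    moreover have ?nonzero
    proof (rule ccontr)
      assume "\<not> ?nonzero"
      moreover have "0 \<le> (\<Sum>j=1..m. \<bar>M (t j)\<bar>)"
        by (intro sum_nonneg) auto
      ultimately have "(\<Sum>j=1..m. \<bar>M (t j)\<bar>) = 0" by linarith
      then have M0: "M (t j) = 0" if "j \<in> {1..m}" for j
        using that by (simp add: sum_nonneg_eq_0_iff)
      \<comment> \<open>\<open>m\<close> summands below this \<epsilon> add up to less than
        \<open>inverse C\<close>, the amount that the lower estimate at \<open>e k\<close>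
        demands.\<close>
      define \<epsilon> where "\<epsilon> = inverse C / real m"
      have \<epsilon>: "\<epsilon> > 0" using C assms(5) by (simp add: \<epsilon>_def)
      have "\<exists>\<Lambda>. \<forall>k. lam k > \<Lambda> \<longrightarrow> \<bar>(lam k)\<^sup>2 * multiplier k (t j)\<bar> < \<epsilon>" if j: "j \<in> {1..m}" for j
        using multiplier_asymptotics[OF t_pos[OF j] \<epsilon>] M0[OF j] by (metis add.right_neutral)
      then obtain \<Lambda> where \<Lambda>: "\<And>j k. j \<in> {1..m} \<Longrightarrow> lam k > \<Lambda> j \<Longrightarrow> \<bar>(lam k)\<^sup>2 * multiplier k (t j)\<bar> < \<epsilon>"
        by metis
      \<comment> \<open>An eigenvalue beyond all \<open>m\<close> thresholds at once; the sum of
        absolute values dominates each of them.\<close>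
      obtain k where "k \<notin> {k. lam k \<le> (\<Sum>j=1..m. \<bar>\<Lambda> j\<bar>)}"
        using finite_lam_le ex_new_if_finite infinite_UNIV_nat by blast
      then have k: "lam k > \<Lambda> j" if "j \<in> {1..m}" for j
        using member_le_sum[of j "{1..m}" "\<lambda>j. \<bar>\<Lambda> j\<bar>"] that by auto
      have "inverse C * (1 / (lam k)\<^sup>2) \<le> (\<Sum>j=1..m. \<bar>multiplier k (t j)\<bar>)"
        using H_le[OF e_L2[of k]] t_pos by (simp add: Hs_norm_eigenfunction Y_eigenfunction_norm)
      then have "(lam k)\<^sup>2 * (inverse C * (1 / (lam k)\<^sup>2)) \<le> (lam k)\<^sup>2 * (\<Sum>j=1..m. \<bar>multiplier k (t j)\<bar>)"
        by (rule mult_left_mono) simp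
      also have "\<dots> = (\<Sum>j=1..m. \<bar>(lam k)\<^sup>2 * multiplier k (t j)\<bar>)"
        by (simp add: sum_distrib_left abs_mult)
      also have "\<dots> < (\<Sum>j=1..m. \<epsilon>)"
        using \<Lambda> k assms(5) by (intro sum_strict_mono) auto
      also have "\<dots> = inverse C"
        using assms(5) by (simp add: \<epsilon>_def)
      finally show False using lam_pos[of k] by simp
    qed
    ultimately show "?unique \<and> ?nonzero" ..
  next
    assume right: "?unique \<and> ?nonzero"
    obtain c where c: "c > 0" "\<And>y0. y0 \<in> L2 \<Omega> \<Longrightarrow> c * ?H y0 \<le> (\<Sum>j=1..m. L2_norm \<Omega> (Y y0 (t j)))"
      using lower_estimate[of "{1..m}" t] t_pos right by auto
    have "\<exists>B. \<forall>y0\<in>L2 \<Omega>. L2_norm \<Omega> (Y y0 (t j)) \<le> B * ?H y0" if "j \<in> {1..m}" for j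
      using upper_estimate[OF t_pos[OF that]] by metis
    then obtain B where B: "\<And>j y0. j \<in> {1..m} \<Longrightarrow> y0 \<in> L2 \<Omega> \<Longrightarrow> L2_norm \<Omega> (Y y0 (t j)) \<le> B j * ?H y0"
      by metis
    \<comment> \<open>The first entry serves the lower estimate, the second the upper one.\<close>
    define C where "C = max (1 / c) (\<Sum>j=1..m. B j)"
    have C: "C > 0" "inverse C \<le> c" "(\<Sum>j=1..m. B j) \<le> C"
    proof -
      have "1 / c \<le> C" "1 / c > 0" using c(1) by (auto simp: C_def)
      then show "C > 0" by linarith
      then show "inverse C \<le> c" using \<open>1 / c \<le> C\<close> c(1) by (simp add: field_simps)
      show "(\<Sum>j=1..m. B j) \<le> C" by (simp add: C_def)
    qed
    have \<Omega>: "closure \<Omega> \<inter> \<Omega> = \<Omega>" "closure \<Omega> \<noteq> {}"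
      using closure_subset[of \<Omega>] assms(1) by (auto simp: bounded_C2_domain_def)
    show ?observable
    proof (intro exI[of _ "\<lambda>_. closure \<Omega>"] exI[of _ C] conjI ballI)
      fix y0 assume y0: "y0 \<in> L2 \<Omega>"
      have "inverse C * ?H y0 \<le> c * ?H y0"
        using C Hs_norm_nonneg[OF y0] by (intro mult_right_mono) auto
      then show "inverse C * ?H y0 \<le> (\<Sum>j=1..m. L2_norm (closure \<Omega> \<inter> \<Omega>) (Y y0 (t j)))"
        unfolding \<Omega> using c(2)[OF y0] by linarith
      have "(\<Sum>j=1..m. L2_norm \<Omega> (Y y0 (t j))) \<le> (\<Sum>j=1..m. B j) * ?H y0"
        unfolding sum_distrib_right using B y0 by (intro sum_mono) auto
      also have "\<dots> \<le> C * ?H y0"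
        using C Hs_norm_nonneg[OF y0] by (intro mult_right_mono) auto
      finally show "(\<Sum>j=1..m. L2_norm (closure \<Omega> \<inter> \<Omega>) (Y y0 (t j))) \<le> C * ?H y0"
        unfolding \<Omega> .
    qed (simp_all add: C(1) \<Omega>(2) del: closure_eq_empty)
  qed
qed

end
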